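(* Let $0<p,q,M<\infty$ and let $\omega$ be a radial weight. Then the non-tangential maximal operator $N_M$ is bounded from $AL^q_p(\omega)$ to $L^q_p(\omega)$ and from $AT^q_p(\omega)$ to $T^q_p(\omega)$; that is, there is a constant $C>0$ such that $\|N_M(f)\|_{L^q_p(\omega)}\le C\|f\|_{L^q_p(\omega)}$ for all $f\in AL^q_p(\omega)$, and $\|N_M(f)\|_{T^q_p(\omega)}\le C\|f\|_{T^q_p(\omega)}$ for all $f\in AT^q_p(\omega)$.
   Context: $\mathbb{D}$ is the open unit disc, $\mathbb{T}=\partial\mathbb{D}$, $\mathcal{H}(\mathbb{D})$ is the space of analytic functions in $\mathbb{D}$, and $dA=\frac{dx\,dy}{\pi}$. A weight is a function $\omega:\mathbb{D}\to[0,\infty)$ integrable over $\mathbb{D}$; it is radial if $\omega(z)=\omega(|z|)$ for all $z\in\mathbb{D}$. Throughout, it is assumed that $\widehat{\omega}(z)=\int_{|z|}^1\omega(s)\,ds>0$ for all $z\in\mathbb{D}$. For $0<M<\infty$ and $\xi\in\overline{\mathbb{D}}$, $\Gamma_M(\xi)=\{z\in\mathbb{D}:|\arg z-\arg\xi|<M(|\xi|-|z|)\}$ (difference of arguments modulo $2\pi$), and $\Gamma(\xi)=\Gamma_1(\xi)$. For $0<p,q<\infty$, $L^q_p(\omega)$ and $T^q_p(\omega)$ consist of the complex-valued measurable functions $f$ on $\mathbb{D}$ such that, respectively, $$\|f\|_{L^q_p(\omega)}=\left(\frac1{2\pi}\int_0^{2\pi}\left(\int_0^1|f(re^{i\theta})|^p\omega(r)r\,dr\right)^{q/p}d\theta\right)^{1/q}<\infty,$$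 $$\|f\|_{T^q_p(\omega)}=\left(\int_{\mathbb{T}}\left(\int_{\Gamma(\xi)}|f(z)|^p\omega(z)\frac{dA(z)}{1-|z|}\right)^{q/p}|d\xi|\right)^{1/q}<\infty.$$ Set $AL^q_p(\omega)=L^q_p(\omega)\cap\mathcal{H}(\mathbb{D})$ and $AT^q_p(\omega)=T^q_p(\omega)\cap\mathcal{H}(\mathbb{D})$. The non-tangential maximal function is $N_M(f)(\xi)=\sup_{z\in\Gamma_M(\xi)}|f(z)|$, $\xi\in\overline{\mathbb{D}}$. *)

theory Defs
  imports "HOL-Complex_Analysis.Complex_Analysis"
begin

text \<open>Functions on the unit disc are total functions of type \<^typ>\<open>complex \<Rightarrow> _\<close>; every notion
  below looks only at their values on \<^term>\<open>ball 0 1 :: complex set\<close>.\<close>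

definition weight :: "(complex \<Rightarrow> real) \<Rightarrow> bool" where
  "weight \<omega> \<longleftrightarrow> (\<forall>z\<in>ball 0 1. 0 \<le> \<omega> z) \<and> set_integrable lebesgue (ball 0 1) \<omega>"

definition radial :: "(complex \<Rightarrow> real) \<Rightarrow> bool" where
  "radial \<omega> \<longleftrightarrow> (\<forall>z\<in>ball 0 1. \<omega> z = \<omega> (of_real (cmod z)))"

text \<open>Extended-valued on purpose: integrability of a radial weight over the disc does not exclude
  that the integral over the whole radius (the value at \<open>0\<close>) is infinite.\<close>

definition weight_hat :: "(complex \<Rightarrow> real) \<Rightarrow> complex \<Rightarrow> ennreal" where
  "weight_hat \<omega> z = (\<integral>\<^sup>+ s\<in>{cmod z<..<1}. ennreal (\<omega> (of_real s)) \<partial>lebesgue)"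

text \<open>Since \<^const>\<open>is_Arg\<close> relates a point to all its arguments, this compares arguments
  modulo \<open>2\<pi>\<close>. Every real number is an argument of \<open>0\<close>, so \<open>0\<close> lies in the region of
  every \<open>\<xi> \<noteq> 0\<close>, while the region of \<open>\<xi> = 0\<close> is empty.\<close>

definition nt_region :: "real \<Rightarrow> complex \<Rightarrow> complex set" where
  "nt_region M \<xi> =
     {z \<in> ball 0 1. \<exists>s t. is_Arg z s \<and> is_Arg \<xi> t \<and> \<bar>s - t\<bar> < M * (cmod \<xi> - cmod z)}"

text \<open>The maximal function is extended-valued (it may be infinite on the unit circle, and it is
  \<open>0\<close> at \<open>\<xi> = 0\<close>).\<close>

definition nt_max :: "real \<Rightarrow> (complex \<Rightarrow> complex) \<Rightarrow> complex \<Rightarrow> ennreal" where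
  "nt_max M f \<xi> = (SUP z\<in>nt_region M \<xi>. ennreal (cmod (f z)))"

text \<open>The maximal function as a complex-valued function, for use where \<^const>\<open>nt_max\<close> is finite.\<close>

definition nt_max_fun :: "real \<Rightarrow> (complex \<Rightarrow> complex) \<Rightarrow> complex \<Rightarrow> complex" where
  "nt_max_fun M f \<xi> = of_real (enn2real (nt_max M f \<xi>))"

text \<open>Real powers on \<open>[0,\<infinity>]\<close>; used only with exponents \<open>a > 0\<close>.\<close>

definition ennreal_powr :: "ennreal \<Rightarrow> real \<Rightarrow> ennreal" where
  "ennreal_powr x a = (if x = \<infinity> then \<infinity> else ennreal (enn2real x powr a))"

definition L_norm :: "real \<Rightarrow> real \<Rightarrow> (complex \<Rightarrow> real) \<Rightarrow> (complex \<Rightarrow> complex) \<Rightarrow> ennreal" where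
  "L_norm p q \<omega> f =
     ennreal_powr
       (ennreal (1 / (2 * pi)) *
         (\<integral>\<^sup>+ \<theta>\<in>{0..2 * pi}.
            ennreal_powr
              (\<integral>\<^sup>+ r\<in>{0..<1}. ennreal (cmod (f (rcis r \<theta>)) powr p * \<omega> (of_real r) * r) \<partial>lebesgue)
              (q / p) \<partial>lebesgue))
       (1 / q)"

text \<open>The measure \<open>dA\<close> is Lebesgue measure divided by \<open>\<pi>\<close>; integration over the circle with
  respect to arc length is parametrised by \<open>\<xi> = cis \<theta>\<close>.\<close>

definition T_norm :: "real \<Rightarrow> real \<Rightarrow> (complex \<Rightarrow> real) \<Rightarrow> (complex \<Rightarrow> complex) \<Rightarrow> ennreal" where
  "T_norm p q \<omega> f =
     ennreal_powr
       (\<integral>\<^sup>+ \<theta>\<in>{0..2 * pi}.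
          ennreal_powr
            (\<integral>\<^sup>+ z\<in>nt_region 1 (cis \<theta>).
               ennreal (cmod (f z) powr p * \<omega> z / (1 - cmod z) * (1 / pi)) \<partial>lebesgue)
            (q / p) \<partial>lebesgue)
       (1 / q)"

definition L_space :: "real \<Rightarrow> real \<Rightarrow> (complex \<Rightarrow> real) \<Rightarrow> (complex \<Rightarrow> complex) set" where
  "L_space p q \<omega> = {f \<in> borel_measurable (lebesgue_on (ball 0 1)). L_norm p q \<omega> f < \<infinity>}"

definition T_space :: "real \<Rightarrow> real \<Rightarrow> (complex \<Rightarrow> real) \<Rightarrow> (complex \<Rightarrow> complex) set" where
  "T_space p q \<omega> = {f \<in> borel_measurable (lebesgue_on (ball 0 1)). T_norm p q \<omega> f < \<infinity>}"

definition AL_space :: "real \<Rightarrow> real \<Rightarrow> (complex \<Rightarrow> real) \<Rightarrow> (complex \<Rightarrow> complex) set" where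
  "AL_space p q \<omega> = L_space p q \<omega> \<inter> {f. f holomorphic_on ball 0 1}"

definition AT_space :: "real \<Rightarrow> real \<Rightarrow> (complex \<Rightarrow> real) \<Rightarrow> (complex \<Rightarrow> complex) set" where
  "AT_space p q \<omega> = T_space p q \<omega> \<inter> {f. f holomorphic_on ball 0 1}"

end

theory Submission
  imports Defs
begin

text \<open>For small \<open>s\<close> the function \<open>|f|\<^sup>s\<close> is subharmonic, so Poisson's formula on the circle of radius
  \<open>r\<close> bounds \<open>N(f)\<^sup>s\<close> on that circle by the Hardy--Littlewood maximal function of \<open>|f|\<^sup>s\<close> restricted
  to the same circle. The theorem thereby becomes a vector-valued (Fefferman--Stein) maximal inequality
  in which the radius is the parameter; since \<open>s\<close> may be as small as we like, only a single large inner
  exponent is needed, and the vector-valued inequality reduces to weighted scalar ones. In the tent space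
  norm the cone adds a second parameter, the relative angle within the cone, which enters only through a
  rotation and hence commutes with the maximal function; so both norms are instances of one inequality.\<close>

section \<open>Real powers of extended nonnegative reals\<close>

text \<open>Only the outer exponent \<open>a = q / p\<close> is prescribed; the inner exponent
  \<open>P\<close> may be whatever suits \<open>a\<close>, since \<open>s = p / P\<close> adapts to
  it. For \<open>a = 1\<close> Tonelli reduces everything to scalar functions. For
  \<open>a > 1\<close> and \<open>P = 2\<close> one can test against functions of the dual exponent.
  With \<open>F\<close> and \<open>G\<close> the left and right inner integrals, Young's inequality
  gives \<open>F^a \<le> F V^(-b) + V^(a/d)\<close>, where \<open>V\<close> is the sum of
  \<open>G^d\<close> and its maximal function. Powers of \<open>V\<close> below one are weights of
  Coifman--Rochberg type, and this makes the maximal function bounded with the weight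
  \<open>V^(-b)\<close> once \<open>P\<close> is large compared with \<open>b\<close>. The freedom
  in \<open>P\<close> is spent here. A power \<open>|f|^s\<close> is the modulus of a holomorphic
  function only in the absence of zeros. Interior zeros can be reflected away, zeros on the circle
  itself cannot, so circles through zeros are discarded; their radii are countable, hence
  negligible.\<close>

lemma ennreal_powr_ennreal: "0 \<le> r \<Longrightarrow> ennreal_powr (ennreal r) a = ennreal (r powr a)"
  by (simp add: ennreal_powr_def)

lemma ennreal_powr_0 [simp]: "ennreal_powr 0 a = 0"
  by (simp add: ennreal_powr_def)

lemma ennreal_powr_top [simp]: "ennreal_powr top a = top"
  by (simp add: ennreal_powr_def)

lemma ennreal_powr_1 [simp]: "ennreal_powr x 1 = x"
  by (cases x) (auto simp: ennreal_powr_def)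

lemma ennreal_powr_mono: "0 < a \<Longrightarrow> x \<le> y \<Longrightarrow> ennreal_powr x a \<le> ennreal_powr y a"
  by (cases x; cases y) (auto simp: ennreal_powr_ennreal intro!: ennreal_leI powr_mono2 simp: top_unique)

lemma ennreal_powr_eq_0_iff [simp]: "ennreal_powr x a = 0 \<longleftrightarrow> x = 0"
  by (cases x) (auto simp: ennreal_powr_ennreal)

lemma ennreal_powr_eq_top_iff [simp]: "ennreal_powr x a = top \<longleftrightarrow> x = top"
  by (cases x) (auto simp: ennreal_powr_ennreal)

lemma ennreal_powr_mult: "ennreal_powr (x * y) a = ennreal_powr x a * ennreal_powr y a"
proof (cases x; cases y)
  fix r s assume "0 \<le> r" "x = ennreal r" "0 \<le> s" "y = ennreal s"
  then show ?thesis by (simp add: ennreal_powr_ennreal powr_mult flip: ennreal_mult)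
qed (auto simp: ennreal_powr_ennreal ennreal_mult_top ennreal_top_mult)

lemma ennreal_powr_ennreal_powr: "ennreal_powr (ennreal_powr x a) b = ennreal_powr x (a * b)"
  by (cases x) (auto simp: ennreal_powr_ennreal powr_powr)

lemma ennreal_powr_add_exp: "0 < a \<Longrightarrow> 0 < b \<Longrightarrow> ennreal_powr x (a + b) = ennreal_powr x a * ennreal_powr x b"
  by (cases x) (auto simp: ennreal_powr_ennreal powr_add ennreal_mult_top ennreal_top_mult ennreal_mult)

lemma ennreal_powr_2: "ennreal_powr x 2 = x\<^sup>2"
  using ennreal_powr_add_exp[of 1 1 x] by (simp add: power2_eq_square)

lemma ennreal_powr_half_square: "(ennreal_powr x (1/2))\<^sup>2 = x"
  by (simp add: ennreal_powr_ennreal_powr flip: ennreal_powr_2)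

lemma ennreal_powr_inverse: "0 < a \<Longrightarrow> ennreal_powr (inverse x) a = inverse (ennreal_powr x a)"
proof (cases x)
  case (real r)
  assume "0 < a"
  with real show ?thesis
    by (cases "r = 0") (auto simp: ennreal_powr_ennreal inverse_ennreal powr_gt_zero powr_minus
        inverse_powr)
qed simp

text \<open>An adjunction between \<open>a\<close> and \<open>1 / a\<close>, valid at
  \<open>0\<close> and \<open>top\<close> as well; suprema and strict levels pass through powers by
  it.\<close>

lemma ennreal_powr_le_iff: "0 < a \<Longrightarrow> ennreal_powr x a \<le> y \<longleftrightarrow> x \<le> ennreal_powr y (1 / a)"
  using ennreal_powr_mono[of a x "ennreal_powr y (1 / a)"] ennreal_powr_mono[of "1/a" "ennreal_powr x a" y]
  by (auto simp: ennreal_powr_ennreal_powr)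

lemma ennreal_powr_less_iff: "0 < a \<Longrightarrow> y < ennreal_powr x a \<longleftrightarrow> ennreal_powr y (1 / a) < x"
  using ennreal_powr_le_iff[of a x y] by (simp add: linorder_not_le[symmetric])

lemma ennreal_powr_SUP_le:
  assumes "0 < a" "\<And>i. i \<in> I \<Longrightarrow> ennreal_powr (f i) a \<le> y"
  shows "ennreal_powr (SUP i\<in>I. f i) a \<le> y"
  using assms by (simp add: ennreal_powr_le_iff SUP_le_iff)

lemma ennreal_powr_measurable [measurable]:
  assumes [measurable]: "f \<in> borel_measurable M"
  shows "(\<lambda>x. ennreal_powr (f x) a) \<in> borel_measurable M"
  unfolding ennreal_powr_def by measurable

text \<open>Bounding the sum by twice the maximum costs \<open>2 powr a\<close> but treats concave
  and convex powers alike.\<close>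

lemma ennreal_powr_add_le:
  assumes "0 < a"
  shows "ennreal_powr (x + y) a \<le> ennreal (2 powr a) * (ennreal_powr x a + ennreal_powr y a)"
proof -
  have "ennreal_powr (x + y) a \<le> ennreal_powr (2 * max x y) a"
    using assms by (intro ennreal_powr_mono) (auto simp: mult_2 intro!: add_mono)
  also have "\<dots> = ennreal (2 powr a) * ennreal_powr (max x y) a"
    using ennreal_powr_ennreal[of 2 a] by (simp add: ennreal_powr_mult)
  also have "\<dots> \<le> ennreal (2 powr a) * (ennreal_powr x a + ennreal_powr y a)"
    by (intro mult_left_mono) (auto simp: max_def)
  finally show ?thesis .
qed

text \<open>At \<open>0\<close> and at \<open>top\<close> the product is \<open>0\<close>, because
  \<open>0 * top = 0\<close>; hence only an inequality.\<close>

lemma mult_inverse_le_1: "x * inverse x \<le> (1::ennreal)"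
  by (cases x) (auto simp: ennreal_mult_top ennreal_top_mult inverse_ennreal simp flip: ennreal_mult
      , metis ennreal_inverse_mult ennreal_0 ennreal_1 ennreal_leI ennreal_mult eq_refl inverse_ennreal inverse_nonnegative_iff_nonnegative less_eq_real_def mult_zero_left right_inverse zero_le_one)

lemma set_nn_integral_has_integral:
  fixes f :: "'a::euclidean_space \<Rightarrow> real"
  assumes "\<And>x. x \<in> S \<Longrightarrow> 0 \<le> f x" "(f has_integral I) S"
  shows "(\<integral>\<^sup>+x\<in>S. ennreal (f x) \<partial>lborel) = ennreal I"
proof -
  have "(\<integral>\<^sup>+x\<in>S. ennreal (f x) \<partial>lborel) = (\<integral>\<^sup>+x. ennreal (indicator S x * f x) \<partial>lborel)"
    by (intro nn_integral_cong) (auto split: split_indicator)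
  then show ?thesis
    using nn_integral_has_integral_lebesgue[OF assms] by simp
qed

text \<open>The level set is kept as a factor of the integrand, ready for exchanging the integral
  over \<open>t\<close> with one over a second variable.\<close>

lemma layer_cake:
  assumes "0 < P"
  shows "ennreal_powr y P = (\<integral>\<^sup>+t\<in>{0<..}. (indicator {t. ennreal t < y} t * ennreal (P * t powr (P - 1))) \<partial>lborel)"
    (is "_ = ?R y")
proof -
  have fin: "ennreal_powr (ennreal c) P = ?R (ennreal c)" if "0 \<le> c" for c
  proof -
    have "((\<lambda>t. P * t powr (P - 1)) has_integral (P * (c powr (P-1+1) / (P-1+1)))) {0..c}"
      using assms that by (intro has_integral_mult_right has_integral_powr_from_0) auto
    then have "((\<lambda>t. P * t powr (P - 1)) has_integral (c powr P)) {0..c}"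
      using assms by simp
    then have "(\<integral>\<^sup>+t\<in>{0..c}. ennreal (P * t powr (P - 1)) \<partial>lborel) = ennreal (c powr P)"
      using assms by (intro set_nn_integral_has_integral) auto
    moreover have "?R (ennreal c) = (\<integral>\<^sup>+t\<in>{0..c}. ennreal (P * t powr (P - 1)) \<partial>lborel)"
    proof (rule nn_integral_cong_AE)
      have "AE t in lborel. t \<noteq> 0 \<and> t \<noteq> c"
        using AE_lborel_singleton[of 0] AE_lborel_singleton[of c] by eventually_elim simp
      then show "AE t in lborel. indicator {t. ennreal t < ennreal c} t * ennreal (P * t powr (P - 1)) * indicator {0<..} t =
          ennreal (P * t powr (P - 1)) * indicator {0..c} t"
        by eventually_elim (auto split: split_indicator simp: ennreal_less_iff)
    qed
    ultimately show ?thesis using that by (simp add: ennreal_powr_ennreal)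
  qed
  show ?thesis
  proof (cases y)
    case (real c) then show ?thesis using fin by simp
  next
    case top
    have "?R top = top"
    proof (rule ccontr)
      assume "?R top \<noteq> top"
      then obtain b where b: "?R top = ennreal b" "0 \<le> b" by (cases "?R top") auto
      \<comment> \<open>A finite value \<open>b\<close> at \<open>y = top\<close> is refuted by a
        finite level whose own integral is already \<open>b + 1\<close>.\<close>
      have "?R (ennreal ((b+1) powr (1/P))) \<le> ?R top"
        by (intro nn_integral_mono) (auto split: split_indicator)
      moreover have "?R (ennreal ((b+1) powr (1/P))) = ennreal (b+1)"
        using fin[of "(b+1) powr (1/P)"] assms b by (simp add: ennreal_powr_ennreal powr_powr)
      ultimately show False using b by (simp add: )
    qed
    then show ?thesis using top by simp
  qed
qed

section \<open>The Hardy--Littlewood maximal function\<close>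

text \<open>Rational balls make the supremum countable, so that joint measurability in a parameter is
  immediate.\<close>

definition rational_balls :: "(real \<times> real) set" where
  "rational_balls = {(a, r). a \<in> \<rat> \<and> r \<in> \<rat> \<and> 0 < r}"

definition ball_avg :: "real \<Rightarrow> real \<Rightarrow> (real \<Rightarrow> ennreal) \<Rightarrow> ennreal" where
  "ball_avg a r g = ennreal (1 / (2 * r)) * (\<integral>\<^sup>+y\<in>ball a r. g y \<partial>lborel)"

text \<open>The uncentred maximal function. Balls that miss \<open>x\<close> contribute
  \<open>0\<close> through the indicator, so the index set does not depend on
  \<open>x\<close>.\<close>

definition hl_max :: "(real \<Rightarrow> ennreal) \<Rightarrow> real \<Rightarrow> ennreal" where
  "hl_max g x = (SUP c\<in>rational_balls. indicator (ball (fst c) (snd c)) x * ball_avg (fst c) (snd c) g)"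

lemma sets_ball [measurable]: "ball a r \<in> sets (borel :: 'a::metric_space measure)"
  by simp

lemma countable_rational_balls: "countable rational_balls"
  by (rule countable_subset[of _ "\<rat> \<times> \<rat>"]) (auto simp: rational_balls_def countable_rat)

lemma ball_avg_le_hl_max:
  "(a, r) \<in> rational_balls \<Longrightarrow> x \<in> ball a r \<Longrightarrow> ball_avg a r g \<le> hl_max g x"
  unfolding hl_max_def by (rule SUP_upper2[of "(a, r)"]) auto

lemma hl_max_leI:
  assumes "\<And>a r. (a, r) \<in> rational_balls \<Longrightarrow> x \<in> ball a r \<Longrightarrow> ball_avg a r g \<le> y"
  shows "hl_max g x \<le> y"
  unfolding hl_max_def using assms by (intro SUP_least) (auto split: split_indicator)

lemma less_hl_max_iff:
  "y < hl_max g x \<longleftrightarrow> (\<exists>(a, r)\<in>rational_balls. x \<in> ball a r \<and> y < ball_avg a r g)"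
  unfolding hl_max_def less_SUP_iff by (force split: split_indicator)

lemma set_nn_integral_eq_ball_avg:
  "0 < r \<Longrightarrow> (\<integral>\<^sup>+y\<in>ball a r. g y \<partial>lborel) = ennreal (2 * r) * ball_avg a r g"
  unfolding ball_avg_def mult.assoc[symmetric] by (simp flip: ennreal_mult)

lemma ball_avg_mono:
  assumes "ball a r \<subseteq> ball b t" "0 < r" "t \<le> c * r"
  shows "ball_avg a r g \<le> ennreal c * ball_avg b t g"
proof -
  have t: "0 < t" using assms(1,2) by (metis ball_eq_empty linorder_not_le subset_empty)
  then have c: "0 < c" using assms by (metis less_le_trans zero_less_mult_pos2)
  have "1 / (2 * r) \<le> c * (1 / (2 * t))" using assms t by (simp add: field_simps)
  then have *: "ennreal (1 / (2 * r)) \<le> ennreal c * ennreal (1 / (2 * t))"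
    using c t by (simp add: ennreal_leI flip: ennreal_mult)
  have "ball_avg a r g \<le> ennreal (1 / (2 * r)) * (\<integral>\<^sup>+y\<in>ball b t. g y \<partial>lborel)"
    unfolding ball_avg_def using assms(1)
    by (intro mult_left_mono nn_integral_mono) (auto split: split_indicator)
  also have "\<dots> \<le> ennreal c * ball_avg b t g"
    unfolding ball_avg_def mult.assoc[symmetric] using * by (intro mult_right_mono) auto
  finally show ?thesis .
qed

lemma ball_avg_le_hl_max_real:
  assumes "0 < r" "x \<in> ball a r"
  shows "ball_avg a r g \<le> 2 * hl_max g x"
proof -
  obtain a' where a': "a' \<in> \<rat>" "a - r/4 < a'" "a' < a + r/4"
    using Rats_dense_in_real[of "a - r/4" "a + r/4"] assms by auto
  \<comment> \<open>Moving the centre by less than \<open>r / 4\<close> needs a radius above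
    \<open>5/4 * r\<close>; staying below \<open>2 * r\<close> costs the factor 2.\<close>
  obtain r' where r': "r' \<in> \<rat>" "5/4 * r < r'" "r' < 2 * r"
    using Rats_dense_in_real[of "5/4 * r" "2 * r"] assms by auto
  have sub: "ball a r \<subseteq> ball a' r'"
    using a' r' by (auto simp: dist_real_def)
  have "ball_avg a r g \<le> ennreal 2 * ball_avg a' r' g"
    using r' assms by (intro ball_avg_mono sub) auto
  also have "\<dots> \<le> ennreal 2 * hl_max g x"
    using a' r' assms sub by (intro mult_left_mono ball_avg_le_hl_max) (auto simp: rational_balls_def)
  finally show ?thesis by simp
qed

text \<open>Both the parameter \<open>k z\<close> and the point \<open>h z\<close> vary measurably;
  with the two projections this is joint measurability on a product.\<close>

lemma measurable_hl_max_param: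
  assumes [measurable]: "case_prod g \<in> borel_measurable (M \<Otimes>\<^sub>M borel)" "h \<in> borel_measurable N" "k \<in> measurable N M"
  shows "(\<lambda>z. hl_max (g (k z)) (h z)) \<in> borel_measurable N"
proof -
  have 1: "(\<lambda>x. ball_avg a r (g x)) \<in> borel_measurable M" for a r
  proof -
    have "(\<lambda>x. \<integral>\<^sup>+y\<in>ball a r. g x y \<partial>lborel) \<in> borel_measurable M"
      by (rule lborel.borel_measurable_nn_integral) measurable
    then show ?thesis unfolding ball_avg_def by measurable
  qed
  have [measurable]: "(\<lambda>z. ball_avg a r (g (k z))) \<in> borel_measurable N" for a r
    by (rule measurable_compose[OF _ 1]) measurable
  show ?thesis unfolding hl_max_def
    by (intro borel_measurable_SUP countable_rational_balls borel_measurable_times_ennreal) measurable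
qed

lemma measurable_hl_max [measurable]: "hl_max g \<in> borel_measurable borel"
  unfolding hl_max_def
  by (intro borel_measurable_SUP countable_rational_balls borel_measurable_times_ennreal) measurable

lemma ball_avg_mono_AE: "AE y in lborel. f y \<le> g y \<Longrightarrow> ball_avg a r f \<le> ball_avg a r g"
  unfolding ball_avg_def
  by (intro mult_left_mono nn_integral_mono_AE) (auto elim!: eventually_mono split: split_indicator)

lemma hl_max_mono_AE: "AE y in lborel. f y \<le> g y \<Longrightarrow> hl_max f x \<le> hl_max g x"
  by (rule hl_max_leI) (rule order_trans[OF ball_avg_mono_AE ball_avg_le_hl_max])

lemma ball_avg_add:
  assumes [measurable]: "f \<in> borel_measurable borel" "g \<in> borel_measurable borel"
  shows "ball_avg a r (\<lambda>y. f y + g y) = ball_avg a r f + ball_avg a r g"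
  unfolding ball_avg_def by (simp add: distrib_left distrib_right nn_integral_add)

lemma ball_avg_const: "0 < r \<Longrightarrow> ball_avg a r (\<lambda>y. c) = c"
  unfolding ball_avg_def
  by (simp add: nn_integral_cmult_indicator ball_eq_greaterThanLessThan mult.left_commute flip: ennreal_mult)

lemma hl_max_add_le:
  assumes [measurable]: "f \<in> borel_measurable borel" "g \<in> borel_measurable borel"
  shows "hl_max (\<lambda>y. f y + g y) x \<le> hl_max f x + hl_max g x"
  by (intro hl_max_leI) (auto simp: ball_avg_add intro!: add_mono ball_avg_le_hl_max)

lemma hl_max_const_le: "hl_max (\<lambda>_. c) x \<le> c"
  by (rule hl_max_leI) (auto simp: ball_avg_const rational_balls_def)

section \<open>Weighted weak type and strong type inequalities\<close>

lemma nn_integral_incseq_SUP: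
  assumes "f \<in> borel_measurable M" "\<And>n :: nat. A n \<in> sets M" "incseq A"
  shows "(\<integral>\<^sup>+x\<in>(\<Union>n. A n). f x \<partial>M) = (SUP n. \<integral>\<^sup>+x\<in>A n. f x \<partial>M)"
  using SUP_emeasure_incseq[of A "density M f"] assms
  by (simp add: emeasure_density image_subset_iff sets.countable_UN)

text \<open>The Fefferman--Stein form of Vitali's argument. Disjoint balls are selected whose
  fivefold dilates cover the union. The average of \<open>w\<close> over a dilate is at most
  \<open>hl_max w\<close> at every point of the selected ball, so it can be moved inside the
  integral of \<open>g\<close> over that ball. The constant 5 is the ratio of the two
  lengths.\<close>

lemma weak_type_finite:
  assumes [measurable]: "w \<in> borel_measurable borel" "g \<in> borel_measurable borel"
    and J: "finite J" "J \<subseteq> rational_balls" "\<And>a r. (a, r) \<in> J \<Longrightarrow> l \<le> ball_avg a r g"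
  shows "l * (\<integral>\<^sup>+x\<in>(\<Union>(a, r)\<in>J. ball a r). w x \<partial>lborel) \<le> 5 * (\<integral>\<^sup>+x. g x * hl_max w x \<partial>lborel)"
proof -
  obtain C where C: "C \<subseteq> J"
      "pairwise (\<lambda>i j. disjnt (cball (fst i) (snd i)) (cball (fst j) (snd j))) C"
      "\<And>i. i \<in> J \<Longrightarrow> \<exists>j. j \<in> C \<and> cball (fst i) (snd i) \<subseteq> ball (fst j) (5 * snd j)"
  proof (rule Vitali_covering_lemma_cballs_balls[of J snd "Max (snd ` J)" fst])
    fix i assume "i \<in> J"
    then show "0 < snd i \<and> snd i \<le> Max (snd ` J)"
      using J(1,2) by (auto simp: rational_balls_def)
  next
    fix C
    assume "countable C" and sub: "C \<subseteq> J"
      and disj: "pairwise (\<lambda>i j. disjnt (cball (fst i) (snd i)) (cball (fst j) (snd j))) C"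
      and cover: "\<And>i. i \<in> J \<Longrightarrow> \<exists>j. j \<in> C \<and>
        \<not> disjnt (cball (fst i) (snd i)) (cball (fst j) (snd j)) \<and>
        cball (fst i) (snd i) \<subseteq> ball (fst j) (5 * snd j)"
    show thesis
    proof (rule that[OF sub disj])
      fix i assume "i \<in> J"
      from cover[OF this] show "\<exists>j. j \<in> C \<and> cball (fst i) (snd i) \<subseteq> ball (fst j) (5 * snd j)"
        by (elim ex_forward) simp
    qed
  qed
  have fin: "finite C" using C(1) J(1) finite_subset by blast
  have one: "l * (\<integral>\<^sup>+x\<in>ball a (5 * r). w x \<partial>lborel) \<le> 5 * (\<integral>\<^sup>+x\<in>ball a r. (g x * hl_max w x) \<partial>lborel)"
    if "(a, r) \<in> C" for a r
  proof -
    have r: "a \<in> \<rat>" "r \<in> \<rat>" "0 < r" and l: "l \<le> ball_avg a r g"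
      using that C(1) J(2,3) by (auto simp: rational_balls_def)
    let ?m = "ball_avg a (5 * r) w"
    have m: "?m \<le> hl_max w y" if "y \<in> ball a r" for y
      using r that by (intro ball_avg_le_hl_max) (auto simp: rational_balls_def)
    have "l * (\<integral>\<^sup>+x\<in>ball a (5 * r). w x \<partial>lborel) \<le> ball_avg a r g * (ennreal (10 * r) * ?m)"
      using r l by (subst set_nn_integral_eq_ball_avg) (auto intro!: mult_right_mono)
    also have "\<dots> = 5 * (?m * (ennreal (2 * r) * ball_avg a r g))"
    proof -
      have "ennreal (10 * r) = 5 * ennreal (2 * r)"
        using r ennreal_mult[of 5 "2 * r"] by simp
      then show ?thesis by (simp add: mult_ac)
    qed
    also have "\<dots> = 5 * (\<integral>\<^sup>+x. ?m * (g x * indicator (ball a r) x) \<partial>lborel)"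
      using r by (subst set_nn_integral_eq_ball_avg[symmetric], simp, subst nn_integral_cmult) auto
    also have "\<dots> \<le> 5 * (\<integral>\<^sup>+x\<in>ball a r. (g x * hl_max w x) \<partial>lborel)"
      using m by (intro mult_left_mono nn_integral_mono)
        (auto split: split_indicator intro!: mult_left_mono simp: mult.commute[of ?m])
    finally show ?thesis .
  qed
  have "l * (\<integral>\<^sup>+x\<in>(\<Union>(a, r)\<in>J. ball a r). w x \<partial>lborel)
      \<le> l * (\<integral>\<^sup>+x. (\<Sum>c\<in>C. w x * indicator (ball (fst c) (5 * snd c)) x) \<partial>lborel)"
  proof (intro mult_left_mono nn_integral_mono)
    fix x
    show "w x * indicator (\<Union>(a, r)\<in>J. ball a r) x \<le> (\<Sum>c\<in>C. w x * indicator (ball (fst c) (5 * snd c)) x)"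
    proof (cases "x \<in> (\<Union>(a, r)\<in>J. ball a r)")
      case True
      then obtain i where "i \<in> J" "x \<in> ball (fst i) (snd i)" by auto
      then obtain j where j: "j \<in> C" "x \<in> ball (fst j) (5 * snd j)"
        using C(3)[of i] ball_subset_cball[of "fst i" "snd i"] by (meson subsetD)
      have "w x * indicator (ball (fst j) (5 * snd j)) x \<le> (\<Sum>c\<in>C. w x * indicator (ball (fst c) (5 * snd c)) x)"
        using fin j by (intro member_le_sum) auto
      then show ?thesis using j True by simp
    qed simp
  qed simp
  also have "\<dots> = (\<Sum>c\<in>C. l * (\<integral>\<^sup>+x\<in>ball (fst c) (5 * snd c). w x \<partial>lborel))"
    by (subst nn_integral_sum) (auto simp: sum_distrib_left)
  also have "\<dots> \<le> (\<Sum>c\<in>C. 5 * (\<integral>\<^sup>+x\<in>ball (fst c) (snd c). (g x * hl_max w x) \<partial>lborel))"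
    by (intro sum_mono one) auto
  also have "\<dots> = 5 * (\<integral>\<^sup>+x. (\<Sum>c\<in>C. g x * hl_max w x * indicator (ball (fst c) (snd c)) x) \<partial>lborel)"
    by (subst nn_integral_sum) (auto simp: sum_distrib_left)
  also have "\<dots> \<le> 5 * (\<integral>\<^sup>+x. g x * hl_max w x \<partial>lborel)"
  proof (intro mult_left_mono nn_integral_mono)
    fix x
    show "(\<Sum>c\<in>C. g x * hl_max w x * indicator (ball (fst c) (snd c)) x) \<le> g x * hl_max w x"
    proof (cases "\<exists>c\<in>C. x \<in> ball (fst c) (snd c)")
      case True
      then obtain c where c: "c \<in> C" "x \<in> ball (fst c) (snd c)" by auto
      have "x \<notin> ball (fst d) (snd d)" if "d \<in> C - {c}" for d
      proof
        assume "x \<in> ball (fst d) (snd d)"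
        then have "x \<in> cball (fst d) (snd d)" "x \<in> cball (fst c) (snd c)"
          using c(2) by simp_all
        moreover have "disjnt (cball (fst c) (snd c)) (cball (fst d) (snd d))"
          using pairwiseD[OF C(2) c(1), of d] that by auto
        ultimately show False unfolding disjnt_iff by blast
      qed
      then have "(\<Sum>d\<in>C - {c}. g x * hl_max w x * indicator (ball (fst d) (snd d)) x) = 0"
        by (intro sum.neutral) auto
      then show ?thesis using c fin by (subst sum.remove[of _ c]) auto
    qed auto
  qed simp
  finally show ?thesis .
qed

text \<open>Vitali's selection needs bounded radii and finite sums. Finite subfamilies of the
  countable index set provide both, and the superlevel set is the increasing union of what they
  cover.\<close>

lemma weak_type:
  assumes [measurable]: "w \<in> borel_measurable borel" "g \<in> borel_measurable borel"
  shows "l * (\<integral>\<^sup>+x\<in>{x. l < hl_max g x}. w x \<partial>lborel) \<le> 5 * (\<integral>\<^sup>+x. g x * hl_max w x \<partial>lborel)"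
proof -
  define K where "K = {(a, r)\<in>rational_balls. l < ball_avg a r g}"
  have K: "K \<subseteq> rational_balls" "countable K"
    by (auto simp: K_def intro: countable_subset[OF _ countable_rational_balls])
  have eq: "{x. l < hl_max g x} = (\<Union>(a, r)\<in>K. ball a r)"
    unfolding less_hl_max_iff K_def by fastforce
  show ?thesis
  proof (cases "K = {}")
    case True then show ?thesis by (simp add: eq)
  next
    case False
    define J where "J n = from_nat_into K ` {..n}" for n
    have JK: "J n \<subseteq> K" for n using from_nat_into[OF False] by (auto simp: J_def)
    have UJ: "(\<Union>n. J n) = K"
      using range_from_nat_into[OF False K(2)] unfolding J_def by (simp add: UN_atMost_UNIV flip: image_UN)
    define U where "U n = (\<Union>(a, r)\<in>J n. ball a r)" for n
    have opU: "open (U n)" for n unfolding U_def by auto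
    then have [measurable]: "U n \<in> sets borel" for n by auto
    have "incseq U" unfolding incseq_def U_def J_def by (intro allI impI UN_mono image_mono) auto
    have Un: "(\<Union>n. U n) = (\<Union>(a, r)\<in>K. ball a r)" unfolding U_def UJ[symmetric] by simp
    have "(\<integral>\<^sup>+x\<in>(\<Union>n. U n). w x \<partial>lborel) = (SUP n. \<integral>\<^sup>+x\<in>U n. w x \<partial>lborel)"
      using \<open>incseq U\<close> by (intro nn_integral_incseq_SUP) auto
    then have "l * (\<integral>\<^sup>+x\<in>(\<Union>n. U n). w x \<partial>lborel) = (SUP n. l * (\<integral>\<^sup>+x\<in>U n. w x \<partial>lborel))"
      by (simp add: SUP_mult_left_ennreal)
    also have "\<dots> \<le> 5 * (\<integral>\<^sup>+x. g x * hl_max w x \<partial>lborel)"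
    proof (rule SUP_least)
      fix n show "l * (\<integral>\<^sup>+x\<in>U n. w x \<partial>lborel) \<le> 5 * (\<integral>\<^sup>+x. g x * hl_max w x \<partial>lborel)"
        unfolding U_def
      proof (rule weak_type_finite)
        show "finite (J n)" by (simp add: J_def)
        show "J n \<subseteq> rational_balls" using JK[of n] K(1) by (rule subset_trans)
        fix a r assume "(a, r) \<in> J n"
        then have "(a, r) \<in> K" using JK[of n] by blast
        then show "l \<le> ball_avg a r g" by (auto simp: K_def less_imp_le)
      qed measurable
    qed
    finally show ?thesis unfolding eq Un .
  qed
qed

text \<open>Marcinkiewicz truncation: the part of \<open>g\<close> below \<open>t / 2\<close> raises
  the maximal function by at most \<open>t / 2\<close>, so only the part above it matters. Applying
  the weak type bound at level \<open>t / 2\<close> doubles the constant 5.\<close>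

lemma weak_type_truncated:
  assumes [measurable]: "w \<in> borel_measurable borel" "g \<in> borel_measurable borel" and t: "0 < t"
  shows "ennreal t * (\<integral>\<^sup>+x\<in>{x. ennreal t < hl_max g x}. w x \<partial>lborel)
    \<le> 10 * (\<integral>\<^sup>+x. (g x * hl_max w x) * indicator {x. ennreal t < 2 * g x} x \<partial>lborel)"
proof -
  define h where "h x = g x * indicator {x. ennreal t < 2 * g x} x" for x
  have [measurable]: "h \<in> borel_measurable borel" unfolding h_def by measurable
  have half: "ennreal t = ennreal (t/2) + ennreal (t/2)" using t by (simp flip: ennreal_plus)
  have "g x \<le> h x + ennreal (t/2)" for x
  proof (cases "ennreal t < 2 * g x")
    case False
    then have "2 * g x \<le> 2 * ennreal (t / 2)" using half by (simp add: mult_2)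
    then have "g x \<le> ennreal (t/2)"
      using t by (cases "g x") (auto simp: ennreal_mult_top top_unique simp flip: ennreal_mult ennreal_numeral)
    then show ?thesis by (simp add: add_increasing)
  qed (simp add: h_def)
  then have "hl_max g x \<le> hl_max (\<lambda>y. h y + ennreal (t/2)) x" for x
    by (intro hl_max_mono_AE AE_I2)
  then have le: "hl_max g x \<le> hl_max h x + ennreal (t/2)" for x
    using hl_max_add_le[of h "\<lambda>_. ennreal (t/2)" x] hl_max_const_le[of "ennreal (t/2)" x]
    by (auto intro: order_trans add_left_mono)
  have sub: "{x. ennreal t < hl_max g x} \<subseteq> {x. ennreal (t/2) < hl_max h x}"
  proof (intro subsetI CollectI, rule ccontr)
    fix x assume x: "x \<in> {x. ennreal t < hl_max g x}" "\<not> ennreal (t/2) < hl_max h x"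
    then have "hl_max g x \<le> ennreal t"
      unfolding half by (intro order_trans[OF le] add_right_mono) simp
    with x show False by simp
  qed
  have t2: "ennreal t = 2 * ennreal (t/2)" by (simp add: half mult_2)
  have "ennreal t * (\<integral>\<^sup>+x\<in>{x. ennreal t < hl_max g x}. w x \<partial>lborel)
    \<le> ennreal t * (\<integral>\<^sup>+x\<in>{x. ennreal (t/2) < hl_max h x}. w x \<partial>lborel)"
    using sub by (intro mult_left_mono nn_integral_mono) (auto split: split_indicator)
  also have "\<dots> = 2 * (ennreal (t/2) * (\<integral>\<^sup>+x\<in>{x. ennreal (t/2) < hl_max h x}. w x \<partial>lborel))"
    unfolding t2 mult.assoc ..
  also have "\<dots> \<le> 2 * (5 * (\<integral>\<^sup>+x. h x * hl_max w x \<partial>lborel))"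
    by (intro mult_left_mono weak_type) auto
  also have "\<dots> = 10 * (\<integral>\<^sup>+x. (g x * hl_max w x) * indicator {x. ennreal t < 2 * g x} x \<partial>lborel)"
  proof -
    have "(\<lambda>x. h x * hl_max w x) = (\<lambda>x. (g x * hl_max w x) * indicator {x. ennreal t < 2 * g x} x)"
      by (simp add: h_def mult_ac)
    then show ?thesis by (simp add: mult.assoc[symmetric])
  qed
  finally show ?thesis .
qed

text \<open>The Fefferman--Stein inequality. The layer density \<open>P * t powr (P - 1)\<close>
  gives up one factor \<open>t\<close> to the weak type bound; what remains is, up to
  \<open>P / (P - 1)\<close>, the density for the exponent \<open>P - 1\<close> at height
  \<open>2 * g\<close>. This produces \<open>2 powr (P - 1)\<close>, and the factor \<open>g\<close>
  left by the weak type bound completes the power \<open>P\<close>.\<close>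

lemma weighted_hl_max:
  assumes [measurable]: "w \<in> borel_measurable borel" "g \<in> borel_measurable borel" and P: "1 < P"
  shows "(\<integral>\<^sup>+x. ennreal_powr (hl_max g x) P * w x \<partial>lborel)
    \<le> ennreal (10 * P / (P - 1) * 2 powr (P - 1)) * (\<integral>\<^sup>+x. ennreal_powr (g x) P * hl_max w x \<partial>lborel)"
proof -
  define k where "k t = ennreal (P * t powr (P - 1)) * indicator {0<..} t" for t :: real
  define j where "j t = ennreal ((P-1) * t powr (P - 2)) * indicator {0<..} t" for t :: real
  have [measurable]: "k \<in> borel_measurable borel" "j \<in> borel_measurable borel"
    unfolding k_def j_def by measurable
  define D where "D t x = (if ennreal t < hl_max g x then w x else 0)" for t x
  define E where "E t x = (if ennreal t < 2 * g x then g x * hl_max w x else 0)" for t x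
  have [measurable]: "case_prod D \<in> borel_measurable (borel \<Otimes>\<^sub>M borel)" "case_prod E \<in> borel_measurable (borel \<Otimes>\<^sub>M borel)"
    unfolding D_def E_def by measurable
  have D: "(\<integral>\<^sup>+x. D t x \<partial>lborel) = (\<integral>\<^sup>+x\<in>{x. ennreal t < hl_max g x}. w x \<partial>lborel)" for t
    by (intro nn_integral_cong) (auto simp: D_def)
  have E: "(\<integral>\<^sup>+x. E t x \<partial>lborel) = (\<integral>\<^sup>+x. (g x * hl_max w x) * indicator {x. ennreal t < 2 * g x} x \<partial>lborel)" for t
    by (intro nn_integral_cong) (auto simp: E_def)
  let ?D = "\<lambda>t. \<integral>\<^sup>+x. D t x \<partial>lborel" and ?E = "\<lambda>t. \<integral>\<^sup>+x. E t x \<partial>lborel"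
  have "ennreal_powr (hl_max g x) P * w x = (\<integral>\<^sup>+t. k t * D t x \<partial>lborel)" for x
  proof -
    have "ennreal_powr (hl_max g x) P * w x = (\<integral>\<^sup>+t. w x * (k t * indicator {t. ennreal t < hl_max g x} t) \<partial>lborel)"
      using P by (subst nn_integral_cmult) (simp_all add: layer_cake k_def mult_ac)
    also have "\<dots> = (\<integral>\<^sup>+t. k t * D t x \<partial>lborel)"
      by (intro nn_integral_cong) (auto simp: D_def mult_ac)
    finally show ?thesis .
  qed
  then have "(\<integral>\<^sup>+x. ennreal_powr (hl_max g x) P * w x \<partial>lborel) = (\<integral>\<^sup>+x. (\<integral>\<^sup>+t. k t * D t x \<partial>lborel) \<partial>lborel)"
    by simp
  also have "\<dots> = (\<integral>\<^sup>+t. (\<integral>\<^sup>+x. k t * D t x \<partial>lborel) \<partial>lborel)"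
    by (rule lborel_pair.Fubini') measurable
  also have "\<dots> = (\<integral>\<^sup>+t. k t * ?D t \<partial>lborel)"
    by (intro nn_integral_cong nn_integral_cmult) measurable
  also have "\<dots> \<le> (\<integral>\<^sup>+t. ennreal (10 * P / (P - 1)) * (j t * ?E t) \<partial>lborel)"
  proof (rule nn_integral_mono)
    fix t :: real
    show "k t * ?D t \<le> ennreal (10 * P / (P - 1)) * (j t * ?E t)"
    proof (cases "0 < t")
      case True
      have tt: "t powr (P - 1) = t powr (P - 2) * t"
        using True powr_add[of t "P-2" 1] by simp
      have "k t * ?D t = ennreal (P * t powr (P - 2)) * (ennreal t * ?D t)"
        unfolding mult.assoc[symmetric] using True P by (simp add: k_def tt mult_ac flip: ennreal_mult)
      also have "\<dots> \<le> ennreal (P * t powr (P - 2)) * (10 * ?E t)"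
        using True weak_type_truncated[of w g t] unfolding D E by (intro mult_left_mono) auto
      also have "\<dots> = (ennreal (P * t powr (P - 2)) * ennreal 10) * ?E t"
        by (simp add: mult.assoc)
      also have "\<dots> = (ennreal (10 * P / (P - 1)) * ennreal ((P-1) * t powr (P - 2))) * ?E t"
        using P by (subst (1 2) ennreal_mult[symmetric]) (auto simp: mult_ac)
      finally show ?thesis using True by (simp add: j_def mult.assoc)
    qed (simp add: k_def)
  qed
  also have "\<dots> = ennreal (10 * P / (P - 1)) * (\<integral>\<^sup>+t. j t * ?E t \<partial>lborel)"
    by (rule nn_integral_cmult) measurable
  also have "(\<integral>\<^sup>+t. j t * ?E t \<partial>lborel) = (\<integral>\<^sup>+t. (\<integral>\<^sup>+x. j t * E t x \<partial>lborel) \<partial>lborel)"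
    by (intro nn_integral_cong nn_integral_cmult[symmetric]) measurable
  also have "\<dots> = (\<integral>\<^sup>+x. (\<integral>\<^sup>+t. j t * E t x \<partial>lborel) \<partial>lborel)"
    by (rule lborel_pair.Fubini'[symmetric]) measurable
  also have "\<dots> = (\<integral>\<^sup>+x. ennreal (2 powr (P - 1)) * (ennreal_powr (g x) P * hl_max w x) \<partial>lborel)"
  proof (rule nn_integral_cong)
    fix x
    have "(\<integral>\<^sup>+t. j t * E t x \<partial>lborel)
       = (\<integral>\<^sup>+t. (g x * hl_max w x) * (j t * indicator {t. ennreal t < 2 * g x} t) \<partial>lborel)"
      by (intro nn_integral_cong) (auto simp: E_def mult_ac)
    also have "\<dots> = (g x * hl_max w x) * ennreal_powr (2 * g x) (P - 1)"
      using P by (subst nn_integral_cmult) (simp_all add: layer_cake j_def mult_ac)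
    also have "\<dots> = ennreal (2 powr (P - 1)) * (ennreal_powr (g x) P * hl_max w x)"
      using ennreal_powr_add_exp[of 1 "P-1" "g x"] ennreal_powr_ennreal[of 2 "P-1"] P by (simp add: ennreal_powr_mult mult_ac)
    finally show "(\<integral>\<^sup>+t. j t * E t x \<partial>lborel) = ennreal (2 powr (P - 1)) * (ennreal_powr (g x) P * hl_max w x)" .
  qed
  also have "\<dots> = ennreal (2 powr (P - 1)) * (\<integral>\<^sup>+x. (ennreal_powr (g x) P * hl_max w x) \<partial>lborel)"
    by (rule nn_integral_cmult) measurable
  also have "ennreal (10 * P / (P - 1)) * \<dots> = ennreal (10 * P / (P - 1) * 2 powr (P - 1)) * (\<integral>\<^sup>+x. ennreal_powr (g x) P * hl_max w x \<partial>lborel)"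
    using P by (subst ennreal_mult) (simp_all add: mult.assoc)
  finally show ?thesis .
qed

lemma hl_max_bounded:
  assumes [measurable]: "g \<in> borel_measurable borel" and P: "1 < P"
  shows "(\<integral>\<^sup>+x. ennreal_powr (hl_max g x) P \<partial>lborel)
    \<le> ennreal (10 * P / (P - 1) * 2 powr (P - 1)) * (\<integral>\<^sup>+x. ennreal_powr (g x) P \<partial>lborel)"
proof -
  have "(\<integral>\<^sup>+x. ennreal_powr (hl_max g x) P \<partial>lborel) = (\<integral>\<^sup>+x. ennreal_powr (hl_max g x) P * 1 \<partial>lborel)"
    by (simp only: mult_1_right)
  also have "\<dots> \<le> ennreal (10 * P / (P - 1) * 2 powr (P - 1)) * (\<integral>\<^sup>+x. ennreal_powr (g x) P * hl_max (\<lambda>_. 1) x \<partial>lborel)"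
    using P by (intro weighted_hl_max) measurable
  also have "\<dots> \<le> ennreal (10 * P / (P - 1) * 2 powr (P - 1)) * (\<integral>\<^sup>+x. ennreal_powr (g x) P * 1 \<partial>lborel)"
    by (intro mult_left_mono nn_integral_mono hl_max_const_le) auto
  finally show "(\<integral>\<^sup>+x. ennreal_powr (hl_max g x) P \<partial>lborel)
      \<le> ennreal (10 * P / (P - 1) * 2 powr (P - 1)) * (\<integral>\<^sup>+x. ennreal_powr (g x) P \<partial>lborel)"
    by (simp only: mult_1_right)
qed

section \<open>The Coifman--Rochberg estimate\<close>

lemma le_ennreal_powr_half: "x\<^sup>2 \<le> y \<Longrightarrow> x \<le> ennreal_powr y (1/2)"
  using ennreal_powr_le_iff[of 2 x y] by (simp add: ennreal_powr_2)

lemma ball_avg_Cauchy_Schwarz: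
  assumes [measurable]: "f \<in> borel_measurable borel" "g \<in> borel_measurable borel"
  shows "(ball_avg a r (\<lambda>y. f y * g y))\<^sup>2 \<le> ball_avg a r (\<lambda>y. (f y)\<^sup>2) * ball_avg a r (\<lambda>y. (g y)\<^sup>2)"
proof -
  let ?I = "indicator (ball a r) :: real \<Rightarrow> ennreal"
  have "(\<integral>\<^sup>+y. (f y * ?I y) * (g y * ?I y) \<partial>lborel)\<^sup>2
    \<le> (\<integral>\<^sup>+y. (f y * ?I y)\<^sup>2 \<partial>lborel) * (\<integral>\<^sup>+y. (g y * ?I y)\<^sup>2 \<partial>lborel)"
    by (rule Cauchy_Schwarz_nn_integral) measurable
  moreover have "(\<lambda>y. (f y * ?I y) * (g y * ?I y)) = (\<lambda>y. f y * g y * ?I y)"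
    by (auto split: split_indicator)
  moreover have "(\<lambda>y. (f y * ?I y)\<^sup>2) = (\<lambda>y. (f y)\<^sup>2 * ?I y)" "(\<lambda>y. (g y * ?I y)\<^sup>2) = (\<lambda>y. (g y)\<^sup>2 * ?I y)"
    by (auto split: split_indicator)
  ultimately have "(\<integral>\<^sup>+y. f y * g y * ?I y \<partial>lborel)\<^sup>2
    \<le> (\<integral>\<^sup>+y. (f y)\<^sup>2 * ?I y \<partial>lborel) * (\<integral>\<^sup>+y. (g y)\<^sup>2 * ?I y \<partial>lborel)"
    by (simp only:)
  then have "(ennreal (1 / (2 * r)))\<^sup>2 * (\<integral>\<^sup>+y. f y * g y * ?I y \<partial>lborel)\<^sup>2
    \<le> (ennreal (1 / (2 * r)))\<^sup>2 * ((\<integral>\<^sup>+y. (f y)\<^sup>2 * ?I y \<partial>lborel) * (\<integral>\<^sup>+y. (g y)\<^sup>2 * ?I y \<partial>lborel))"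
    by (rule mult_left_mono) simp
  then show ?thesis
    unfolding ball_avg_def by (simp add: power2_eq_square mult_ac)
qed

text \<open>Kolmogorov's argument: split the layers at height \<open>A\<close>. Those below
  contribute at most the square root of \<open>A\<close> on average. Above \<open>A\<close> the weak
  type bound leaves the tail \<open>t powr (-3/2)\<close>, whose integral is of the same size. By
  the hypothesis \<open>A\<close> is a level at which the weak type estimate does not exceed the
  length of the ball, so the two parts balance.\<close>

lemma kolmogorov_real:
  assumes [measurable]: "g \<in> borel_measurable borel" and "0 < r" "0 < A"
    and le: "5 * (\<integral>\<^sup>+y. g y \<partial>lborel) \<le> ennreal (2 * r * A)"
  shows "ball_avg a r (\<lambda>y. ennreal_powr (hl_max g y) (1/2)) \<le> 2 * ennreal_powr (ennreal A) (1/2)"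
proof -
  let ?k = "\<lambda>t. ennreal (1/2 * t powr (1/2 - 1))"
  define D where "D t y = (if ennreal t < hl_max g y then ?k t * indicator {A..} t * indicator (ball a r) y else 0)" for t y
  have [measurable]: "case_prod D \<in> borel_measurable (borel \<Otimes>\<^sub>M borel)"
    unfolding D_def by measurable
  have pointwise: "ennreal_powr (hl_max g y) (1/2) * indicator (ball a r) y
      \<le> ennreal_powr (ennreal A) (1/2) * indicator (ball a r) y + (\<integral>\<^sup>+t. D t y \<partial>lborel)" for y
  proof (cases "y \<in> ball a r")
    case True
    have "ennreal_powr (hl_max g y) (1/2) = (\<integral>\<^sup>+t\<in>{0<..}. (indicator {t. ennreal t < hl_max g y} t * ?k t) \<partial>lborel)"
      by (rule layer_cake) simp
    also have "\<dots> \<le> (\<integral>\<^sup>+t. (indicator {t. ennreal t < ennreal A} t * ?k t) * indicator {0<..} t + D t y \<partial>lborel)"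
      using True \<open>0 < A\<close> by (intro nn_integral_mono) (auto simp: D_def ennreal_less_iff split: split_indicator)
    also have "\<dots> = (\<integral>\<^sup>+t\<in>{0<..}. (indicator {t. ennreal t < ennreal A} t * ?k t) \<partial>lborel) + (\<integral>\<^sup>+t. D t y \<partial>lborel)"
      by (rule nn_integral_add) measurable
    also have "(\<integral>\<^sup>+t\<in>{0<..}. (indicator {t. ennreal t < ennreal A} t * ?k t) \<partial>lborel) = ennreal_powr (ennreal A) (1/2)"
      by (rule layer_cake[symmetric]) simp
    finally show ?thesis using True by simp
  qed simp
  have inner: "(\<integral>\<^sup>+y. D t y \<partial>lborel) \<le> ennreal (r * A) * (ennreal (t powr (-3/2)) * indicator {A..} t)" for t
  proof (cases "A \<le> t")
    case True
    then have t: "0 < t" using \<open>0 < A\<close> by simp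
    have "(\<integral>\<^sup>+y. D t y \<partial>lborel) \<le> (\<integral>\<^sup>+y. ?k t * (1 * indicator {y. ennreal t < hl_max g y} y) \<partial>lborel)"
      by (intro nn_integral_mono) (auto simp: D_def split: split_indicator)
    also have "\<dots> = ?k t * (\<integral>\<^sup>+y. 1 * indicator {y. ennreal t < hl_max g y} y \<partial>lborel)"
      by (rule nn_integral_cmult) measurable
    also have "?k t = ennreal (1/2 * t powr (-3/2)) * ennreal t"
    proof -
      have "t powr (1/2 - 1) = t powr (-3/2) * t" using t powr_add[of t "-3/2" 1] by simp
      then show ?thesis using t by (simp flip: ennreal_mult)
    qed
    also have "ennreal (1/2 * t powr (-3/2)) * ennreal t * (\<integral>\<^sup>+y. 1 * indicator {y. ennreal t < hl_max g y} y \<partial>lborel)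
        \<le> ennreal (1/2 * t powr (-3/2)) * (5 * (\<integral>\<^sup>+y. g y * hl_max (\<lambda>_. 1) y \<partial>lborel))"
      unfolding mult.assoc by (intro mult_left_mono weak_type) auto
    also have "\<dots> \<le> ennreal (1/2 * t powr (-3/2)) * (5 * (\<integral>\<^sup>+y. g y * 1 \<partial>lborel))"
      by (intro mult_left_mono nn_integral_mono hl_max_const_le) auto
    also have "\<dots> \<le> ennreal (1/2 * t powr (-3/2)) * ennreal (2 * r * A)"
      using le by (intro mult_left_mono) (simp_all only: mult_1_right zero_le)
    also have "\<dots> = ennreal (r * A) * (ennreal (t powr (-3/2)) * indicator {A..} t)"
      using True \<open>0 < r\<close> \<open>0 < A\<close> by (simp add: mult_ac flip: ennreal_mult)
    finally show ?thesis .
  next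
    case False
    then have "D t y = 0" for y by (simp add: D_def)
    then show ?thesis by simp
  qed
  have "((\<lambda>t. t powr (-3/2)) has_integral - (A powr (-3/2 + 1)) / (-3/2 + 1)) {A..}"
    using \<open>0 < A\<close> by (intro has_integral_powr_to_inf) auto
  then have "((\<lambda>t. t powr (-3/2)) has_integral (2 * A powr (-1/2))) {A..}" by (simp add: mult.commute)
  then have tail: "(\<integral>\<^sup>+t. ennreal (t powr (-3/2)) * indicator {A..} t \<partial>lborel) = ennreal (2 * A powr (-1/2))"
    by (intro set_nn_integral_has_integral) auto
  have "(\<integral>\<^sup>+y. ennreal_powr (hl_max g y) (1/2) * indicator (ball a r) y \<partial>lborel)
     \<le> (\<integral>\<^sup>+y. ennreal_powr (ennreal A) (1/2) * indicator (ball a r) y + (\<integral>\<^sup>+t. D t y \<partial>lborel) \<partial>lborel)"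
    by (intro nn_integral_mono pointwise)
  also have "\<dots> = (\<integral>\<^sup>+y. ennreal_powr (ennreal A) (1/2) * indicator (ball a r) y \<partial>lborel) + (\<integral>\<^sup>+y. (\<integral>\<^sup>+t. D t y \<partial>lborel) \<partial>lborel)"
    by (rule nn_integral_add) measurable
  also have "(\<integral>\<^sup>+y. (\<integral>\<^sup>+t. D t y \<partial>lborel) \<partial>lborel) = (\<integral>\<^sup>+t. (\<integral>\<^sup>+y. D t y \<partial>lborel) \<partial>lborel)"
    by (rule lborel_pair.Fubini') measurable
  also have "\<dots> \<le> (\<integral>\<^sup>+t. ennreal (r * A) * (ennreal (t powr (-3/2)) * indicator {A..} t) \<partial>lborel)"
    by (intro nn_integral_mono inner)
  also have "\<dots> = ennreal (r * A) * (\<integral>\<^sup>+t. ennreal (t powr (-3/2)) * indicator {A..} t \<partial>lborel)"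
    by (rule nn_integral_cmult) measurable
  also have "\<dots> = ennreal (2 * r * A powr (1/2))"
  proof -
    have "A * A powr (-1/2) = A powr (1/2)" using \<open>0 < A\<close> powr_add[of A 1 "-1/2"] by simp
    then have "r * A * (2 * A powr (-1/2)) = 2 * r * A powr (1/2)"
      by (metis mult.assoc mult.commute)
    then show ?thesis
      unfolding tail using \<open>0 < A\<close> \<open>0 < r\<close> by (simp flip: ennreal_mult)
  qed
  also have "(\<integral>\<^sup>+y. ennreal_powr (ennreal A) (1/2) * indicator (ball a r) y \<partial>lborel) = ennreal (2 * r * A powr (1/2))"
    using \<open>0 < A\<close> \<open>0 < r\<close>
    by (simp add: nn_integral_cmult_indicator ball_eq_greaterThanLessThan ennreal_powr_ennreal mult_ac flip: ennreal_mult)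
  finally have "ball_avg a r (\<lambda>y. ennreal_powr (hl_max g y) (1/2))
      \<le> ennreal (1 / (2 * r)) * (ennreal (2 * r * A powr (1/2)) + ennreal (2 * r * A powr (1/2)))"
    unfolding ball_avg_def by (intro mult_left_mono add_mono) auto
  also have "\<dots> = 2 * ennreal_powr (ennreal A) (1/2)"
    using \<open>0 < A\<close> \<open>0 < r\<close> by (simp add: ennreal_powr_ennreal flip: ennreal_mult ennreal_plus ennreal_numeral)
  finally show ?thesis .
qed

lemma kolmogorov:
  assumes [measurable]: "g \<in> borel_measurable borel" and "0 < r"
    and le: "5 * (\<integral>\<^sup>+y. g y \<partial>lborel) \<le> ennreal (2 * r) * A"
  shows "ball_avg a r (\<lambda>y. ennreal_powr (hl_max g y) (1/2)) \<le> 2 * ennreal_powr A (1/2)"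
proof (cases A)
  case (real b)
  show ?thesis
  proof (cases "b = 0")
    \<comment> \<open>The layers cannot be split at height \<open>0\<close>; here \<open>g\<close>
      vanishes almost everywhere and its maximal function vanishes identically.\<close>
    case True
    with le real have "(\<integral>\<^sup>+y. g y \<partial>lborel) = 0" by simp
    then have "AE y in lborel. g y \<le> 0" by (subst (asm) nn_integral_0_iff_AE) auto
    then have "hl_max g y \<le> 0" for y
      using hl_max_mono_AE[of g "\<lambda>_. 0" y] hl_max_const_le[of 0 y] by (meson order_trans)
    then have "hl_max g y = 0" for y by simp
    then show ?thesis by (simp add: ball_avg_def)
  next
    case False
    with real le \<open>0 < r\<close> show ?thesis
      by (simp only: real(2)) (intro kolmogorov_real, simp_all add: ennreal_mult)
  qed
qed (simp add: ennreal_mult_top)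

text \<open>The Coifman--Rochberg argument: up to a constant, the values of the maximal function on an
  interval come either from the triple interval, where the weak type estimate applies, or from longer
  intervals, which may be enlarged to contain the point \<open>x\<close>.\<close>

lemma coifman_rochberg:
  assumes [measurable]: "h \<in> borel_measurable borel" and c: "(a, r) \<in> rational_balls" and x: "x \<in> ball a r"
  shows "ball_avg a r (\<lambda>y. ennreal_powr (h y + hl_max h y) (1/2)) \<le> 49 * ennreal_powr (hl_max h x) (1/2)"
proof -
  have r: "a \<in> \<rat>" "r \<in> \<rat>" "0 < r" using c by (auto simp: rational_balls_def)
  define m where "m = hl_max h x"
  define h' where "h' y = h y * indicator (ball a (3 * r)) y" for y
  have [measurable]: "h' \<in> borel_measurable borel" unfolding h'_def by measurable
  have loc: "hl_max h y \<le> hl_max h' y + 3 * m" if y: "y \<in> ball a r" for y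
  proof (rule hl_max_leI)
    fix b t assume b: "(b, t) \<in> rational_balls" "y \<in> ball b t"
    have bt: "b \<in> \<rat>" "t \<in> \<rat>" "0 < t" using b by (auto simp: rational_balls_def)
    show "ball_avg b t h \<le> hl_max h' y + 3 * m"
    proof (cases "t < r")
      case True
      have "ball b t \<subseteq> ball a (3 * r)"
        using True b(2) y by (auto simp: dist_real_def)
      then have "h z * indicator (ball b t) z = h' z * indicator (ball b t) z" for z
        using subsetD[of "ball b t" "ball a (3 * r)" z]
        by (cases "z \<in> ball b t") (simp_all add: h'_def del: mem_ball)
      then have "ball_avg b t h = ball_avg b t h'"
        unfolding ball_avg_def by simp
      also have "\<dots> \<le> hl_max h' y" by (rule ball_avg_le_hl_max[OF b])
      finally show ?thesis by (simp add: add_increasing2)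
    next
      case False
      \<comment> \<open>The enlarged ball reaches \<open>x\<close>, which is within
        \<open>2 * r\<close> of \<open>y\<close>; since \<open>r \<le> t\<close>, its length grows
        by a factor of at most 3.\<close>
      have "ball_avg b t h \<le> ennreal 3 * ball_avg b (t + 2 * r) h"
        using False r bt by (intro ball_avg_mono) auto
      also have "\<dots> \<le> ennreal 3 * m"
        unfolding m_def using x y b bt r
        by (intro mult_left_mono ball_avg_le_hl_max) (auto simp: rational_balls_def dist_real_def)
      finally show ?thesis by (simp add: add_increasing)
    qed
  qed
  have s2: "ennreal (2 powr (1/2)) \<le> 2"
    using powr_mono[of "1/2" 1 "2::real"] ennreal_leI[of "2 powr (1/2)" 2] by simp
  have ep2: "ennreal_powr (u + v) (1/2) \<le> 2 * (ennreal_powr u (1/2) + ennreal_powr v (1/2))" for u v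
    using ennreal_powr_add_le[of "1/2" u v] mult_right_mono[OF s2] by (meson order_trans zero_le half_gt_zero_iff zero_less_one)
  define e where "e u = ennreal_powr u (1/2)" for u
  have e3: "e (3 * m) \<le> 2 * e m"
  proof -
    have "e 3 \<le> 2"
      using ennreal_powr_ennreal[of 3 "1/2"] ennreal_leI[of "3 powr (1/2)" 2] powr_mono2[of "1/2" 3 4]
        powr_half_sqrt[of 4] by (simp add: e_def)
    then show ?thesis by (simp add: e_def ennreal_powr_mult mult_right_mono)
  qed
  have e15: "e (15 * m) \<le> 4 * e m"
  proof -
    have "e 15 \<le> 4"
      using ennreal_powr_ennreal[of 15 "1/2"] ennreal_leI[of "15 powr (1/2)" 4] powr_mono2[of "1/2" 15 16]
        powr_half_sqrt[of 16] by (simp add: e_def)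
    then show ?thesis by (simp add: e_def ennreal_powr_mult mult_right_mono)
  qed
  have pw: "e (h y + hl_max h y) \<le> 2 * e (h y) + (4 * e (hl_max h' y) + 8 * e m)" if "y \<in> ball a r" for y
  proof -
    have "e (h y + hl_max h y) \<le> 2 * (e (h y) + e (hl_max h y))"
      unfolding e_def by (rule ep2)
    also have "e (hl_max h y) \<le> e (hl_max h' y + 3 * m)"
      unfolding e_def using loc[OF that] by (intro ennreal_powr_mono) auto
    also have "\<dots> \<le> 2 * (e (hl_max h' y) + e (3 * m))"
      unfolding e_def by (rule ep2)
    also have "\<dots> \<le> 2 * (e (hl_max h' y) + 2 * e m)"
      by (intro mult_left_mono add_left_mono e3) auto
    finally show ?thesis by (simp add: distrib_left mult.assoc[symmetric] mult_left_mono add_left_mono)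
  qed
  have [measurable]: "(\<lambda>y. e (h y)) \<in> borel_measurable borel" "(\<lambda>y. e (hl_max h' y)) \<in> borel_measurable borel"
    unfolding e_def by measurable
  have avg_mult: "ball_avg a r (\<lambda>y. c * f y) = c * ball_avg a r f" if "f \<in> borel_measurable borel" for c f
    using that unfolding ball_avg_def by (simp add: mult.assoc mult.left_commute nn_integral_cmult)
  have "ball_avg a r (\<lambda>y. e (h y + hl_max h y)) \<le> ball_avg a r (\<lambda>y. 2 * e (h y) + (4 * e (hl_max h' y) + 8 * e m))"
    unfolding ball_avg_def using pw by (intro mult_left_mono nn_integral_mono) (auto split: split_indicator)
  also have "\<dots> = 2 * ball_avg a r (\<lambda>y. e (h y)) + (4 * ball_avg a r (\<lambda>y. e (hl_max h' y)) + 8 * e m)"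
    using r by (simp add: ball_avg_add avg_mult ball_avg_const)
  also have "\<dots> \<le> 2 * e m + (4 * (2 * (4 * e m)) + 8 * e m)"
  proof (intro add_mono mult_left_mono)
    \<comment> \<open>Jensen's inequality for the square root, as Cauchy--Schwarz against the
      constant \<open>1\<close>.\<close>
    have "(ball_avg a r (\<lambda>y. e (h y) * 1))\<^sup>2 \<le> ball_avg a r (\<lambda>y. (e (h y))\<^sup>2) * ball_avg a r (\<lambda>y. 1\<^sup>2)"
      by (rule ball_avg_Cauchy_Schwarz) measurable
    also have "\<dots> = ball_avg a r h"
      using r ball_avg_const[of r a 1] ennreal_powr_half_square by (simp add: e_def)
    also have "\<dots> \<le> m" unfolding m_def by (rule ball_avg_le_hl_max[OF c x])
    finally show "ball_avg a r (\<lambda>y. e (h y)) \<le> e m"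
      using le_ennreal_powr_half by (simp add: e_def)
  next
    have "ball_avg a (3 * r) h \<le> m"
      unfolding m_def using r x by (intro ball_avg_le_hl_max) (auto simp: rational_balls_def)
    then have "5 * (\<integral>\<^sup>+y. h' y \<partial>lborel) \<le> 5 * (ennreal (2 * (3 * r)) * m)"
      unfolding h'_def using r by (subst set_nn_integral_eq_ball_avg) (auto intro!: mult_left_mono)
    also have "\<dots> = (5 * ennreal (2 * (3 * r))) * m" by (simp add: mult.assoc)
    \<comment> \<open>The number 15 is the weak type constant 5 times the factor 3 between the two
      lengths.\<close>
    also have "5 * ennreal (2 * (3 * r)) = ennreal (2 * r) * 15"
      using r by (simp add: mult_ac flip: ennreal_mult ennreal_numeral)
    finally have "5 * (\<integral>\<^sup>+y. h' y \<partial>lborel) \<le> ennreal (2 * r) * (15 * m)"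
      by (simp add: mult.assoc)
    then have "ball_avg a r (\<lambda>y. e (hl_max h' y)) \<le> 2 * e (15 * m)"
      unfolding e_def using r by (intro kolmogorov) auto
    also have "\<dots> \<le> 2 * (4 * e m)" by (intro mult_left_mono e15) auto
    finally show "ball_avg a r (\<lambda>y. e (hl_max h' y)) \<le> 2 * (4 * e m)" .
  qed auto
  also have "\<dots> = (2 + (4 * (2 * 4) + 8)) * e m"
    by (simp only: distrib_right mult.assoc)
  \<comment> \<open>The sum is 42; it is rounded up to a square, whose root 7 appears in the next
    lemma.\<close>
  also have "\<dots> \<le> 49 * e m" by (intro mult_right_mono) simp_all
  finally show ?thesis unfolding e_def m_def .
qed

text \<open>The role of the exponent \<open>1/4\<close>: the square of the weight \<open>v\<close> still satisfies the
  Coifman--Rochberg estimate, and the remaining factor is a maximal function of a square.\<close>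

lemma hl_max_le_weight:
  fixes h :: "real \<Rightarrow> ennreal"
  defines "v \<equiv> \<lambda>y. ennreal_powr (h y + hl_max h y) (1/4)"
  assumes [measurable]: "h \<in> borel_measurable borel" "g \<in> borel_measurable borel"
    and ae: "AE y in lborel. g y \<le> g y * inverse (v y) * v y"
  shows "hl_max g x \<le> 7 * ennreal_powr (hl_max (\<lambda>y. (g y * inverse (v y))\<^sup>2) x) (1/2) * v x"
proof (rule hl_max_leI)
  fix a r assume c: "(a, r) \<in> rational_balls" "x \<in> ball a r"
  have [measurable]: "v \<in> borel_measurable borel" unfolding v_def by measurable
  have v2: "(v y)\<^sup>2 = ennreal_powr (h y + hl_max h y) (1/2)" for y
    unfolding v_def by (simp add: ennreal_powr_ennreal_powr flip: ennreal_powr_2)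
  \<comment> \<open>Where \<open>v\<close> is \<open>0\<close> or \<open>top\<close> the product
    \<open>inverse (v y) * v y\<close> is \<open>0\<close>, so the hypothesis says that
    \<open>g\<close> vanishes almost everywhere on that set.\<close>
  have "(ball_avg a r g)\<^sup>2 \<le> (ball_avg a r (\<lambda>y. g y * inverse (v y) * v y))\<^sup>2"
    using ae by (intro power_mono ball_avg_mono_AE) auto
  also have "\<dots> \<le> ball_avg a r (\<lambda>y. (g y * inverse (v y))\<^sup>2) * ball_avg a r (\<lambda>y. (v y)\<^sup>2)"
    by (rule ball_avg_Cauchy_Schwarz) measurable
  also have "\<dots> \<le> hl_max (\<lambda>y. (g y * inverse (v y))\<^sup>2) x * (49 * ennreal_powr (hl_max h x) (1/2))"
    unfolding v2 by (intro mult_mono ball_avg_le_hl_max[OF c] coifman_rochberg c) auto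
  also have "\<dots> \<le> hl_max (\<lambda>y. (g y * inverse (v y))\<^sup>2) x * (49 * (v x)\<^sup>2)"
    unfolding v2 by (intro mult_left_mono ennreal_powr_mono) (auto simp: add_increasing)
  also have "\<dots> = (7 * ennreal_powr (hl_max (\<lambda>y. (g y * inverse (v y))\<^sup>2) x) (1/2) * v x)\<^sup>2"
    by (simp add: power_mult_distrib ennreal_powr_half_square mult_ac)
  finally have "(ball_avg a r g)\<^sup>2 \<le> (7 * ennreal_powr (hl_max (\<lambda>y. (g y * inverse (v y))\<^sup>2) x) (1/2) * v x)\<^sup>2" .
  from le_ennreal_powr_half[OF this]
  show "ball_avg a r g \<le> 7 * ennreal_powr (hl_max (\<lambda>y. (g y * inverse (v y))\<^sup>2) x) (1/2) * v x"
    by (simp add: ennreal_powr_ennreal_powr flip: ennreal_powr_2)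
qed

section \<open>The vector-valued maximal inequality\<close>

lemma mult_inverse_ennreal_powr_le:
  assumes "0 < a" "a < 1"
  shows "x * inverse (ennreal_powr x (1 - a)) \<le> ennreal_powr x a"
proof -
  have e: "ennreal_powr x a * ennreal_powr x (1 - a) = x"
    using ennreal_powr_add_exp[of a "1 - a" x] assms by simp
  have "x * inverse (ennreal_powr x (1 - a)) = ennreal_powr x a * (ennreal_powr x (1 - a) * inverse (ennreal_powr x (1 - a)))"
    unfolding mult.assoc[symmetric] e ..
  also have "\<dots> \<le> ennreal_powr x a * 1"
    by (intro mult_left_mono mult_inverse_le_1) auto
  finally show ?thesis by simp
qed

lemma ennreal_inverse_antimono: "x \<le> y \<Longrightarrow> inverse y \<le> inverse (x::ennreal)"
proof (cases x; cases y)
  fix r t :: real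
  assume "x \<le> y" "0 \<le> r" "x = ennreal r" "0 \<le> t" "y = ennreal t"
  then show ?thesis
    by (cases "r = 0") (auto simp: inverse_ennreal intro!: ennreal_leI le_imp_inverse_le)
qed (auto simp: top_unique)

text \<open>Young's inequality with exponents \<open>1 / a\<close> and \<open>1 / (1 - a)\<close>,
  without sharp constants: if \<open>x\<close> is at most \<open>v\<close> to the power
  \<open>1 / d\<close>, the second term dominates; otherwise \<open>x\<close> to the power
  \<open>1 - a\<close> can be replaced by the smaller power of \<open>v\<close> in the denominator.
  It trades a concave power of an integral for the integral itself with a weight.\<close>

lemma ennreal_powr_le_weight_split:
  assumes a: "0 < a" "a < 1" and d: "0 < d"
  shows "ennreal_powr x a \<le> x * inverse (ennreal_powr v ((1 - a) / d)) + ennreal_powr v (a / d)"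
proof (cases "x \<le> ennreal_powr v (1 / d)")
  case True
  then have "ennreal_powr x a \<le> ennreal_powr v (a / d)"
    using ennreal_powr_mono[OF a(1) True] by (simp add: ennreal_powr_ennreal_powr)
  then show ?thesis by (simp add: add_increasing)
next
  case False
  then have "ennreal_powr v (1 / d) < x" by simp
  then have le: "ennreal_powr v ((1 - a) / d) \<le> ennreal_powr x (1 - a)"
    and v: "ennreal_powr v ((1 - a) / d) \<noteq> top"
    using ennreal_powr_mono[of "1 - a" "ennreal_powr v (1 / d)" x] a by (auto simp: ennreal_powr_ennreal_powr less_le top_unique)
  have x0: "x \<noteq> 0" using False by auto
  show ?thesis
  proof (cases "x = top")
    case True
    with v show ?thesis by (simp add: ennreal_top_mult ennreal_inverse_eq_0_iff less_top)
  next
    case False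
    have "ennreal_powr x a = ennreal_powr x a * (ennreal_powr x (1 - a) * inverse (ennreal_powr x (1 - a)))"
    proof -
      have "ennreal_powr x (1 - a) * inverse (ennreal_powr x (1 - a)) = 1"
        using False x0 ennreal_divide_self[of "ennreal_powr x (1 - a)"]
        by (simp add: divide_ennreal_def less_top[symmetric])
      then show ?thesis by simp
    qed
    also have "\<dots> = x * inverse (ennreal_powr x (1 - a))"
    proof -
      have "ennreal_powr x a * ennreal_powr x (1 - a) = x"
        using ennreal_powr_add_exp[of a "1 - a" x] a by simp
      then show ?thesis by (simp only: mult.assoc[symmetric])
    qed
    also have "\<dots> \<le> x * inverse (ennreal_powr v ((1 - a) / d))"
      by (intro mult_left_mono ennreal_inverse_antimono le) auto
    finally show ?thesis by (simp add: add_increasing2)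
  qed
qed

text \<open>The two terms dominate according to the position of \<open>y\<close> relative to
  \<open>k\<close> times the power \<open>a - 1\<close> of \<open>x\<close>. The parameter
  \<open>k\<close> stays free so that the second coefficient can be made small enough for
  absorption.\<close>

lemma mult_le_ep_split:
  assumes a: "1 < a" and k: "0 < k"
  shows "x * y \<le> ennreal k * ennreal_powr x a
    + ennreal (k powr (- 1 / (a - 1))) * ennreal_powr y (a / (a - 1))"
proof (cases "y \<le> ennreal k * ennreal_powr x (a - 1)")
  case True
  then have "x * y \<le> x * (ennreal k * ennreal_powr x (a - 1))" by (rule mult_left_mono) simp
  also have "\<dots> = ennreal k * ennreal_powr x a"
    using ennreal_powr_add_exp[of 1 "a - 1" x] a by (simp add: mult_ac)
  finally show ?thesis by (simp add: add_increasing2)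
next
  case False
  have k1: "ennreal (1/k) * ennreal k = 1" using k by (simp flip: ennreal_mult)
  from False have "ennreal k * ennreal_powr x (a - 1) \<le> y" by simp
  then have "ennreal (1/k) * (ennreal k * ennreal_powr x (a - 1)) \<le> ennreal (1/k) * y"
    by (rule mult_left_mono) simp
  then have "ennreal_powr x (a - 1) \<le> ennreal (1/k) * y"
    by (simp add: mult.assoc[symmetric] k1)
  then have "x \<le> ennreal_powr (ennreal (1/k) * y) (1 / (a - 1))"
    using a by (simp add: ennreal_powr_le_iff)
  also have "\<dots> = ennreal (k powr (- 1 / (a - 1))) * ennreal_powr y (1 / (a - 1))"
    using k by (simp add: ennreal_powr_mult ennreal_powr_ennreal powr_divide powr_minus_divide)
  finally have "x * y \<le> ennreal (k powr (- 1 / (a - 1))) * ennreal_powr y (1 / (a - 1)) * y"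
    by (rule mult_right_mono) simp
  also have "\<dots> = ennreal (k powr (- 1 / (a - 1))) * ennreal_powr y (1 / (a - 1) + 1)"
    using a ennreal_powr_add_exp[of "1 / (a - 1)" 1 y] by (simp add: mult.assoc)
  also have "1 / (a - 1) + 1 = a / (a - 1)" using a by (simp add: field_simps)
  finally show ?thesis by (simp add: add_increasing)
qed

section \<open>Maximal inequalities with values in a space of functions of the parameter\<close>

context sigma_finite_measure
begin

lemma pair_lborel: "pair_sigma_finite M (lborel :: real measure)"
  by (intro pair_sigma_finite.intro sigma_finite_measure_axioms sigma_finite_lborel)

text \<open>The outer power is one and the weight does not depend on the parameter, so Tonelli lets
  the scalar inequality act for each \<open>x\<close> separately; its constant at exponent 2 is
  40.\<close>

lemma vector_maximal_weighted:
  fixes g :: "'a \<Rightarrow> real \<Rightarrow> ennreal"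
  assumes [measurable]: "case_prod g \<in> borel_measurable (M \<Otimes>\<^sub>M borel)" "w \<in> borel_measurable borel"
  shows "(\<integral>\<^sup>+y. (\<integral>\<^sup>+x. ennreal_powr (hl_max (g x) y) 2 \<partial>M) * w y \<partial>lborel)
      \<le> ennreal 40 * (\<integral>\<^sup>+y. (\<integral>\<^sup>+x. ennreal_powr (g x y) 2 \<partial>M) * hl_max w y \<partial>lborel)"
proof -
  interpret P: pair_sigma_finite M "lborel :: real measure" by (rule pair_lborel)
  have [measurable]: "(\<lambda>(x, y). hl_max (g x) y) \<in> borel_measurable (M \<Otimes>\<^sub>M borel)"
    unfolding case_prod_beta by (rule measurable_hl_max_param[where M=M]) measurable
  have gx [measurable]: "x \<in> space M \<Longrightarrow> g x \<in> borel_measurable borel" for x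
    by measurable
  have "(\<integral>\<^sup>+y. (\<integral>\<^sup>+x. ennreal_powr (hl_max (g x) y) 2 \<partial>M) * w y \<partial>lborel)
     = (\<integral>\<^sup>+y. (\<integral>\<^sup>+x. ennreal_powr (hl_max (g x) y) 2 * w y \<partial>M) \<partial>lborel)"
    by (intro nn_integral_cong nn_integral_multc[symmetric]) measurable
  also have "\<dots> = (\<integral>\<^sup>+x. (\<integral>\<^sup>+y. ennreal_powr (hl_max (g x) y) 2 * w y \<partial>lborel) \<partial>M)"
    by (rule P.Fubini') measurable
  also have "\<dots> \<le> (\<integral>\<^sup>+x. ennreal 40 * (\<integral>\<^sup>+y. ennreal_powr (g x y) 2 * hl_max w y \<partial>lborel) \<partial>M)"
  proof (rule nn_integral_mono)
    fix x assume "x \<in> space M"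
    then show "(\<integral>\<^sup>+y. ennreal_powr (hl_max (g x) y) 2 * w y \<partial>lborel) \<le> ennreal 40 * (\<integral>\<^sup>+y. ennreal_powr (g x y) 2 * hl_max w y \<partial>lborel)"
      using weighted_hl_max[of w "g x" 2] by simp
  qed
  also have "\<dots> = ennreal 40 * (\<integral>\<^sup>+x. (\<integral>\<^sup>+y. ennreal_powr (g x y) 2 * hl_max w y \<partial>lborel) \<partial>M)"
    by (rule nn_integral_cmult) measurable
  also have "(\<integral>\<^sup>+x. (\<integral>\<^sup>+y. ennreal_powr (g x y) 2 * hl_max w y \<partial>lborel) \<partial>M)
      = (\<integral>\<^sup>+y. (\<integral>\<^sup>+x. ennreal_powr (g x y) 2 * hl_max w y \<partial>M) \<partial>lborel)"
    by (rule P.Fubini'[symmetric]) measurable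
  also have "\<dots> = (\<integral>\<^sup>+y. (\<integral>\<^sup>+x. ennreal_powr (g x y) 2 \<partial>M) * hl_max w y \<partial>lborel)"
    by (intro nn_integral_cong nn_integral_multc) measurable
  finally show "(\<integral>\<^sup>+y. (\<integral>\<^sup>+x. ennreal_powr (hl_max (g x) y) 2 \<partial>M) * w y \<partial>lborel)
      \<le> ennreal 40 * (\<integral>\<^sup>+y. (\<integral>\<^sup>+x. ennreal_powr (g x y) 2 \<partial>M) * hl_max w y \<partial>lborel)" .
qed

lemma vector_maximal_eq_1:
  fixes g :: "'a \<Rightarrow> real \<Rightarrow> ennreal"
  assumes [measurable]: "case_prod g \<in> borel_measurable (M \<Otimes>\<^sub>M borel)"
  shows "(\<integral>\<^sup>+y. (\<integral>\<^sup>+x. ennreal_powr (hl_max (g x) y) 2 \<partial>M) \<partial>lborel)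
      \<le> ennreal 40 * (\<integral>\<^sup>+y. (\<integral>\<^sup>+x. ennreal_powr (g x y) 2 \<partial>M) \<partial>lborel)"
proof -
  have "(\<integral>\<^sup>+y. (\<integral>\<^sup>+x. ennreal_powr (hl_max (g x) y) 2 \<partial>M) * 1 \<partial>lborel)
    \<le> ennreal 40 * (\<integral>\<^sup>+y. (\<integral>\<^sup>+x. ennreal_powr (g x y) 2 \<partial>M) * hl_max (\<lambda>_. 1) y \<partial>lborel)"
    by (rule vector_maximal_weighted) measurable
  also have "\<dots> \<le> ennreal 40 * (\<integral>\<^sup>+y. (\<integral>\<^sup>+x. ennreal_powr (g x y) 2 \<partial>M) * 1 \<partial>lborel)"
    by (intro mult_left_mono nn_integral_mono hl_max_const_le) auto
  finally show ?thesis
    by (simp only: mult_1_right)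
qed

text \<open>Truncating in height and in space makes the integral finite, as the absorption argument
  requires; monotone convergence then removes the truncation.\<close>

lemma ennreal_powr_SUP_truncate:
  fixes u :: "real \<Rightarrow> ennreal"
  assumes "0 < a"
  shows "ennreal_powr (u y) a \<le> (SUP n::nat. ennreal_powr (min (u y) (of_nat n)) a * indicator {- real n..real n} y)"
proof (rule dense_le)
  fix z assume z: "z < ennreal_powr (u y) a"
  then have "ennreal_powr z (1/a) < u y" "ennreal_powr z (1/a) < top"
    using assms order.strict_trans2[OF _ top_greatest] by (auto simp: ennreal_powr_less_iff)
  moreover then obtain n where "ennreal_powr z (1/a) < of_nat n"
    using ennreal_Ex_less_of_nat[of "ennreal_powr z (1/a)"] by auto
  moreover obtain m where "\<bar>y\<bar> < real m" using reals_Archimedean2 by blast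
  moreover have "(of_nat n :: ennreal) \<le> of_nat (max n m)" by (intro of_nat_mono) simp
  ultimately have "ennreal_powr z (1/a) < min (u y) (of_nat (max n m))" "\<bar>y\<bar> \<le> real (max n m)"
    unfolding min_less_iff_conj by (meson less_le_trans, simp)
  then have "z < ennreal_powr (min (u y) (of_nat (max n m))) a" "y \<in> {- real (max n m)..real (max n m)}"
    using assms by (simp_all only: ennreal_powr_less_iff) auto
  then have "z \<le> ennreal_powr (min (u y) (of_nat (max n m))) a * indicator {- real (max n m)..real (max n m)} y"
    by simp
  also have "\<dots> \<le> (SUP n::nat. ennreal_powr (min (u y) (of_nat n)) a * indicator {- real n..real n} y)"
    by (rule SUP_upper) simp
  finally show "z \<le> (SUP n::nat. ennreal_powr (min (u y) (of_nat n)) a * indicator {- real n..real n} y)" .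
qed

text \<open>Duality without duality: the weight is the truncated power of the left hand side itself.\<close>

lemma vector_maximal_gt_1:
  assumes a: "1 < a"
  obtains C :: real where "0 < C"
    "\<And>g :: 'a \<Rightarrow> real \<Rightarrow> ennreal. case_prod g \<in> borel_measurable (M \<Otimes>\<^sub>M borel) \<Longrightarrow>
      (\<integral>\<^sup>+y. ennreal_powr (\<integral>\<^sup>+x. ennreal_powr (hl_max (g x) y) 2 \<partial>M) a \<partial>lborel)
      \<le> ennreal C * (\<integral>\<^sup>+y. ennreal_powr (\<integral>\<^sup>+x. ennreal_powr (g x y) 2 \<partial>M) a \<partial>lborel)"
proof -
  define C :: real where "C = 40"
  define a' where "a' = a / (a - 1)"
  have a': "1 < a'" "(a - 1) * a' = a" using a by (auto simp: a'_def field_simps)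
  define D where "D = 10 * a' / (a' - 1) * 2 powr (a' - 1)"
  have C: "0 < C" and D: "0 < D" using a' by (auto simp: C_def D_def)
  \<comment> \<open>Chosen so that the second coefficient in Young's inequality, multiplied by the
    constants \<open>C\<close> and \<open>D\<close> of the two maximal inequalities, becomes
    \<open>1/2\<close>.\<close>
  define k where "k = (2 * C * D) powr (a - 1)"
  have k: "0 < k" "k powr (- 1 / (a - 1)) = 1 / (2 * C * D)"
    using C D a by (auto simp: k_def powr_powr powr_minus_divide)
  show thesis
  proof (rule that[of "2 * C * k"])
    show "0 < 2 * C * k" using C k by simp
    fix g :: "'a \<Rightarrow> real \<Rightarrow> ennreal" assume [measurable]: "case_prod g \<in> borel_measurable (M \<Otimes>\<^sub>M borel)"
    have [measurable]: "(\<lambda>(x, y). hl_max (g x) y) \<in> borel_measurable (M \<Otimes>\<^sub>M borel)"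
      unfolding case_prod_beta by (rule measurable_hl_max_param[where M=M]) measurable
    define F where "F y = (\<integral>\<^sup>+x. ennreal_powr (hl_max (g x) y) 2 \<partial>M)" for y
    define G where "G y = (\<integral>\<^sup>+x. ennreal_powr (g x y) 2 \<partial>M)" for y
    have [measurable]: "F \<in> borel_measurable borel" "G \<in> borel_measurable borel"
      unfolding F_def G_def by measurable
    define J where "J = (\<integral>\<^sup>+y. ennreal_powr (G y) a \<partial>lborel)"
    define H where "H n y = ennreal_powr (min (F y) (of_nat n)) a * indicator {- real n..real n} y" for n y
    have [measurable]: "H n \<in> borel_measurable borel" for n unfolding H_def by measurable
    have S: "(\<integral>\<^sup>+y. H n y \<partial>lborel) \<le> ennreal (2 * C * k) * J" for n
    proof -
      define S where "S = (\<integral>\<^sup>+y. H n y \<partial>lborel)"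
      define w where "w y = ennreal_powr (min (F y) (of_nat n)) (a - 1) * indicator {- real n..real n} y" for y
      have [measurable]: "w \<in> borel_measurable borel" unfolding w_def by measurable
      \<comment> \<open>Finiteness of \<open>S\<close> is what permits subtracting
        \<open>S / 2\<close> from both sides at the end.\<close>
      have "S \<le> (\<integral>\<^sup>+y. ennreal_powr (of_nat n) a * indicator {- real n..real n} y \<partial>lborel)"
        unfolding S_def H_def using a by (intro nn_integral_mono mult_right_mono ennreal_powr_mono) auto
      also have "\<dots> = ennreal_powr (of_nat n) a * ennreal (2 * real n)"
        by (simp add: nn_integral_cmult_indicator)
      also have "\<dots> < top"
        by (simp add: ennreal_of_nat_eq_real_of_nat ennreal_powr_ennreal flip: ennreal_mult)
      finally have fin: "S < top" .
      \<comment> \<open>Because \<open>(a - 1) * a' = a\<close>, the weight is extremal for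
        Hoelder's inequality: its power \<open>a'\<close> is the truncated integrand again.\<close>
      have wS: "(\<integral>\<^sup>+y. ennreal_powr (w y) a' \<partial>lborel) = S"
        unfolding S_def w_def H_def
        by (intro nn_integral_cong) (auto simp: ennreal_powr_ennreal_powr a' split: split_indicator)
      have "S \<le> (\<integral>\<^sup>+y. F y * w y \<partial>lborel)"
        unfolding S_def
      proof (rule nn_integral_mono)
        fix y
        have "ennreal_powr (min (F y) (of_nat n)) a = min (F y) (of_nat n) * ennreal_powr (min (F y) (of_nat n)) (a - 1)"
          using ennreal_powr_add_exp[of 1 "a - 1" "min (F y) (of_nat n)"] a by simp
        also have "\<dots> \<le> F y * ennreal_powr (min (F y) (of_nat n)) (a - 1)"
          by (intro mult_right_mono) auto
        finally show "H n y \<le> F y * w y"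
          unfolding H_def w_def mult.assoc[symmetric] by (rule mult_right_mono) simp
      qed
      also have "\<dots> \<le> ennreal C * (\<integral>\<^sup>+y. G y * hl_max w y \<partial>lborel)"
        unfolding F_def G_def C_def by (rule vector_maximal_weighted) measurable
      also have "\<dots> \<le> ennreal C * (\<integral>\<^sup>+y. ennreal k * ennreal_powr (G y) a
          + ennreal (1 / (2 * C * D)) * ennreal_powr (hl_max w y) a' \<partial>lborel)"
        using mult_le_ep_split[OF a k(1)] unfolding k(2) a'_def
        by (intro mult_left_mono nn_integral_mono) auto
      also have "(\<integral>\<^sup>+y. ennreal k * ennreal_powr (G y) a
          + ennreal (1 / (2 * C * D)) * ennreal_powr (hl_max w y) a' \<partial>lborel)
         = ennreal k * J + ennreal (1 / (2 * C * D)) * (\<integral>\<^sup>+y. ennreal_powr (hl_max w y) a' \<partial>lborel)"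
        by (simp add: nn_integral_add nn_integral_cmult J_def)
      also have "\<dots> \<le> ennreal k * J + ennreal (1 / (2 * C * D)) * (ennreal D * S)"
        using hl_max_bounded[of w a'] a'(1) unfolding wS D_def[symmetric] by (intro add_left_mono mult_left_mono) auto
      also have "ennreal C * (ennreal k * J + ennreal (1 / (2 * C * D)) * (ennreal D * S))
          = ennreal (C * k) * J + (ennreal C * (ennreal (1 / (2 * C * D)) * ennreal D)) * S"
        using C k(1) by (simp add: distrib_left mult.assoc[symmetric] ennreal_mult)
      also have "ennreal C * (ennreal (1 / (2 * C * D)) * ennreal D) = ennreal (1/2)"
        using C D by (simp flip: ennreal_mult)
      finally have "S \<le> ennreal (C * k) * J + ennreal (1/2) * S"
        by (simp add: mult_left_mono)
      then have "S \<le> 2 * (ennreal (C * k) * J)"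
      proof (cases "ennreal (C * k) * J")
        case (real b)
        then show ?thesis
          using \<open>S \<le> ennreal (C * k) * J + ennreal (1/2) * S\<close> fin
          by (cases S) (auto simp del: ennreal_half simp flip: ennreal_mult ennreal_plus ennreal_numeral)
      qed (simp add: ennreal_mult_top)
      also have "\<dots> = ennreal (2 * C * k) * J"
        using C k(1) by (simp add: ennreal_mult mult.assoc)
      finally show ?thesis unfolding S_def .
    qed
    have "(\<integral>\<^sup>+y. ennreal_powr (F y) a \<partial>lborel) \<le> (\<integral>\<^sup>+y. (SUP n. H n y) \<partial>lborel)"
      unfolding H_def using a by (intro nn_integral_mono ennreal_powr_SUP_truncate) auto
    also have "\<dots> = (SUP n. (\<integral>\<^sup>+y. H n y \<partial>lborel))"
    proof (rule nn_integral_monotone_convergence_SUP)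
      show "incseq H"
        unfolding H_def incseq_def le_fun_def using a
        by (intro allI impI mult_mono ennreal_powr_mono min.mono) (auto split: split_indicator)
    qed measurable
    also have "\<dots> \<le> ennreal (2 * C * k) * J"
      by (intro SUP_least S)
    finally show "(\<integral>\<^sup>+y. ennreal_powr (\<integral>\<^sup>+x. ennreal_powr (hl_max (g x) y) 2 \<partial>M) a \<partial>lborel)
      \<le> ennreal (2 * C * k) * (\<integral>\<^sup>+y. ennreal_powr (\<integral>\<^sup>+x. ennreal_powr (g x y) 2 \<partial>M) a \<partial>lborel)"
      unfolding F_def G_def J_def .
  qed
qed

text \<open>For exponents below 1 the weight is \<open>v = V powr (1/4)\<close> with \<open>V\<close> built from a small power of
  the right hand side; with \<open>b = (1 - a) / d\<close>, the exponent \<open>P = 4 b\<close> turns \<open>V powr b\<close> into \<open>v powr P\<close>.\<close>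

lemma vector_maximal_lt_1:
  assumes a: "0 < a" "a < 1" and d: "0 < d" "d < a" "d \<le> 1 - a"
  obtains C :: real where "0 < C"
    "\<And>g :: 'a \<Rightarrow> real \<Rightarrow> ennreal. case_prod g \<in> borel_measurable (M \<Otimes>\<^sub>M borel) \<Longrightarrow>
      (\<integral>\<^sup>+y. ennreal_powr (\<integral>\<^sup>+x. ennreal_powr (hl_max (g x) y) (4 * ((1 - a) / d)) \<partial>M) a \<partial>lborel)
      \<le> ennreal C * (\<integral>\<^sup>+y. ennreal_powr (\<integral>\<^sup>+x. ennreal_powr (g x y) (4 * ((1 - a) / d)) \<partial>M) a \<partial>lborel)"
proof -
  interpret P: pair_sigma_finite M "lborel :: real measure" by (rule pair_lborel)
  define b where "b = (1 - a) / d"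
  define P where "P = 4 * b"
  define K where "K Q = 10 * Q / (Q - 1) * 2 powr (Q - 1)" for Q :: real
  \<comment> \<open>The scalar maximal theorem will be used at the exponents
    \<open>P / 2 = 2 * b\<close> and \<open>a / d\<close>; the bounds on \<open>d\<close> are
    exactly what puts both above 1.\<close>
  have b: "1 \<le> b" using a d by (auto simp: b_def field_simps)
  then have P: "0 < P" "1 < P / 2" by (auto simp: P_def)
  have ad: "1 < a / d" using d by (simp add: field_simps)
  have K: "0 < K Q" if "1 < Q" for Q using that by (auto simp: K_def)
  define C1 where "C1 = 7 powr P * K (P / 2)"
  define C2 where "C2 = 2 powr (a / d) * (1 + K (a / d))"
  have C1: "0 < C1" using K[OF P(2)] by (simp add: C1_def)
  have C2: "0 < C2" using K[OF ad] by (simp add: C2_def)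
  show thesis
  proof (rule that[of "C1 + C2"])
    show "0 < C1 + C2" using C1 C2 by simp
    fix g :: "'a \<Rightarrow> real \<Rightarrow> ennreal" assume [measurable]: "case_prod g \<in> borel_measurable (M \<Otimes>\<^sub>M borel)"
    have [measurable]: "(\<lambda>(x, y). hl_max (g x) y) \<in> borel_measurable (M \<Otimes>\<^sub>M borel)"
      unfolding case_prod_beta by (rule measurable_hl_max_param[where M=M]) measurable
    define F where "F y = (\<integral>\<^sup>+x. ennreal_powr (hl_max (g x) y) P \<partial>M)" for y
    define G where "G y = (\<integral>\<^sup>+x. ennreal_powr (g x y) P \<partial>M)" for y
    have [measurable]: "F \<in> borel_measurable borel" "G \<in> borel_measurable borel"
      unfolding F_def G_def by measurable
    define J where "J = (\<integral>\<^sup>+y. ennreal_powr (G y) a \<partial>lborel)"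
    \<comment> \<open>The power \<open>a / d\<close> of \<open>h\<close> is the power
      \<open>a\<close> of \<open>G\<close>, so the scalar maximal theorem bounds the integral of the
      power \<open>a / d\<close> of \<open>V\<close> by \<open>J\<close>.\<close>
    define h where "h y = ennreal_powr (G y) d" for y
    have [measurable]: "h \<in> borel_measurable borel" unfolding h_def by measurable
    \<comment> \<open>Adding \<open>h\<close> itself gives \<open>h \<le> V\<close> at every point,
      with no appeal to Lebesgue differentiation.\<close>
    define V where "V y = h y + hl_max h y" for y
    have [measurable]: "V \<in> borel_measurable borel" unfolding V_def by measurable
    define v where "v y = ennreal_powr (V y) (1/4)" for y
    have [measurable]: "v \<in> borel_measurable borel" unfolding v_def by measurable
    have vP: "ennreal_powr (v y) P = ennreal_powr (V y) b" for y
      by (simp add: v_def ennreal_powr_ennreal_powr P_def)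
    have hV: "h y \<le> V y" for y by (simp add: V_def add_increasing2)

    have VJ: "(\<integral>\<^sup>+y. ennreal_powr (V y) (a / d) \<partial>lborel) \<le> ennreal C2 * J"
    proof -
      have hJ: "(\<integral>\<^sup>+y. ennreal_powr (h y) (a / d) \<partial>lborel) = J"
        using d by (simp add: h_def J_def ennreal_powr_ennreal_powr)
      have "(\<integral>\<^sup>+y. ennreal_powr (V y) (a / d) \<partial>lborel)
         \<le> (\<integral>\<^sup>+y. ennreal (2 powr (a / d)) * (ennreal_powr (h y) (a / d) + ennreal_powr (hl_max h y) (a / d)) \<partial>lborel)"
        unfolding V_def using ad by (intro nn_integral_mono ennreal_powr_add_le) simp
      also have "\<dots> = ennreal (2 powr (a / d)) * (J + (\<integral>\<^sup>+y. ennreal_powr (hl_max h y) (a / d) \<partial>lborel))"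
        unfolding hJ[symmetric] by (simp add: nn_integral_cmult nn_integral_add)
      also have "\<dots> \<le> ennreal (2 powr (a / d)) * (J + ennreal (K (a / d)) * J)"
        using hl_max_bounded[of h "a / d"] ad unfolding hJ K_def
        by (intro mult_left_mono add_left_mono) auto
      also have "\<dots> = ennreal C2 * J"
      proof -
        have "J + ennreal (K (a / d)) * J = ennreal (1 + K (a / d)) * J"
          using K[OF ad] by (simp add: distrib_right)
        then show ?thesis
          using K[OF ad] by (simp add: C2_def mult.assoc ennreal_mult)
      qed
      finally show ?thesis .
    qed

    have FJ: "(\<integral>\<^sup>+y. F y * inverse (ennreal_powr (V y) b) \<partial>lborel) \<le> ennreal C1 * J" if "J < top"
    proof -
      have "AE y in lborel. V y \<noteq> top"
      proof -
        have "(\<integral>\<^sup>+y. ennreal_powr (V y) (a / d) \<partial>lborel) \<noteq> \<infinity>"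
          using VJ that by (auto simp: top_unique ennreal_mult_eq_top_iff)
        then have "AE y in lborel. ennreal_powr (V y) (a / d) \<noteq> \<infinity>"
          by (intro nn_integral_noteq_infinite) measurable
        then show ?thesis by simp
      qed
      \<comment> \<open>Dividing by \<open>v\<close> loses nothing: \<open>V\<close> is finite
        almost everywhere because \<open>J\<close> is finite, and where \<open>V\<close> vanishes so
        does \<open>G\<close>, hence \<open>g x y\<close> for almost every \<open>x\<close>.\<close>
      then have "AE y in lborel. AE x in M. g x y \<le> g x y * inverse (v y) * v y"
      proof (eventually_elim)
        fix y assume y: "V y \<noteq> top"
        show "AE x in M. g x y \<le> g x y * inverse (v y) * v y"
        proof (cases "V y = 0")
          case True
          then have "G y = 0" using hV[of y] by (simp add: h_def)
          then have "AE x in M. ennreal_powr (g x y) P = 0"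
            unfolding G_def by (subst (asm) nn_integral_0_iff_AE) measurable
          then show ?thesis by (rule eventually_mono) simp
        next
          case False
          with y have "v y * inverse (v y) = 1"
            using ennreal_divide_self[of "v y"] by (simp add: divide_ennreal_def less_top[symmetric] v_def)
          then show ?thesis by (simp add: mult.assoc mult.commute[of "inverse (v y)"])
        qed
      qed
      then have ae: "AE x in M. AE y in lborel. g x y \<le> g x y * inverse (v y) * v y"
        by (subst P.AE_commute) measurable
      \<comment> \<open>The weight estimate bounds \<open>hl_max (g x)\<close> divided by
        \<open>v\<close> by the square root of \<open>hl_max (q x)\<close>. The weighted inequality
        at exponent \<open>P\<close> thus becomes an unweighted one for \<open>q x\<close> at
        exponent \<open>P / 2\<close>.\<close>
      define q where "q x y = (g x y * inverse (v y))\<^sup>2" for x y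
      let ?Q = "\<lambda>x. \<integral>\<^sup>+y. ennreal_powr (q x y) (P / 2) \<partial>lborel"
      let ?H = "\<lambda>x. \<integral>\<^sup>+y. ennreal_powr (hl_max (g x) y * inverse (v y)) P \<partial>lborel"
      have [measurable]: "case_prod q \<in> borel_measurable (M \<Otimes>\<^sub>M borel)" unfolding q_def by measurable
      have q: "ennreal_powr (q x y) (P / 2) = ennreal_powr (g x y) P * inverse (ennreal_powr (V y) b)" for x y
        using P(1) by (simp add: q_def ennreal_powr_ennreal_powr ennreal_powr_mult ennreal_powr_inverse vP flip: ennreal_powr_2)
      have "(\<integral>\<^sup>+y. F y * inverse (ennreal_powr (V y) b) \<partial>lborel)
        = (\<integral>\<^sup>+y. (\<integral>\<^sup>+x. ennreal_powr (hl_max (g x) y * inverse (v y)) P \<partial>M) \<partial>lborel)"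
        unfolding F_def using P(1)
        by (intro nn_integral_cong) (subst nn_integral_multc[symmetric], measurable, simp add: ennreal_powr_mult ennreal_powr_inverse vP)
      also have "\<dots> = (\<integral>\<^sup>+x. ?H x \<partial>M)"
        by (rule P.Fubini') measurable
      also have "\<dots> \<le> (\<integral>\<^sup>+x. ennreal C1 * ?Q x \<partial>M)"
      proof (rule nn_integral_mono_AE)
        show "AE x in M. ?H x
            \<le> ennreal C1 * ?Q x"
          using ae AE_space
        proof eventually_elim
          fix x assume x: "AE y in lborel. g x y \<le> g x y * inverse (v y) * v y" and [measurable]: "x \<in> space M"
          have [measurable]: "g x \<in> borel_measurable borel" "q x \<in> borel_measurable borel" by measurable
          have "hl_max (g x) y * inverse (v y) \<le> 7 * ennreal_powr (hl_max (q x) y) (1/2)" for y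
          proof -
            have "hl_max (g x) y \<le> 7 * ennreal_powr (hl_max (q x) y) (1/2) * v y"
              using x unfolding q_def v_def V_def by (intro hl_max_le_weight) measurable
            then have "hl_max (g x) y * inverse (v y) \<le> 7 * ennreal_powr (hl_max (q x) y) (1/2) * v y * inverse (v y)"
              by (rule mult_right_mono) simp
            also have "\<dots> \<le> 7 * ennreal_powr (hl_max (q x) y) (1/2) * 1"
              unfolding mult.assoc by (intro mult_left_mono) (simp_all add: mult_inverse_le_1)
            finally show ?thesis by simp
          qed
          then have "?H x
            \<le> (\<integral>\<^sup>+y. ennreal_powr (7 * ennreal_powr (hl_max (q x) y) (1/2)) P \<partial>lborel)"
            using P(1) by (intro nn_integral_mono ennreal_powr_mono) auto
          also have "\<dots> = (\<integral>\<^sup>+y. ennreal (7 powr P) * ennreal_powr (hl_max (q x) y) (P / 2) \<partial>lborel)"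
            using ennreal_powr_ennreal[of 7 P] by (simp add: ennreal_powr_mult ennreal_powr_ennreal_powr)
          also have "\<dots> = ennreal (7 powr P) * (\<integral>\<^sup>+y. ennreal_powr (hl_max (q x) y) (P / 2) \<partial>lborel)"
            by (rule nn_integral_cmult) measurable
          also have "\<dots> \<le> ennreal (7 powr P) * (ennreal (K (P / 2)) * ?Q x)"
            unfolding K_def using P(2) by (intro mult_left_mono hl_max_bounded) auto
          also have "\<dots> = ennreal C1 * ?Q x"
            using K[OF P(2)] by (simp add: C1_def ennreal_mult mult.assoc)
          finally show "?H x
            \<le> ennreal C1 * ?Q x" .
        qed
      qed
      also have "\<dots> = ennreal C1 * (\<integral>\<^sup>+x. ?Q x \<partial>M)"
        by (rule nn_integral_cmult) measurable
      also have "(\<integral>\<^sup>+x. ?Q x \<partial>M)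
          = (\<integral>\<^sup>+y. (\<integral>\<^sup>+x. ennreal_powr (q x y) (P / 2) \<partial>M) \<partial>lborel)"
        by (rule P.Fubini'[symmetric]) measurable
      also have "\<dots> = (\<integral>\<^sup>+y. G y * inverse (ennreal_powr (V y) b) \<partial>lborel)"
        unfolding q G_def by (intro nn_integral_cong nn_integral_multc) measurable
      also have "\<dots> \<le> J"
        unfolding J_def
      proof (rule nn_integral_mono)
        fix y
        \<comment> \<open>This is what \<open>b = (1 - a) / d\<close> is for: the weight then lowers
          \<open>G\<close> to its power \<open>a\<close>.\<close>
        have "ennreal_powr (G y) (1 - a) = ennreal_powr (h y) b"
          using d by (simp add: h_def ennreal_powr_ennreal_powr b_def)
        also have "\<dots> \<le> ennreal_powr (V y) b" using b hV by (intro ennreal_powr_mono) auto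
        finally have "G y * inverse (ennreal_powr (V y) b) \<le> G y * inverse (ennreal_powr (G y) (1 - a))"
          by (intro mult_left_mono ennreal_inverse_antimono) auto
        also have "\<dots> \<le> ennreal_powr (G y) a" by (rule mult_inverse_ennreal_powr_le[OF a])
        finally show "G y * inverse (ennreal_powr (V y) b) \<le> ennreal_powr (G y) a" .
      qed
      finally show ?thesis by (simp add: mult_left_mono)
    qed

    have "(\<integral>\<^sup>+y. ennreal_powr (F y) a \<partial>lborel) \<le> ennreal (C1 + C2) * J"
    proof (cases "J < top")
      case True
      have "(\<integral>\<^sup>+y. ennreal_powr (F y) a \<partial>lborel)
        \<le> (\<integral>\<^sup>+y. F y * inverse (ennreal_powr (V y) b) + ennreal_powr (V y) (a / d) \<partial>lborel)"
        unfolding b_def by (intro nn_integral_mono ennreal_powr_le_weight_split a d)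
      also have "\<dots> = (\<integral>\<^sup>+y. F y * inverse (ennreal_powr (V y) b) \<partial>lborel) + (\<integral>\<^sup>+y. ennreal_powr (V y) (a / d) \<partial>lborel)"
        by (rule nn_integral_add) measurable
      also have "\<dots> \<le> ennreal C1 * J + ennreal C2 * J"
        by (intro add_mono FJ VJ True)
      also have "\<dots> = ennreal (C1 + C2) * J"
        using C1 C2 by (simp add: distrib_right)
      finally show ?thesis .
    next
      case False
      then have "J = top" by (simp add: less_top[symmetric])
      then show ?thesis using C1 C2 by (simp add: ennreal_mult_top)
    qed
    then show "(\<integral>\<^sup>+y. ennreal_powr (\<integral>\<^sup>+x. ennreal_powr (hl_max (g x) y) (4 * ((1 - a) / d)) \<partial>M) a \<partial>lborel)
      \<le> ennreal (C1 + C2) * (\<integral>\<^sup>+y. ennreal_powr (\<integral>\<^sup>+x. ennreal_powr (g x y) (4 * ((1 - a) / d)) \<partial>M) a \<partial>lborel)"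
      unfolding F_def G_def J_def P_def b_def .
  qed
qed

text \<open>The inner exponent \<open>P\<close> is delivered, not prescribed: it may depend on
  \<open>a\<close>, and the application adapts the power of \<open>|f|\<close> to it.\<close>

lemma vector_maximal:
  assumes a: "0 < a"
  obtains P C :: real where "0 < P" "0 < C"
    "\<And>g :: 'a \<Rightarrow> real \<Rightarrow> ennreal. case_prod g \<in> borel_measurable (M \<Otimes>\<^sub>M borel) \<Longrightarrow>
      (\<integral>\<^sup>+y. ennreal_powr (\<integral>\<^sup>+x. ennreal_powr (hl_max (g x) y) P \<partial>M) a \<partial>lborel)
      \<le> ennreal C * (\<integral>\<^sup>+y. ennreal_powr (\<integral>\<^sup>+x. ennreal_powr (g x y) P \<partial>M) a \<partial>lborel)"
proof -
  consider "a < 1" | "a = 1" | "1 < a" by linarith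
  then show thesis
  proof cases
    case 1
    define d where "d = min (a / 2) (1 - a)"
    have d: "0 < d" "d < a" "d \<le> 1 - a" using a 1 by (auto simp: d_def min_def)
    show thesis
      by (rule vector_maximal_lt_1[OF a 1 d], rule that[of "4 * ((1 - a) / d)"]) (use d 1 in auto)
  next
    case 2
    show thesis by (rule that[of 2 40]) (use vector_maximal_eq_1 2 in auto)
  next
    case 3
    show thesis by (rule vector_maximal_gt_1[OF 3], rule that[of 2]) auto
  qed
qed

end

section \<open>Domination of the non-tangential maximal function\<close>

text \<open>The identity behind the modulus of a Blaschke factor; the last term vanishes for
  \<open>norm w = r\<close>. It serves both the reflection of zeros and the denominator of the
  Poisson kernel.\<close>

lemma norm_blaschke:
  "(norm (of_real (r\<^sup>2) - cnj a * w))\<^sup>2 = r\<^sup>2 * (norm (w - a))\<^sup>2 + (r\<^sup>2 - (norm w)\<^sup>2) * (r\<^sup>2 - (norm a)\<^sup>2)"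
  by (simp add: cmod_power2) (simp add: power2_eq_square algebra_simps)

text \<open>Each zero \<open>a\<close> is replaced by its reflection in the circle of radius \<open>r\<close>, which leaves
  the modulus on the circle unchanged and does not decrease it inside.\<close>

lemma zero_free_majorant:
  fixes f :: "complex \<Rightarrow> complex"
  assumes "0 < r" "open S" "connected S" "cball 0 r \<subseteq> S"
    and "finite Z" "f holomorphic_on S" "{z \<in> cball 0 r. f z = 0} = Z" "Z \<subseteq> ball 0 r"
  shows "\<exists>g. g holomorphic_on S \<and> (\<forall>z\<in>cball 0 r. g z \<noteq> 0 \<and> norm (f z) \<le> norm (g z))
    \<and> (\<forall>z\<in>sphere 0 r. norm (f z) = norm (g z))"
  using assms(5-)
proof (induction Z arbitrary: f rule: finite_induct)
  case empty
  then show ?case by (intro exI[of _ f]) auto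
next
  case (insert a Z)
  have a: "norm a < r" "a \<in> S" "f a = 0"
    using insert.prems assms(4) by auto
  have "infinite (cball (0::complex) r)"
    using \<open>0 < r\<close> uncountable_cball countable_finite by blast
  then have "\<not> f constant_on S"
  proof -
    { assume "f constant_on S"
      then have "f z = 0" if "z \<in> S" for z using a(2,3) that by (auto simp: constant_on_def)
      then have "{z \<in> cball 0 r. f z = 0} = cball 0 r" using assms(4) by auto
      then have False using insert.prems(2) insert.hyps(1) \<open>infinite (cball 0 r)\<close> by simp }
    then show ?thesis by blast
  qed
  then obtain g \<rho> n where g: "0 < n" "0 < \<rho>" "ball a \<rho> \<subseteq> S" "g holomorphic_on ball a \<rho>"
      "\<And>w. w \<in> ball a \<rho> \<Longrightarrow> f w = (w - a) ^ n * g w" "\<And>w. w \<in> ball a \<rho> \<Longrightarrow> g w \<noteq> 0"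
    using holomorphic_factor_zero_nonconstant[OF insert.prems(1) assms(2,3) a(2,3)] by metis
  \<comment> \<open>The zero \<open>a\<close> is divided out with its full multiplicity
    \<open>n\<close>; the local factorisation supplies the value at \<open>a\<close> and shows that
    it is not zero.\<close>
  define k where "k w = (if w = a then g a else f w / (w - a) ^ n)" for w
  have "k holomorphic_on (S - {a}) \<union> ball a \<rho>"
  proof (rule holomorphic_on_Un)
    have "(\<lambda>w. f w / (w - a) ^ n) holomorphic_on S - {a}"
      using insert.prems(1) by (intro holomorphic_intros) (auto elim: holomorphic_on_subset)
    then show "k holomorphic_on S - {a}"
      by (rule holomorphic_transform) (simp add: k_def)
    show "k holomorphic_on ball a \<rho>"
      using g(2) by (intro holomorphic_transform[OF g(4)]) (simp add: k_def g(5) del: mem_ball)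
  qed (use \<open>open S\<close> in auto)
  moreover have "(S - {a}) \<union> ball a \<rho> = S" using g(2,3) a(2) by auto
  ultimately have k: "k holomorphic_on S" by simp
  have fk: "f w = (w - a) ^ n * k w" for w
    using a(3) g(1) by (simp add: k_def)
  have ka: "k a \<noteq> 0" using g(2) g(6)[of a] by (simp add: k_def)
  \<comment> \<open>This is \<open>w - a\<close> divided by the Blaschke factor with zero
    \<open>a\<close>. For \<open>a \<noteq> 0\<close> its zero \<open>r\<^sup>2 / cnj a\<close> lies
    outside the closed disc.\<close>
  define b where "b w = (of_real (r\<^sup>2) - cnj a * w) / of_real r" for w
  have nb2: "(norm (b w))\<^sup>2 = (norm (w - a))\<^sup>2 + (r\<^sup>2 - (norm w)\<^sup>2) * (r\<^sup>2 - (norm a)\<^sup>2) / r\<^sup>2" for w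
    using \<open>0 < r\<close> by (simp only: b_def norm_divide power_divide norm_blaschke) (simp add: field_simps)
  have nb: "norm (w - a) \<le> norm (b w)" if "norm w \<le> r" for w
  proof (rule power2_le_imp_le)
    have "(norm w)\<^sup>2 \<le> r\<^sup>2" "(norm a)\<^sup>2 \<le> r\<^sup>2" using that a(1) by (auto intro: power_mono)
    then show "(norm (w - a))\<^sup>2 \<le> (norm (b w))\<^sup>2" unfolding nb2 by simp
  qed simp
  have nbs: "norm (w - a) = norm (b w)" if "norm w = r" for w
  proof (rule power2_eq_imp_eq)
    show "(norm (w - a))\<^sup>2 = (norm (b w))\<^sup>2" unfolding nb2 using that by simp
  qed auto
  have b0: "b w \<noteq> 0" if "norm w \<le> r" for w
  proof (cases "w = a")
    case True
    have "(norm a)\<^sup>2 < r\<^sup>2" using a(1) by (simp add: power_strict_mono)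
    then have "0 < (norm (b w))\<^sup>2" unfolding nb2 using True \<open>0 < r\<close> by simp
    then show ?thesis by auto
  next
    case False
    then have "0 < norm (w - a)" by simp
    then show ?thesis using nb[OF that] by auto
  qed
  define f1 where "f1 w = b w ^ n * k w" for w
  have f1: "f1 holomorphic_on S"
    unfolding f1_def b_def using k \<open>0 < r\<close> by (intro holomorphic_intros) auto
  have "{z \<in> cball 0 r. f1 z = 0} = Z"
  proof -
    have "f1 z = 0 \<longleftrightarrow> f z = 0 \<and> z \<noteq> a" if "z \<in> cball 0 r" for z
      using that b0[of z] ka by (auto simp: f1_def fk)
    then have "{z \<in> cball 0 r. f1 z = 0} = {z \<in> cball 0 r. f z = 0} - {a}" by auto
    then show ?thesis using insert.prems(2) insert.hyps(2) by auto
  qed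
  with insert.IH[OF f1] insert.prems(3) obtain h where h: "h holomorphic_on S"
      "\<forall>z\<in>cball 0 r. h z \<noteq> 0 \<and> norm (f1 z) \<le> norm (h z)" "\<forall>z\<in>sphere 0 r. norm (f1 z) = norm (h z)"
    by auto
  have "norm (f z) \<le> norm (f1 z)" if "z \<in> cball 0 r" for z
    unfolding fk f1_def norm_mult norm_power using that
    by (intro mult_right_mono power_mono nb) auto
  then have "norm (f z) \<le> norm (h z)" if "z \<in> cball 0 r" for z
    using h(2) that by (blast intro: order_trans)
  moreover have "norm (f z) = norm (h z)" if "z \<in> sphere 0 r" for z
  proof -
    have "norm (f z) = norm (f1 z)"
      unfolding fk f1_def norm_mult norm_power using that nbs[of z] by simp
    then show ?thesis using h(3) that by simp
  qed
  ultimately show ?case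
    using h(1,2) by blast
qed

section \<open>Poisson's formula for powers of the modulus\<close>

abbreviation poisson :: "real \<Rightarrow> real \<Rightarrow> real \<Rightarrow> real" where
  "poisson r \<rho> x \<equiv> (r\<^sup>2 - \<rho>\<^sup>2) / (2 * pi * (norm (rcis r x - of_real \<rho>))\<^sup>2)"

text \<open>Cauchy's formula for \<open>h u / (r\<^sup>2 - \<rho> u)\<close> is Poisson's formula for \<open>h\<close>.\<close>

lemma poisson_bound:
  assumes "continuous_on (cball 0 r) h" "h holomorphic_on ball 0 r" "0 \<le> \<rho>" "\<rho> < r"
  shows "ennreal (norm (h (of_real \<rho>))) \<le> (\<integral>\<^sup>+x\<in>{0..2 * pi}.
    ennreal (poisson r \<rho> x * norm (h (rcis r x))) \<partial>lborel)"
proof -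
  have r: "0 < r" using assms by linarith
  define d where "d u = of_real (r\<^sup>2) - of_real \<rho> * u" for u :: complex
  have d0: "d u \<noteq> 0" if "norm u \<le> r" for u
  proof
    assume "d u = 0"
    then have "norm (of_real (r\<^sup>2) :: complex) = norm (of_real \<rho> * u)" by (simp add: d_def)
    then have "r\<^sup>2 = \<rho> * norm u" using assms(3) by (simp add: norm_mult norm_power)
    also have "\<dots> \<le> \<rho> * r" using that assms(3) by (intro mult_left_mono) auto
    also have "\<dots> < r * r" using assms(4) r by simp
    finally show False by (simp add: power2_eq_square)
  qed
  define F where "F u = h u / d u" for u
  have "((\<lambda>u. F u / (u - of_real \<rho>)) has_contour_integral (2 * of_real pi * \<i> * F (of_real \<rho>))) (circlepath 0 r)"
  proof (rule Cauchy_integral_circlepath)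
    show "continuous_on (cball 0 r) F"
      unfolding F_def using assms(1) d0 by (intro continuous_intros) (auto simp: d_def[abs_def] intro!: continuous_intros)
    show "F holomorphic_on ball 0 r"
      unfolding F_def using assms(2) d0 by (intro holomorphic_intros) (auto simp: d_def[abs_def] intro!: holomorphic_intros)
    show "norm (complex_of_real \<rho> - 0) < r" using assms by simp
  qed
  then have int: "((\<lambda>x. F (rcis r x) / (rcis r x - of_real \<rho>) * of_real r * \<i> * cis x) has_integral (2 * of_real pi * \<i> * F (of_real \<rho>))) {0..2 * pi}"
    unfolding circlepath_def by (subst (asm) has_contour_integral_part_circlepath_iff) (auto simp: rcis_def)
  define k where "k x = norm (h (rcis r x)) / (norm (rcis r x - of_real \<rho>))\<^sup>2" for x
  have ne: "rcis r x \<noteq> of_real \<rho>" for x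
  proof
    assume "rcis r x = of_real \<rho>"
    then have "norm (rcis r x) = norm (complex_of_real \<rho>)" by simp
    then show False using assms r by simp
  qed
  have cont: "continuous_on {0..2 * pi} k"
    unfolding k_def rcis_def using ne r
    by (intro continuous_intros continuous_on_compose2[OF assms(1)]) (auto simp: rcis_def norm_mult)
  \<comment> \<open>On the circle \<open>norm (d u) = r * norm (u - of_real \<rho>)\<close>, so the
    two denominators merge into a square and \<open>r\<close> cancels.\<close>
  have nk: "norm (F (rcis r x) / (rcis r x - of_real \<rho>) * of_real r * \<i> * cis x) = k x" for x
  proof -
    have "norm (d (rcis r x)) = r * norm (rcis r x - of_real \<rho>)"
    proof -
      have "(norm (d (rcis r x)))\<^sup>2 = (r * norm (rcis r x - of_real \<rho>))\<^sup>2"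
        using norm_blaschke[of r "of_real \<rho>" "rcis r x"] r by (simp add: d_def power_mult_distrib)
      then show ?thesis using r by (simp add: power2_eq_iff_nonneg)
    qed
    then show ?thesis using r by (simp add: k_def F_def norm_mult norm_divide power2_eq_square)
  qed
  have kint: "(k has_integral integral {0..2 * pi} k) {0..2 * pi}"
    using cont by (simp add: integrable_continuous_interval integrable_integral)
  have "norm (2 * of_real pi * \<i> * F (of_real \<rho>)) \<le> integral {0..2 * pi} k"
    using has_integral_integrable[OF int] has_integral_integrable[OF kint] integral_unique[OF int]
      integral_norm_bound_integral[of _ "{0..2 * pi}" k] nk by (metis (no_types, lifting) order_refl)
  moreover have "norm (2 * of_real pi * \<i> * F (of_real \<rho>)) = 2 * pi * norm (h (of_real \<rho>)) / (r\<^sup>2 - \<rho>\<^sup>2)"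
  proof -
    have "d (of_real \<rho>) = of_real (r\<^sup>2 - \<rho>\<^sup>2)" by (simp add: d_def power2_eq_square)
    moreover have "\<rho>\<^sup>2 < r\<^sup>2" using assms by (simp add: power_strict_mono)
    ultimately show ?thesis by (simp add: F_def norm_mult norm_divide del: of_real_diff of_real_power)
  qed
  ultimately have "2 * pi * norm (h (of_real \<rho>)) / (r\<^sup>2 - \<rho>\<^sup>2) \<le> integral {0..2 * pi} k"
    by simp
  then have "2 * pi * norm (h (of_real \<rho>)) \<le> integral {0..2 * pi} k * (r\<^sup>2 - \<rho>\<^sup>2)"
    using assms power_strict_mono[of \<rho> r 2] by (simp add: pos_divide_le_eq)
  then have "norm (h (of_real \<rho>)) \<le> (r\<^sup>2 - \<rho>\<^sup>2) / (2 * pi) * integral {0..2 * pi} k"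
    by (simp add: pos_le_divide_eq mult_ac)
  then have "ennreal (norm (h (of_real \<rho>))) \<le> ennreal ((r\<^sup>2 - \<rho>\<^sup>2) / (2 * pi) * integral {0..2 * pi} k)"
    by (rule ennreal_leI)
  also have "\<dots> = (\<integral>\<^sup>+x\<in>{0..2 * pi}. ennreal ((r\<^sup>2 - \<rho>\<^sup>2) / (2 * pi) * k x) \<partial>lborel)"
    using has_integral_mult_right[OF kint, of "(r\<^sup>2 - \<rho>\<^sup>2) / (2 * pi)"] assms power_strict_mono[of \<rho> r 2]
    by (intro set_nn_integral_has_integral[symmetric]) (auto simp: k_def)
  finally show ?thesis by (simp add: k_def)
qed

text \<open>The zero-free majorant \<open>g\<close> has a holomorphic logarithm \<open>l\<close> on
  the closed disc, and \<open>exp (s * l)\<close> has modulus \<open>|g|\<close> to the power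
  \<open>s\<close>. Poisson's formula applies to it; on the circle it agrees in modulus with the
  power of \<open>|f|\<close> and inside it is not smaller. The hypothesis on the circle keeps the
  zeros in the open disc, where they can be reflected. A rotation moves the evaluation point to the
  real axis.\<close>

lemma subharmonic_bound:
  assumes f: "f holomorphic_on ball 0 1" and r: "0 < r" "r < 1"
    and nz: "\<And>x. f (rcis r x) \<noteq> 0" and \<rho>: "0 \<le> \<rho>" "\<rho> < r" and s: "0 < s"
  shows "ennreal (norm (f (rcis \<rho> \<psi>)) powr s) \<le> (\<integral>\<^sup>+x\<in>{0..2 * pi}.
    ennreal (poisson r \<rho> x * norm (f (rcis r (\<psi> + x))) powr s) \<partial>lborel)"
proof -
  define F where "F z = f (z * cis \<psi>)" for z
  have Frcis: "F (rcis t x) = f (rcis t (\<psi> + x))" for t x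
    by (simp add: F_def rcis_def cis_mult mult.assoc add.commute)
  have F: "F holomorphic_on ball 0 1"
  proof -
    have "(f \<circ> (\<lambda>z. z * cis \<psi>)) holomorphic_on ball 0 1"
      by (rule holomorphic_on_compose_gen[OF _ f]) (auto intro!: holomorphic_intros simp: norm_mult)
    then show ?thesis by (simp add: F_def[abs_def] o_def)
  qed
  have nzF: "F z \<noteq> 0" if "norm z = r" for z
    using nz[of "\<psi> + Arg z"] that rcis_cmod_Arg[of z] Frcis[of r "Arg z"] by simp
  have sub: "cball (0::complex) r \<subseteq> ball 0 1" using r by auto
  have "\<not> F constant_on ball 0 1 \<or> {z \<in> cball 0 r. F z = 0} = {}"
  proof (rule disjCI)
    assume "\<not> {z \<in> cball 0 r. F z = 0} = {}"
    then obtain z where z: "z \<in> ball 0 1" "F z = 0" using sub by auto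
    have "of_real r \<in> ball (0::complex) 1" "F (of_real r) \<noteq> 0" using r nzF[of "of_real r"] by auto
    with z show "\<not> F constant_on ball 0 1" by (metis constant_on_def)
  qed
  then have fin: "finite {z \<in> cball 0 r. F z = 0}"
  proof
    assume "\<not> F constant_on ball 0 1"
    then show ?thesis using F sub by (intro holomorphic_compact_finite_zeros) auto
  next
    assume e: "{z \<in> cball 0 r. F z = 0} = {}"
    show ?thesis unfolding e by simp
  qed
  have "{z \<in> cball 0 r. F z = 0} \<subseteq> ball 0 r"
    using nzF by (force simp: less_le)
  then obtain g where g: "g holomorphic_on ball 0 1" "\<And>z. z \<in> cball 0 r \<Longrightarrow> g z \<noteq> 0"
      "\<And>z. z \<in> cball 0 r \<Longrightarrow> norm (F z) \<le> norm (g z)" "\<And>z. z \<in> sphere 0 r \<Longrightarrow> norm (F z) = norm (g z)"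
    using zero_free_majorant[OF r(1) _ _ sub fin F refl] by auto
  have gc: "g holomorphic_on cball 0 r" using g(1) sub by (rule holomorphic_on_subset)
  obtain l where l: "l holomorphic_on cball 0 r" "\<And>z. z \<in> cball 0 r \<Longrightarrow> g z = exp (l z)"
    by (rule contractible_imp_holomorphic_log[OF gc]) (use g(2) convex_imp_contractible[OF convex_cball] in auto)
  define h where "h z = exp (of_real s * l z)" for z
  have hol: "h holomorphic_on cball 0 r" unfolding h_def using l(1) by (intro holomorphic_intros)
  have nh: "norm (h z) = norm (g z) powr s" if "z \<in> cball 0 r" for z
    using l(2)[OF that] by (simp add: h_def norm_exp_eq_Re powr_def)
  have "ennreal (norm (F (of_real \<rho>)) powr s) \<le> ennreal (norm (h (of_real \<rho>)))"
    using nh[of "of_real \<rho>"] g(3)[of "of_real \<rho>"] \<rho> s by (auto intro!: ennreal_leI powr_mono2)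
  also have "\<dots> \<le> (\<integral>\<^sup>+x\<in>{0..2 * pi}.
    ennreal (poisson r \<rho> x * norm (h (rcis r x))) \<partial>lborel)"
    using hol \<rho> by (intro poisson_bound holomorphic_on_imp_continuous_on) (auto elim: holomorphic_on_subset)
  finally have "ennreal (norm (F (of_real \<rho>)) powr s) \<le> (\<integral>\<^sup>+x\<in>{0..2 * pi}.
    ennreal (poisson r \<rho> x * norm (h (rcis r x))) \<partial>lborel)" .
  moreover have "norm (h (rcis r x)) = norm (f (rcis r (\<psi> + x))) powr s" for x
    using nh g(4) r by (simp flip: Frcis)
  moreover have "F (of_real \<rho>) = f (rcis \<rho> \<psi>)" using Frcis[of \<rho> 0] by (simp add: rcis_def)
  ultimately show ?thesis by (simp only:)
qed

section \<open>Comparison of the Poisson kernel with the maximal function\<close>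

lemma norm_rcis_diff_ge:
  assumes "0 \<le> \<rho>" "\<rho> < r" "\<bar>x\<bar> \<le> pi"
  shows "r / 6 * max ((r - \<rho>) / r) \<bar>x\<bar> \<le> norm (rcis r x - of_real \<rho>)"
proof -
  have r: "0 < r" using assms by linarith
  \<comment> \<open>The Taylor remainder is at most \<open>\<bar>y\<bar> ^ 3 / 6\<close>, and
    \<open>\<bar>y\<bar> < 2\<close> turns this into two thirds of
    \<open>\<bar>y\<bar>\<close>.\<close>
  have sin: "\<bar>y\<bar> / 3 \<le> \<bar>sin y\<bar>" if y: "\<bar>y\<bar> \<le> pi / 2" for y :: real
  proof -
    obtain t where "sin y = (\<Sum>m<3. sin_coeff m * y ^ m) + (sin (t + 1/2 * real 3 * pi) / fact 3) * y ^ 3"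
      using Maclaurin_sin_expansion[of y 3] by blast
    then have e: "sin y = y + sin (t + 1/2 * real 3 * pi) / 6 * y ^ 3"
      by (simp add: eval_nat_numeral sin_coeff_def fact_numeral)
    have "\<bar>sin y - y\<bar> \<le> 1 / 6 * \<bar>y\<bar> ^ 3"
      unfolding e using mult_left_le_one_le[of "\<bar>y\<bar> ^ 3" "\<bar>sin (t + 1/2 * real 3 * pi)\<bar>"]
      by (simp add: abs_mult power_abs)
    also have "\<dots> = \<bar>y\<bar> * (\<bar>y\<bar>\<^sup>2 / 6)" by (simp add: power3_eq_cube power2_eq_square)
    also have "\<dots> \<le> \<bar>y\<bar> * (2 / 3)"
      using y pi_half_less_two power_mono[of "\<bar>y\<bar>" 2 2] by (intro mult_left_mono) auto
    finally show ?thesis by linarith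
  qed
  have ns: "norm (cis x - 1) = 2 * \<bar>sin (x / 2)\<bar>"
  proof -
    have "(norm (cis x - 1))\<^sup>2 = (2 * \<bar>sin (x / 2)\<bar>)\<^sup>2"
    proof -
      have c: "cos x = 1 - 2 * (sin (x / 2))\<^sup>2" using cos_double_sin[of "x / 2"] by simp
      have "(norm (cis x - 1))\<^sup>2 = (cos x - 1)\<^sup>2 + (sin x)\<^sup>2" by (simp add: cmod_power2)
      also have "\<dots> = 2 - 2 * cos x"
        unfolding sin_squared_eq by (simp add: power2_eq_square algebra_simps)
      finally show ?thesis by (simp add: c power_mult_distrib)
    qed
    then show ?thesis by (rule power2_eq_imp_eq) auto
  qed
  have "r * (\<bar>x\<bar> / 3) \<le> r * norm (cis x - 1)"
    using sin[of "x / 2"] assms r by (simp add: ns)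
  also have "\<dots> = norm (rcis r x - of_real r)"
  proof -
    have "rcis r x - of_real r = of_real r * (cis x - 1)" by (simp add: rcis_def algebra_simps)
    then show ?thesis using r by (simp add: norm_mult)
  qed
  also have "\<dots> \<le> norm (rcis r x - of_real \<rho>) + norm (complex_of_real \<rho> - of_real r)"
    using norm_triangle_ineq[of "rcis r x - of_real \<rho>" "of_real \<rho> - of_real r"] by simp
  also have "norm (complex_of_real \<rho> - of_real r) = r - \<rho>"
    using assms by (simp flip: of_real_diff)
  finally have 1: "r * (\<bar>x\<bar> / 3) \<le> norm (rcis r x - of_real \<rho>) + (r - \<rho>)" .
  have 2: "r - \<rho> \<le> norm (rcis r x - of_real \<rho>)"
    using norm_triangle_ineq2[of "rcis r x" "of_real \<rho>"] assms r by simp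
  \<comment> \<open>Replacing \<open>\<rho>\<close> by \<open>r\<close> in the chord costs
    \<open>r - \<rho>\<close>, which is itself at most the distance; hence twice the 3 of the sine
    bound.\<close>
  from 1 2 have "r * \<bar>x\<bar> \<le> 6 * norm (rcis r x - of_real \<rho>)" by (simp add: field_simps)
  moreover have "r - \<rho> \<le> 6 * norm (rcis r x - of_real \<rho>)" using 2 assms by linarith
  moreover have "r * max ((r - \<rho>) / r) \<bar>x\<bar> = max (r - \<rho>) (r * \<bar>x\<bar>)"
    using r by (simp add: max_def field_simps)
  ultimately show ?thesis by (simp add: max_def split: if_splits)
qed

text \<open>Measured by the relative gap \<open>\<delta>\<close>, the bound no longer depends on the
  radius. The numerator is at most \<open>2 * r\<^sup>2 * \<delta>\<close>, and with
  \<open>pi\<close> replaced by 3 the constant is \<open>2 * 36 / 6\<close>.\<close>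

lemma poisson_kernel_le:
  assumes "0 \<le> \<rho>" "\<rho> < r" "\<bar>x\<bar> \<le> pi"
  defines "\<delta> \<equiv> (r - \<rho>) / r"
  shows "poisson r \<rho> x \<le> 12 * (\<delta> / (max \<delta> \<bar>x\<bar>)\<^sup>2)"
proof -
  have r: "0 < r" and \<delta>: "0 < \<delta>" "r - \<rho> = r * \<delta>" using assms by (auto simp: \<delta>_def)
  define m where "m = max \<delta> \<bar>x\<bar>"
  define N where "N = norm (rcis r x - of_real \<rho>)"
  have m: "0 < m" using \<delta> by (simp add: m_def less_max_iff_disj)
  have "r / 6 * m \<le> N"
    using norm_rcis_diff_ge[OF assms(1-3)] unfolding \<delta>_def m_def N_def .
  then have "(r / 6 * m)\<^sup>2 \<le> N\<^sup>2"
    using r m by (intro power_mono) auto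
  then have den: "2 * 3 * (r / 6 * m)\<^sup>2 \<le> 2 * pi * N\<^sup>2"
    using pi_gt3 by (intro mult_mono) auto
  have "r\<^sup>2 - \<rho>\<^sup>2 = (r + \<rho>) * (r * \<delta>)"
    unfolding \<delta>(2)[symmetric] by (simp add: power2_eq_square square_diff_square_factored)
  also have "\<dots> \<le> (2 * r) * (r * \<delta>)" using assms r \<delta> by (intro mult_right_mono) auto
  finally have num: "r\<^sup>2 - \<rho>\<^sup>2 \<le> 2 * r\<^sup>2 * \<delta>" by (simp add: power2_eq_square mult_ac)
  have "(r\<^sup>2 - \<rho>\<^sup>2) / (2 * pi * N\<^sup>2) \<le> (2 * r\<^sup>2 * \<delta>) / (2 * 3 * (r / 6 * m)\<^sup>2)"
    using r m \<delta> by (intro frac_le num den) auto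
  also have "\<dots> = 12 * (\<delta> / m\<^sup>2)" using r m by (simp add: power2_eq_square field_simps)
  finally show ?thesis unfolding N_def m_def .
qed

text \<open>An even kernel decreasing in \<open>\<bar>x\<bar>\<close> is a mixture of indicators of
  intervals centred at \<open>0\<close>, and integrals over intervals are what the maximal function
  controls.\<close>

lemma kernel_layer:
  assumes "0 < \<delta>"
  shows "ennreal (\<delta> / (max \<delta> \<bar>x\<bar>)\<^sup>2)
    = (\<integral>\<^sup>+t. ennreal (2 * \<delta> * t powr (-3)) * indicator {\<delta>..} t * indicator {\<bar>x\<bar>..} t \<partial>lborel)"
proof -
  let ?m = "max \<delta> \<bar>x\<bar>"
  have m: "0 < ?m" using assms by (simp add: less_max_iff_disj)
  have "((\<lambda>t. 2 * \<delta> * t powr (-3)) has_integral 2 * \<delta> * (- (?m powr (-3 + 1)) / (-3 + 1))) {?m..}"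
    using m by (intro has_integral_mult_right has_integral_powr_to_inf) auto
  moreover have "2 * \<delta> * (- (?m powr (-3 + 1)) / (-3 + 1)) = \<delta> / ?m\<^sup>2"
    using m powr_minus[of ?m 2] by (simp add: powr_numeral field_simps)
  ultimately have "((\<lambda>t. 2 * \<delta> * t powr (-3)) has_integral (\<delta> / ?m\<^sup>2)) {?m..}" by simp
  then have "(\<integral>\<^sup>+t\<in>{?m..}. ennreal (2 * \<delta> * t powr (-3)) \<partial>lborel) = ennreal (\<delta> / ?m\<^sup>2)"
    using assms by (intro set_nn_integral_has_integral) auto
  moreover have "(\<integral>\<^sup>+t\<in>{?m..}. ennreal (2 * \<delta> * t powr (-3)) \<partial>lborel)
      = (\<integral>\<^sup>+t. ennreal (2 * \<delta> * t powr (-3)) * indicator {\<delta>..} t * indicator {\<bar>x\<bar>..} t \<partial>lborel)"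
    by (intro nn_integral_cong) (auto split: split_indicator)
  ultimately show ?thesis by simp
qed

text \<open>Only half-widths \<open>t \<ge> \<delta>\<close> occur in the mixture, so the offset
  from \<open>\<theta>\<close> to \<open>\<psi>\<close> is at most \<open>M * t\<close>. The
  interval about \<open>\<psi>\<close> then lies in one about \<open>\<theta>\<close> whose length
  is proportional to \<open>t\<close>. This is where the aperture enters the constant.\<close>

lemma kernel_hl_max:
  assumes [measurable]: "G \<in> borel_measurable borel" and \<delta>: "0 < \<delta>" and M: "0 < M" "\<bar>\<psi> - \<theta>\<bar> \<le> M * \<delta>"
  shows "(\<integral>\<^sup>+x. ennreal (\<delta> / (max \<delta> \<bar>x\<bar>)\<^sup>2) * G (\<psi> + x) \<partial>lborel) \<le> ennreal (8 * (M + 2)) * hl_max G \<theta>"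
proof -
  define k where "k t = ennreal (2 * \<delta> * t powr (-3)) * indicator {\<delta>..} t" for t :: real
  have [measurable]: "k \<in> borel_measurable borel" unfolding k_def by measurable
  define D where "D t x = (if \<bar>x\<bar> \<le> t then k t * G (\<psi> + x) else 0)" for t x
  have [measurable]: "case_prod D \<in> borel_measurable (borel \<Otimes>\<^sub>M borel)" unfolding D_def by measurable
  have inner: "(\<integral>\<^sup>+x. D t x \<partial>lborel) \<le> ennreal (8 * \<delta> * (M + 2)) * hl_max G \<theta> * (ennreal (t powr (-2)) * indicator {\<delta>..} t)" for t
  proof (cases "\<delta> \<le> t")
    case True
    then have t: "0 < t" using \<delta> by simp
    have M\<delta>: "M * \<delta> \<le> M * t" using True M by simp
    have avg: "(\<integral>\<^sup>+x. G (\<psi> + x) * indicator (ball \<theta> ((M + 2) * t)) (\<psi> + x) \<partial>lborel)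
        \<le> ennreal (2 * ((M + 2) * t)) * (2 * hl_max G \<theta>)"
    proof -
      have "(\<integral>\<^sup>+x. G (\<psi> + x) * indicator (ball \<theta> ((M + 2) * t)) (\<psi> + x) \<partial>lborel)
          = (\<integral>\<^sup>+y\<in>ball \<theta> ((M + 2) * t). G y \<partial>lborel)"
        by (subst nn_integral_real_affine[of "\<lambda>y. G y * indicator (ball \<theta> ((M + 2) * t)) y" 1 \<psi>]) auto
      also have "\<dots> = ennreal (2 * ((M + 2) * t)) * ball_avg \<theta> ((M + 2) * t) G"
        using t M by (intro set_nn_integral_eq_ball_avg) auto
      also have "\<dots> \<le> ennreal (2 * ((M + 2) * t)) * (2 * hl_max G \<theta>)"
        using t M by (intro mult_left_mono ball_avg_le_hl_max_real) auto
      finally show ?thesis .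
    qed
    \<comment> \<open>The radius is \<open>M + 2\<close> and not \<open>M + 1\<close> times
      \<open>t\<close> because the ball is open.\<close>
    have "\<psi> + x \<in> ball \<theta> ((M + 2) * t)" if "\<bar>x\<bar> \<le> t" for x
      using that t M(2) M\<delta> by (simp add: dist_real_def distrib_right)
    then have "(\<integral>\<^sup>+x. D t x \<partial>lborel) \<le> (\<integral>\<^sup>+x. k t * (G (\<psi> + x) * indicator (ball \<theta> ((M + 2) * t)) (\<psi> + x)) \<partial>lborel)"
      by (intro nn_integral_mono) (simp add: D_def del: mem_ball)
    also have "\<dots> = k t * (\<integral>\<^sup>+x. G (\<psi> + x) * indicator (ball \<theta> ((M + 2) * t)) (\<psi> + x) \<partial>lborel)"
      by (rule nn_integral_cmult) measurable
    also have "\<dots> \<le> k t * (ennreal (2 * ((M + 2) * t)) * (2 * hl_max G \<theta>))"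
      by (intro mult_left_mono avg) auto
    also have "\<dots> = (ennreal (2 * \<delta> * t powr (-3)) * ennreal (2 * ((M + 2) * t)) * 2) * hl_max G \<theta>"
      using True by (simp add: k_def mult.assoc)
    also have "ennreal (2 * \<delta> * t powr (-3)) * ennreal (2 * ((M + 2) * t)) * 2 = ennreal (8 * \<delta> * (M + 2)) * ennreal (t powr (-2))"
    proof -
      have e: "t powr (-2) = t powr (-3) * t" using t powr_add[of t "-3" 1] by simp
      show ?thesis unfolding e using t M \<delta> by (simp add: mult_ac flip: ennreal_mult ennreal_numeral)
    qed
    finally show ?thesis using True by (simp add: mult_ac)
  next
    case False
    then have "D t x = 0" for x by (simp add: D_def k_def)
    then show ?thesis by simp
  qed
  have "((\<lambda>t. t powr (-2)) has_integral - (\<delta> powr (-2 + 1)) / (-2 + 1)) {\<delta>..}"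
    using \<delta> by (intro has_integral_powr_to_inf) auto
  then have "((\<lambda>t. t powr (-2)) has_integral (1 / \<delta>)) {\<delta>..}"
    using \<delta> by (simp add: powr_minus_divide)
  then have tail: "(\<integral>\<^sup>+t. ennreal (t powr (-2)) * indicator {\<delta>..} t \<partial>lborel) = ennreal (1 / \<delta>)"
    by (intro set_nn_integral_has_integral) auto
  have "(\<integral>\<^sup>+x. ennreal (\<delta> / (max \<delta> \<bar>x\<bar>)\<^sup>2) * G (\<psi> + x) \<partial>lborel) = (\<integral>\<^sup>+x. (\<integral>\<^sup>+t. D t x \<partial>lborel) \<partial>lborel)"
  proof (rule nn_integral_cong)
    fix x
    have "ennreal (\<delta> / (max \<delta> \<bar>x\<bar>)\<^sup>2) * G (\<psi> + x) = (\<integral>\<^sup>+t. k t * indicator {\<bar>x\<bar>..} t * G (\<psi> + x) \<partial>lborel)"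
      unfolding kernel_layer[OF \<delta>] k_def by (rule nn_integral_multc[symmetric]) measurable
    also have "\<dots> = (\<integral>\<^sup>+t. D t x \<partial>lborel)"
      by (intro nn_integral_cong) (auto simp: D_def)
    finally show "ennreal (\<delta> / (max \<delta> \<bar>x\<bar>)\<^sup>2) * G (\<psi> + x) = (\<integral>\<^sup>+t. D t x \<partial>lborel)" .
  qed
  also have "\<dots> = (\<integral>\<^sup>+t. (\<integral>\<^sup>+x. D t x \<partial>lborel) \<partial>lborel)"
    by (rule lborel_pair.Fubini') measurable
  also have "\<dots> \<le> (\<integral>\<^sup>+t. ennreal (8 * \<delta> * (M + 2)) * hl_max G \<theta> * (ennreal (t powr (-2)) * indicator {\<delta>..} t) \<partial>lborel)"
    by (intro nn_integral_mono inner)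
  also have "\<dots> = ennreal (8 * \<delta> * (M + 2)) * hl_max G \<theta> * ennreal (1 / \<delta>)"
    unfolding tail[symmetric] by (rule nn_integral_cmult) measurable
  also have "\<dots> = (ennreal (8 * \<delta> * (M + 2)) * ennreal (1 / \<delta>)) * hl_max G \<theta>"
    by (simp add: mult_ac)
  also have "ennreal (8 * \<delta> * (M + 2)) * ennreal (1 / \<delta>) = ennreal (8 * (M + 2))"
    using \<delta> M by (simp flip: ennreal_mult)
  finally show ?thesis .
qed

section \<open>Periodic functions and cones in polar form\<close>

lemma nn_integral_shift:
  assumes "F \<in> borel_measurable borel"
  shows "(\<integral>\<^sup>+x. F (x + c) \<partial>lborel) = (\<integral>\<^sup>+x. F (x :: real) \<partial>lborel)"
  using nn_integral_real_affine[OF assms, of 1 c] by (simp add: add.commute)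

lemma nn_integral_periodic:
  fixes F :: "real \<Rightarrow> ennreal"
  assumes [measurable]: "F \<in> borel_measurable borel" and T: "0 < T" and per: "\<And>x. F (x + T) = F x"
  shows "(\<integral>\<^sup>+x\<in>{a..<a + T}. F x \<partial>lborel) = (\<integral>\<^sup>+x\<in>{0..<T}. F x \<partial>lborel)"
proof -
  have per_nat: "F (x + of_nat n * T) = F x" for x n
    by (induction n) (use per[of "x + of_nat n * T" for n] in \<open>auto simp: algebra_simps\<close>)
  have per_int: "F (x + of_int k * T) = F x" for x k
  proof (cases "0 \<le> k")
    case True then show ?thesis using per_nat[of x "nat k"] by simp
  next
    case False then show ?thesis using per_nat[of "x + of_int k * T" "nat (- k)"] by simp
  qed
  define k where "k = \<lfloor>a / T\<rfloor>"
  define b where "b = a - of_int k * T"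
  have b: "0 \<le> b" "b < T"
    using floor_divide_lower[OF T, of a] floor_divide_upper[OF T, of a]
    by (auto simp: b_def k_def distrib_right)
  have "(\<integral>\<^sup>+x\<in>{a..<a + T}. F x \<partial>lborel) = (\<integral>\<^sup>+x. F (x + of_int k * T) * indicator {a..<a + T} (x + of_int k * T) \<partial>lborel)"
    by (rule nn_integral_shift[symmetric]) measurable
  also have "\<dots> = (\<integral>\<^sup>+x. F x * indicator {b..<T} x + F x * indicator {T..<b + T} x \<partial>lborel)"
    unfolding per_int using b by (intro nn_integral_cong) (auto simp: b_def split: split_indicator)
  also have "\<dots> = (\<integral>\<^sup>+x\<in>{b..<T}. F x \<partial>lborel) + (\<integral>\<^sup>+x\<in>{T..<b + T}. F x \<partial>lborel)"
    by (rule nn_integral_add) measurable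
  also have "(\<integral>\<^sup>+x\<in>{T..<b + T}. F x \<partial>lborel) = (\<integral>\<^sup>+x. F (x + T) * indicator {T..<b + T} (x + T) \<partial>lborel)"
    by (rule nn_integral_shift[symmetric]) measurable
  also have "\<dots> = (\<integral>\<^sup>+x\<in>{0..<b}. F x \<partial>lborel)"
    unfolding per by (intro nn_integral_cong) (auto split: split_indicator)
  also have "(\<integral>\<^sup>+x\<in>{b..<T}. F x \<partial>lborel) + (\<integral>\<^sup>+x\<in>{0..<b}. F x \<partial>lborel) = (\<integral>\<^sup>+x. F x * indicator {b..<T} x + F x * indicator {0..<b} x \<partial>lborel)"
    by (rule nn_integral_add[symmetric]) measurable
  also have "\<dots> = (\<integral>\<^sup>+x\<in>{0..<T}. F x \<partial>lborel)"
    using b by (intro nn_integral_cong) (auto split: split_indicator)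
  finally show ?thesis .
qed

lemma nn_integral_Icc_eq_Ico:
  "(\<integral>\<^sup>+x\<in>{a..b}. F x \<partial>lborel) = (\<integral>\<^sup>+x\<in>{a..<b :: real}. F x \<partial>lborel)"
  by (intro nn_integral_cong_AE AE_I'[of "{b}"]) (auto split: split_indicator)

lemma rcis_add_2pi: "rcis r (x + 2 * pi) = rcis r x"
  by (simp add: rcis_def flip: cis_mult)

text \<open>Adding one multiple of \<open>2 * pi\<close> to both arguments keeps their difference,
  so the argument of the vertex may be taken to be \<open>\<theta>\<close>.\<close>

lemma nt_region_rcis:
  assumes "0 < r" "r \<le> 1" "0 < M"
  shows "nt_region M (rcis r \<theta>) = {rcis \<rho> \<psi> |\<rho> \<psi>. 0 \<le> \<rho> \<and> \<bar>\<psi> - \<theta>\<bar> < M * (r - \<rho>)}"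
proof (intro subset_antisym subsetI)
  have is_Arg_rcis: "is_Arg (rcis \<rho> \<psi>) \<psi>" if "0 \<le> \<rho>" for \<rho> \<psi>
    using that by (simp add: is_Arg_def rcis_def cis_conv_exp norm_mult)
  {
    fix z assume "z \<in> nt_region M (rcis r \<theta>)"
    then obtain s t where st: "is_Arg z s" "is_Arg (rcis r \<theta>) t" "\<bar>s - t\<bar> < M * (r - cmod z)"
      using assms by (auto simp: nt_region_def)
    have "of_real r * cis \<theta> = of_real r * cis t"
      using st(2) assms by (simp add: is_Arg_def rcis_def cis_conv_exp norm_mult)
    then have "cis \<theta> = cis t" using assms by simp
    then have "sin \<theta> = sin t \<and> cos \<theta> = cos t" by (simp add: complex_eq_iff)
    then obtain n :: int where n: "\<theta> = t + 2 * pi * n" using sin_cos_eq_iff by blast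
    have "is_Arg z (s + of_int n * (2 * pi))" using st(1) by (simp only: is_Arg_2pi_iff)
    then have "z = rcis (cmod z) (s + of_int n * (2 * pi))"
      by (simp add: is_Arg_def rcis_def cis_conv_exp)
    moreover have "\<bar>s + of_int n * (2 * pi) - \<theta>\<bar> < M * (r - cmod z)"
      using st(3) n by (simp add: algebra_simps)
    ultimately show "z \<in> {rcis \<rho> \<psi> |\<rho> \<psi>. 0 \<le> \<rho> \<and> \<bar>\<psi> - \<theta>\<bar> < M * (r - \<rho>)}"
      using norm_ge_zero by blast
  next
    fix z assume "z \<in> {rcis \<rho> \<psi> |\<rho> \<psi>. 0 \<le> \<rho> \<and> \<bar>\<psi> - \<theta>\<bar> < M * (r - \<rho>)}"
    then obtain \<rho> \<psi> where z: "z = rcis \<rho> \<psi>" "0 \<le> \<rho>" "\<bar>\<psi> - \<theta>\<bar> < M * (r - \<rho>)" by blast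
    then have "0 < M * (r - \<rho>)" by linarith
    then have "\<rho> < r" using assms by (simp add: zero_less_mult_iff)
    with z assms is_Arg_rcis[of \<rho> \<psi>] is_Arg_rcis[of r \<theta>]
    show "z \<in> nt_region M (rcis r \<theta>)"
      unfolding nt_region_def by auto
  }
qed

lemma continuous_on_rcis:
  assumes "f holomorphic_on ball 0 1" "0 < r" "r < 1"
  shows "continuous_on UNIV (\<lambda>x. f (rcis r (x + c)))"
  using assms unfolding rcis_def
  by (intro continuous_on_compose2[OF holomorphic_on_imp_continuous_on[OF assms(1)]] continuous_intros)
    (auto simp: norm_mult)

text \<open>The maximal function lives on the line, where a periodic function has infinite norm
  unless it vanishes; hence the cut-off to \<open>{-K..K}\<close>. The condition on \<open>K\<close>
  leaves room for the opening of the cone and for half a period on either side. The rotation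
  \<open>\<tau>\<close> is carried along unchanged. The constant is 12 from the Poisson kernel times
  8 from its layers.\<close>

lemma nt_max_le_hl_max:
  assumes f: "f holomorphic_on ball 0 1" and r: "0 < r" "r < 1" and nz: "\<And>x. f (rcis r x) \<noteq> 0"
    and s: "0 < s" and M: "0 < M" and K: "\<bar>\<theta>\<bar> + M + pi \<le> K"
  shows "ennreal_powr (nt_max M f (rcis r (\<theta> + \<tau>))) s
    \<le> ennreal (96 * (M + 2)) * hl_max (\<lambda>y. ennreal (cmod (f (rcis r (y + \<tau>))) powr s) * indicator {-K..K} y) \<theta>"
  unfolding nt_max_def
proof (rule ennreal_powr_SUP_le[OF s])
  fix z assume "z \<in> nt_region M (rcis r (\<theta> + \<tau>))"
  then obtain \<rho> \<psi>' where z: "z = rcis \<rho> \<psi>'" "0 \<le> \<rho>" "\<bar>\<psi>' - (\<theta> + \<tau>)\<bar> < M * (r - \<rho>)"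
    using nt_region_rcis[of r M "\<theta> + \<tau>"] r M by auto
  define \<psi> where "\<psi> = \<psi>' - \<tau>"
  have \<psi>: "\<psi>' = \<psi> + \<tau>" "\<bar>\<psi> - \<theta>\<bar> < M * (r - \<rho>)" using z by (auto simp: \<psi>_def algebra_simps)
  then have "0 < M * (r - \<rho>)" by linarith
  then have \<rho>: "\<rho> < r" using M by (simp add: zero_less_mult_iff)
  \<comment> \<open>The kernel has the scale \<open>(r - \<rho>) / r\<close>; since
    \<open>r < 1\<close> this is at least \<open>r - \<rho>\<close>, so the cone condition survives
    in terms of \<open>\<delta>\<close>.\<close>
  define \<delta> where "\<delta> = (r - \<rho>) / r"
  have \<delta>: "0 < \<delta>" "r - \<rho> \<le> \<delta>"
    using r \<rho> mult_left_le[of r "r - \<rho>"] by (auto simp: \<delta>_def le_divide_eq)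
  have \<psi>\<delta>: "\<bar>\<psi> - \<theta>\<bar> \<le> M * \<delta>"
    using \<psi>(2) mult_left_mono[OF \<delta>(2), of M] M by linarith
  have "M * (r - \<rho>) \<le> M * 1" using M r z(2) by (intro mult_left_mono) auto
  then have \<psi>K: "\<bar>\<psi>\<bar> + pi \<le> K" using \<psi>(2) K by linarith
  let ?g = "\<lambda>y. ennreal (cmod (f (rcis r (y + \<tau>))) powr s)"
  define G where "G y = ?g y * indicator {-K..K} y" for y
  have [measurable]: "(\<lambda>y. f (rcis r (y + \<tau>))) \<in> borel_measurable borel"
    by (intro borel_measurable_continuous_onI continuous_on_rcis f r)
  have [measurable]: "?g \<in> borel_measurable borel" by measurable
  then have [measurable]: "G \<in> borel_measurable borel" unfolding G_def by measurable
  define k where "k x = ennreal (poisson r \<rho> x)" for x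
  have [measurable]: "rcis r \<in> borel_measurable borel"
    unfolding rcis_def by (intro borel_measurable_continuous_onI continuous_intros)
  have [measurable]: "k \<in> borel_measurable borel"
    unfolding k_def by measurable
  define H where "H x = k x * ?g (\<psi> + x)" for x
  have [measurable]: "H \<in> borel_measurable borel" unfolding H_def by measurable
  have "ennreal_powr (ennreal (cmod (f z))) s = ennreal (norm (f (rcis \<rho> \<psi>')) powr s)"
    by (simp add: ennreal_powr_ennreal z)
  also have "\<dots> \<le> (\<integral>\<^sup>+x\<in>{0..2 * pi}.
    ennreal (poisson r \<rho> x * norm (f (rcis r (\<psi>' + x))) powr s) \<partial>lborel)"
    by (rule subharmonic_bound[OF f r nz z(2) \<rho> s])
  also have "\<dots> = (\<integral>\<^sup>+x\<in>{0..2 * pi}. H x \<partial>lborel)"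
    unfolding H_def k_def \<psi>(1) by (simp only: ennreal_mult''[OF powr_ge_zero] add_ac)
  \<comment> \<open>The kernel bound requires \<open>\<bar>x\<bar> \<le> pi\<close>, so the period
    is moved to one centred at \<open>0\<close>.\<close>
  also have "\<dots> = (\<integral>\<^sup>+x\<in>{-pi..<-pi + 2 * pi}. H x \<partial>lborel)"
  proof -
    have "H (x + 2 * pi) = H x" for x
      using rcis_add_2pi[of r x] rcis_add_2pi[of r "\<psi> + x + \<tau>"] by (simp add: H_def k_def add_ac)
    then show ?thesis
      unfolding nn_integral_Icc_eq_Ico by (intro nn_integral_periodic[symmetric]) auto
  qed
  also have "\<dots> \<le> (\<integral>\<^sup>+x. 12 * (ennreal (\<delta> / (max \<delta> \<bar>x\<bar>)\<^sup>2) * G (\<psi> + x)) \<partial>lborel)"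
  proof (rule nn_integral_mono)
    fix x
    show "H x * indicator {-pi..<-pi + 2 * pi} x \<le> 12 * (ennreal (\<delta> / (max \<delta> \<bar>x\<bar>)\<^sup>2) * G (\<psi> + x))"
    proof (cases "x \<in> {-pi..<-pi + 2 * pi}")
      case True
      then have x: "\<bar>x\<bar> \<le> pi" by auto
      then have "\<psi> + x \<in> {-K..K}" using \<psi>K by auto
      then have "G (\<psi> + x) = ?g (\<psi> + x)" by (simp add: G_def)
      moreover have "k x \<le> 12 * ennreal (\<delta> / (max \<delta> \<bar>x\<bar>)\<^sup>2)"
        using poisson_kernel_le[OF z(2) \<rho> x] \<delta>(1) unfolding k_def \<delta>_def[symmetric]
        by (simp add: ennreal_leI flip: ennreal_mult ennreal_numeral)
      ultimately show ?thesis
        using True by (simp add: H_def mult.assoc[symmetric] mult_right_mono)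
    qed simp
  qed
  also have "\<dots> = 12 * (\<integral>\<^sup>+x. ennreal (\<delta> / (max \<delta> \<bar>x\<bar>)\<^sup>2) * G (\<psi> + x) \<partial>lborel)"
    by (rule nn_integral_cmult) measurable
  also have "\<dots> \<le> 12 * (ennreal (8 * (M + 2)) * hl_max G \<theta>)"
    by (intro mult_left_mono kernel_hl_max \<delta> M \<psi>\<delta>) auto
  also have "\<dots> = (12 * ennreal (8 * (M + 2))) * hl_max G \<theta>" by (simp add: mult.assoc)
  also have "12 * ennreal (8 * (M + 2)) = ennreal (96 * (M + 2))"
    using M by (simp add: algebra_simps flip: ennreal_mult ennreal_numeral)
  finally show "ennreal_powr (ennreal (cmod (f z))) s \<le> ennreal (96 * (M + 2)) * hl_max (\<lambda>y. ?g y * indicator {-K..K} y) \<theta>"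
    unfolding G_def .
qed

section \<open>Borel measurability and finiteness of the non-tangential maximal function\<close>

lemma open_polar:
  assumes "open Q"
  shows "open {rcis r t |r t. 0 < r \<and> (r, t) \<in> Q}"
proof (rule openI)
  fix z assume "z \<in> {rcis r t |r t. 0 < r \<and> (r, t) \<in> Q}"
  then obtain r t where z: "z = rcis r t" "0 < r" "(r, t) \<in> Q" by auto
  then have z0: "z \<noteq> 0" "cmod z = r" by auto
  \<comment> \<open>Near \<open>z\<close> the quotient \<open>z' / z\<close> is close to 1, away
    from the cut of \<open>Arg\<close>. So \<open>A\<close> is a choice of argument that is
    continuous at \<open>z\<close> and equals \<open>t\<close> there.\<close>
  define A where "A z' = t + Arg (z' / z)" for z'
  have A: "rcis (cmod z') (A z') = z'" for z'
  proof -
    have "rcis (cmod z') (A z') = rcis r t * rcis (cmod (z' / z)) (Arg (z' / z))"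
      unfolding rcis_mult A_def using z z0 by (simp add: norm_divide)
    then show ?thesis unfolding rcis_cmod_Arg z(1)[symmetric] using z0 by simp
  qed
  have "isCont Arg (z / z)" using z0 by (intro continuous_at_Arg) (simp add: complex_nonpos_Reals_iff)
  then have "isCont (\<lambda>z'. (cmod z', A z')) z"
    unfolding A_def using z0 by (intro continuous_intros isCont_o2[of z "\<lambda>z'. z' / z" Arg]) auto
  then have "((\<lambda>z'. (cmod z', A z')) \<longlongrightarrow> (cmod z, A z)) (nhds z)"
    using tendsto_at_iff_tendsto_nhds[of "\<lambda>z'. (cmod z', A z')" z] unfolding isCont_def by blast
  moreover have "open ({0<..} \<times> UNIV \<inter> Q)" using assms by (intro open_Int open_Times) auto
  moreover have "(cmod z, A z) \<in> {0<..} \<times> UNIV \<inter> Q" using z z0 by (simp add: A_def)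
  ultimately have "\<forall>\<^sub>F z' in nhds z. (cmod z', A z') \<in> {0<..} \<times> UNIV \<inter> Q"
    by (rule topological_tendstoD)
  then obtain e where e: "0 < e" "\<And>z'. dist z' z < e \<Longrightarrow> (cmod z', A z') \<in> {0<..} \<times> UNIV \<inter> Q"
    unfolding eventually_nhds_metric by blast
  have "ball z e \<subseteq> {rcis r t |r t. 0 < r \<and> (r, t) \<in> Q}"
  proof
    fix z' assume "z' \<in> ball z e"
    then have "(cmod z', A z') \<in> {0<..} \<times> UNIV \<inter> Q" by (intro e(2)) (simp add: dist_commute)
    then show "z' \<in> {rcis r t |r t. 0 < r \<and> (r, t) \<in> Q}"
      using A[of z'] by (intro CollectI exI[of _ "cmod z'"] exI[of _ "A z'"]) auto
  qed
  with e(1) show "\<exists>T>0. ball z T \<subseteq> {rcis r t |r t. 0 < r \<and> (r, t) \<in> Q}" by blast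
qed

lemma is_Arg_iff_rcis: "is_Arg z t \<longleftrightarrow> z = rcis (cmod z) t"
  by (simp add: is_Arg_def rcis_def cis_conv_exp)

text \<open>The point is fixed and the vertex varies. The superlevel sets of
  \<open>nt_max m f\<close> are unions of such sets, hence open, whatever the function
  \<open>f\<close>.\<close>

lemma open_nt_region_vertices:
  assumes m: "0 < m"
  shows "open {\<xi>. z \<in> nt_region m \<xi>}"
proof (cases "z \<in> ball 0 1")
  case True
  have "{\<xi>. z \<in> nt_region m \<xi>}
    = (\<Union>s\<in>{s. is_Arg z s}. {rcis r t |r t. 0 < r \<and> (r, t) \<in> {x. \<bar>s - snd x\<bar> < m * (fst x - cmod z)}})"
    (is "?L = ?R")
  proof (intro equalityI subsetI)
    fix \<xi> assume "\<xi> \<in> ?L"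
    then obtain s t where st: "is_Arg z s" "is_Arg \<xi> t" "\<bar>s - t\<bar> < m * (cmod \<xi> - cmod z)"
      by (auto simp: nt_region_def)
    then have "0 < m * (cmod \<xi> - cmod z)" by linarith
    then have "cmod z < cmod \<xi>" using m by (simp add: zero_less_mult_iff)
    then have "0 < cmod \<xi>" using norm_ge_zero[of z] by linarith
    then have "\<xi> \<in> {rcis r t |r t. 0 < r \<and> (r, t) \<in> {x. \<bar>s - snd x\<bar> < m * (fst x - cmod z)}}"
      using st unfolding is_Arg_iff_rcis[of \<xi>]
      by (intro CollectI exI[of _ "cmod \<xi>"] exI[of _ t]) auto
    then show "\<xi> \<in> ?R" using st(1) by blast
  next
    fix \<xi> assume "\<xi> \<in> ?R"
    then obtain s r t where "is_Arg z s" "\<xi> = rcis r t" "0 < r" "\<bar>s - t\<bar> < m * (r - cmod z)"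
      by auto
    then have "is_Arg z s \<and> is_Arg \<xi> t \<and> \<bar>s - t\<bar> < m * (cmod \<xi> - cmod z)"
      by (simp add: is_Arg_iff_rcis[of "rcis r t"])
    then show "\<xi> \<in> ?L" using True unfolding nt_region_def by blast
  qed
  moreover have "open {x :: real \<times> real. \<bar>s - snd x\<bar> < m * (fst x - cmod z)}" for s
    by (intro open_Collect_less continuous_intros)
  ultimately show ?thesis by (simp only:) (intro open_UN ballI open_polar)
next
  case False
  then have "{\<xi>. z \<in> nt_region m \<xi>} = {}" by (auto simp: nt_region_def)
  then show ?thesis by simp
qed

lemma measurable_nt_max [measurable]:
  assumes m: "0 < m"
  shows "nt_max m f \<in> borel_measurable borel"
proof (rule borel_measurableI_greater)
  fix y
  have "{\<xi>. y < nt_max m f \<xi>} = (\<Union>z\<in>{z. y < ennreal (cmod (f z))}. {\<xi>. z \<in> nt_region m \<xi>})"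
    by (auto simp: nt_max_def less_SUP_iff)
  then have "open {\<xi>. y < nt_max m f \<xi>}" using open_nt_region_vertices[OF m] by auto
  then show "{\<xi> \<in> space borel. y < nt_max m f \<xi>} \<in> sets borel" by simp
qed

lemma measurable_nt_max_fun:
  "0 < m \<Longrightarrow> nt_max_fun m f \<in> borel_measurable borel"
  unfolding nt_max_fun_def[abs_def] by (intro measurable_compose[OF measurable_nt_max]) measurable

lemma nt_max_finite:
  assumes f: "f holomorphic_on ball 0 1" and m: "0 < m" and \<xi>: "\<xi> \<in> ball 0 1"
  shows "nt_max m f \<xi> < \<infinity>"
proof -
  have "compact (f ` cball 0 (cmod \<xi>))"
    using f \<xi> by (intro compact_continuous_image holomorphic_on_imp_continuous_on)
      (auto elim: holomorphic_on_subset)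
  then obtain B where B: "\<And>z. z \<in> cball 0 (cmod \<xi>) \<Longrightarrow> cmod (f z) \<le> B"
    using compact_imp_bounded bounded_iff by (metis imageI)
  have "nt_max m f \<xi> \<le> ennreal B"
    unfolding nt_max_def
  proof (intro SUP_least ennreal_leI B)
    fix z assume "z \<in> nt_region m \<xi>"
    then obtain s t where "\<bar>s - t\<bar> < m * (cmod \<xi> - cmod z)" by (auto simp: nt_region_def)
    then have "0 < m * (cmod \<xi> - cmod z)" by linarith
    then show "z \<in> cball 0 (cmod \<xi>)" using m by (simp add: zero_less_mult_iff)
  qed
  then show ?thesis by (rule le_less_trans) simp
qed

lemma nt_max_cong: "(\<And>z. z \<in> ball 0 1 \<Longrightarrow> f z = g z) \<Longrightarrow> nt_max m f \<xi> = nt_max m g \<xi>"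
  unfolding nt_max_def by (intro SUP_cong) (auto simp: nt_region_def)

lemma nt_max_fun_powr:
  assumes "f holomorphic_on ball 0 1" "0 < m" "\<xi> \<in> ball 0 1"
  shows "ennreal (cmod (nt_max_fun m f \<xi>) powr p) = ennreal_powr (nt_max m f \<xi>) p"
  using nt_max_finite[OF assms] by (simp add: nt_max_fun_def ennreal_powr_def)

section \<open>One inequality for both norms\<close>

lemma nn_integral_periods:
  fixes F :: "real \<Rightarrow> ennreal"
  assumes [measurable]: "F \<in> borel_measurable borel" and T: "0 < T" and per: "\<And>x. F (x + T) = F x"
  shows "(\<integral>\<^sup>+x\<in>{a..<a + real n * T}. F x \<partial>lborel) = of_nat n * (\<integral>\<^sup>+x\<in>{0..<T}. F x \<partial>lborel)"
proof (induction n)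
  case (Suc n)
  define b where "b = a + real n * T"
  have b: "a \<le> b" "a + real (Suc n) * T = b + T" using T by (auto simp: b_def algebra_simps)
  have "(\<integral>\<^sup>+x\<in>{a..<a + real (Suc n) * T}. F x \<partial>lborel)
      = (\<integral>\<^sup>+x. F x * indicator {a..<b} x + F x * indicator {b..<b + T} x \<partial>lborel)"
    unfolding b(2) using b(1) T by (intro nn_integral_cong) (auto split: split_indicator)
  also have "\<dots> = (\<integral>\<^sup>+x\<in>{a..<b}. F x \<partial>lborel) + (\<integral>\<^sup>+x\<in>{b..<b + T}. F x \<partial>lborel)"
    by (rule nn_integral_add) measurable
  also have "\<dots> = of_nat n * (\<integral>\<^sup>+x\<in>{0..<T}. F x \<partial>lborel) + (\<integral>\<^sup>+x\<in>{0..<T}. F x \<partial>lborel)"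
    unfolding b_def Suc using T per by (subst nn_integral_periodic) auto
  finally show ?case by (simp add: distrib_right add.commute)
qed simp

lemma continuous_rcis: "continuous_on UNIV (\<lambda>x. rcis (fst x) (snd x))"
  unfolding rcis_def by (intro continuous_intros)

lemma measurable_rcis [measurable]:
  assumes [measurable]: "r \<in> borel_measurable M" "t \<in> borel_measurable M"
  shows "(\<lambda>x. rcis (r x) (t x)) \<in> borel_measurable M"
proof -
  have "(\<lambda>x. rcis (fst x) (snd x)) \<in> borel_measurable (borel :: (real \<times> real) measure)"
    by (rule borel_measurable_continuous_onI[OF continuous_rcis])
  from measurable_compose[OF _ this, of "\<lambda>x. (r x, t x)" M] show ?thesis
    by (simp add: borel_prod[symmetric])
qed

lemma fsigma_unit_ball: "fsigma (ball (0 :: 'a::real_normed_vector) 1)"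
proof -
  have "ball (0 :: 'a) 1 = (\<Union>n. cball 0 (1 - inverse (real (Suc n))))"
  proof (intro equalityI subsetI)
    fix z :: 'a assume "z \<in> ball 0 1"
    then obtain n where "inverse (real (Suc n)) < 1 - norm z"
      using reals_Archimedean[of "1 - norm z"] by auto
    then show "z \<in> (\<Union>n. cball 0 (1 - inverse (real (Suc n))))" by (intro UN_I[of n]) auto
  next
    fix z :: 'a assume "z \<in> (\<Union>n. cball 0 (1 - inverse (real (Suc n))))"
    then obtain n where "norm z \<le> 1 - inverse (real (Suc n))" by auto
    moreover have "0 < inverse (real (Suc n))" by simp
    ultimately show "z \<in> ball 0 1" by (simp only: mem_ball_0)
  qed
  then show ?thesis using fsigma.intros[of "\<lambda>n. cball (0 :: 'a) (1 - inverse (real (Suc n)))"] by simp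
qed

lemma countable_zero_radii:
  assumes "f holomorphic_on ball 0 1" "\<exists>z\<in>ball 0 1. f z \<noteq> (0 :: complex)"
  shows "countable (cmod ` {z \<in> ball 0 1. f z = 0})"
proof (cases "f constant_on ball 0 1")
  case True
  then have "{z \<in> ball 0 1. f z = 0} = {}" using assms(2) by (auto simp: constant_on_def)
  then show ?thesis by (metis countable_empty image_empty)
next
  case False
  then show ?thesis
    using assms(1) fsigma_unit_ball by (intro countable_image holomorphic_countable_zeros) auto
qed

text \<open>The common core of the two norms: \<open>x\<close> parametrises a point by its modulus
  \<open>R x\<close> and its angle \<open>\<tau> x\<close> relative to \<open>\<theta>\<close>. The
  outer power \<open>1 / q\<close> and constant factors are left to the norms.\<close>

definition polar_integral ::
    "'a measure \<Rightarrow> ('a \<Rightarrow> real) \<Rightarrow> ('a \<Rightarrow> real) \<Rightarrow> real \<Rightarrow> real \<Rightarrow> (complex \<Rightarrow> complex) \<Rightarrow> ennreal" where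
  "polar_integral M R \<tau> p q f =
     (\<integral>\<^sup>+\<theta>\<in>{0..2 * pi}. ennreal_powr (\<integral>\<^sup>+x. ennreal (cmod (f (rcis (R x) (\<theta> + \<tau> x))) powr p) \<partial>M) (q / p) \<partial>lborel)"

text \<open>The angle \<open>\<tau> x\<close> only rotates the circle attached to \<open>x\<close>,
  so the bound on a single circle can be inserted for each parameter into
  \<open>vector_maximal\<close>. The hypothesis on countable sets removes the circles through
  zeros.\<close>

lemma (in sigma_finite_measure) polar_integral_nt_max_fun:
  fixes R \<tau> :: "'a \<Rightarrow> real"
  assumes p: "0 < p" and q: "0 < q" and m: "0 < m"
    and [measurable]: "R \<in> borel_measurable M" "\<tau> \<in> borel_measurable M"
    and R: "AE x in M. 0 < R x \<and> R x < 1"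
    and null: "\<And>B. countable B \<Longrightarrow> AE x in M. R x \<notin> B"
  shows "\<exists>C>0. \<forall>f. f holomorphic_on ball 0 1 \<longrightarrow> f \<in> borel_measurable borel \<longrightarrow>
    polar_integral M R \<tau> p q (nt_max_fun m f) \<le> ennreal C * polar_integral M R \<tau> p q f"
proof -
  define a where "a = q / p"
  have a: "0 < a" using p q by (simp add: a_def)
  show ?thesis
  proof (rule vector_maximal[OF a])
    fix P C0 :: real
    assume P: "0 < P" and C0: "0 < C0"
      and FS: "\<And>g :: 'a \<Rightarrow> real \<Rightarrow> ennreal. case_prod g \<in> borel_measurable (M \<Otimes>\<^sub>M borel) \<Longrightarrow>
        (\<integral>\<^sup>+y. ennreal_powr (\<integral>\<^sup>+x. ennreal_powr (hl_max (g x) y) P \<partial>M) a \<partial>lborel)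
        \<le> ennreal C0 * (\<integral>\<^sup>+y. ennreal_powr (\<integral>\<^sup>+x. ennreal_powr (g x y) P \<partial>M) a \<partial>lborel)"
    define s where "s = p / P"
    have s: "0 < s" "s * P = p" using p P by (auto simp: s_def)
    define A where "A = 96 * (m + 2)"
    have A: "0 < A" using m by (simp add: A_def)
    obtain N :: nat where N: "(2 * pi + m + pi) / (2 * pi) \<le> real N" using real_arch_simple by blast
    \<comment> \<open>A whole number of periods, so that the integral over the cut-off window is
      exactly \<open>2 * N\<close> times the integral over one period.\<close>
    define K where "K = real N * (2 * pi)"
    have K: "2 * pi + m + pi \<le> K" using N by (simp add: K_def pos_divide_le_eq)
    have "0 < real N * (2 * pi)" using K m unfolding K_def by (smt (verit) pi_gt_zero)
    then have N0: "0 < N" by (simp add: zero_less_mult_iff)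
    define C where "C = A powr (P * a) * C0 * (2 * N)"
    show ?thesis
    proof (intro exI[of _ C] conjI allI impI)
      show "C > 0" using A C0 N0 by (simp add: C_def)
      fix f :: "complex \<Rightarrow> complex"
      assume f: "f holomorphic_on ball 0 1" and [measurable]: "f \<in> borel_measurable borel"
      let ?L = "\<lambda>\<theta>. \<integral>\<^sup>+x. ennreal_powr (nt_max m f (rcis (R x) (\<theta> + \<tau> x))) p \<partial>M"
      define \<Phi> where "\<Phi> \<theta> = (\<integral>\<^sup>+x. ennreal (cmod (f (rcis (R x) (\<theta> + \<tau> x))) powr p) \<partial>M)" for \<theta>
      have [measurable]: "\<Phi> \<in> borel_measurable borel" unfolding \<Phi>_def by measurable
      have "(\<integral>\<^sup>+\<theta>\<in>{0..2 * pi}. ennreal_powr (?L \<theta>) a \<partial>lborel) \<le> ennreal C * (\<integral>\<^sup>+\<theta>\<in>{0..2 * pi}. ennreal_powr (\<Phi> \<theta>) a \<partial>lborel)"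
      proof (cases "\<exists>z\<in>ball 0 1. f z \<noteq> 0")
        \<comment> \<open>If \<open>f\<close> vanishes on the disc, every circle carries zeros and
          the argument by countability fails; but then the maximal function is
          \<open>0\<close>.\<close>
        case False
        have "nt_max m f \<xi> = 0" for \<xi>
          using False by (auto simp: nt_max_def nt_region_def SUP_eq_const intro!: antisym SUP_least)
        then show ?thesis by simp
      next
        case True
        define g where "g x y = ennreal (cmod (f (rcis (R x) (y + \<tau> x))) powr s) * indicator {-K..K} y" for x y
        have [measurable]: "case_prod g \<in> borel_measurable (M \<Otimes>\<^sub>M borel)" unfolding g_def by measurable
        have [measurable]: "(\<lambda>(x, y). hl_max (g x) y) \<in> borel_measurable (M \<Otimes>\<^sub>M borel)"
          unfolding case_prod_beta by (rule measurable_hl_max_param[where M=M]) measurable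
        \<comment> \<open>The exceptional set of parameters is determined by the radius alone, so it
          serves all \<open>\<theta>\<close> at once.\<close>
        have pw: "AE x in M. \<forall>\<theta>\<in>{0..2 * pi}. ennreal_powr (nt_max m f (rcis (R x) (\<theta> + \<tau> x))) p
            \<le> ennreal (A powr P) * ennreal_powr (hl_max (g x) \<theta>) P"
          using R null[OF countable_zero_radii[OF f True]]
        proof eventually_elim
          fix x assume x: "0 < R x \<and> R x < 1" and z: "R x \<notin> cmod ` {z \<in> ball 0 1. f z = 0}"
          have nz: "f (rcis (R x) t) \<noteq> 0" for t
          proof
            assume "f (rcis (R x) t) = 0"
            then have "cmod (rcis (R x) t) \<in> cmod ` {z \<in> ball 0 1. f z = 0}"
              using x by (intro imageI) simp
            then show False using z x by simp
          qed
          show "\<forall>\<theta>\<in>{0..2 * pi}. ennreal_powr (nt_max m f (rcis (R x) (\<theta> + \<tau> x))) p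
            \<le> ennreal (A powr P) * ennreal_powr (hl_max (g x) \<theta>) P"
          proof
            fix \<theta> assume \<theta>: "\<theta> \<in> {0..2 * pi}"
            have "ennreal_powr (nt_max m f (rcis (R x) (\<theta> + \<tau> x))) s \<le> ennreal A * hl_max (g x) \<theta>"
              unfolding A_def g_def using x \<theta> K by (intro nt_max_le_hl_max f nz s m) auto
            then have "ennreal_powr (ennreal_powr (nt_max m f (rcis (R x) (\<theta> + \<tau> x))) s) P
                \<le> ennreal_powr (ennreal A * hl_max (g x) \<theta>) P"
              using P by (intro ennreal_powr_mono)
            then show "ennreal_powr (nt_max m f (rcis (R x) (\<theta> + \<tau> x))) p
                \<le> ennreal (A powr P) * ennreal_powr (hl_max (g x) \<theta>) P"
              using A s by (simp add: ennreal_powr_ennreal_powr ennreal_powr_mult ennreal_powr_ennreal)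
          qed
        qed
        have "(\<integral>\<^sup>+\<theta>\<in>{0..2 * pi}. ennreal_powr (?L \<theta>) a \<partial>lborel)
          \<le> (\<integral>\<^sup>+\<theta>. ennreal (A powr (P * a)) * ennreal_powr (\<integral>\<^sup>+x. ennreal_powr (hl_max (g x) \<theta>) P \<partial>M) a \<partial>lborel)"
        proof (rule nn_integral_mono)
          fix \<theta>
          show "ennreal_powr (?L \<theta>) a * indicator {0..2 * pi} \<theta>
            \<le> ennreal (A powr (P * a)) * ennreal_powr (\<integral>\<^sup>+x. ennreal_powr (hl_max (g x) \<theta>) P \<partial>M) a"
          proof (cases "\<theta> \<in> {0..2 * pi}")
            case True
            have "?L \<theta> \<le> (\<integral>\<^sup>+x. ennreal (A powr P) * ennreal_powr (hl_max (g x) \<theta>) P \<partial>M)"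
              using pw True by (intro nn_integral_mono_AE) (auto elim!: eventually_mono)
            also have "\<dots> = ennreal (A powr P) * (\<integral>\<^sup>+x. ennreal_powr (hl_max (g x) \<theta>) P \<partial>M)"
              by (rule nn_integral_cmult) measurable
            finally have "ennreal_powr (?L \<theta>) a \<le> ennreal_powr (ennreal (A powr P) * (\<integral>\<^sup>+x. ennreal_powr (hl_max (g x) \<theta>) P \<partial>M)) a"
              using a by (intro ennreal_powr_mono)
            then show ?thesis using True by (simp add: ennreal_powr_mult ennreal_powr_ennreal powr_powr)
          qed simp
        qed
        also have "\<dots> = ennreal (A powr (P * a)) * (\<integral>\<^sup>+\<theta>. ennreal_powr (\<integral>\<^sup>+x. ennreal_powr (hl_max (g x) \<theta>) P \<partial>M) a \<partial>lborel)"
          by (rule nn_integral_cmult) measurable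
        also have "\<dots> \<le> ennreal (A powr (P * a)) * (ennreal C0 * (\<integral>\<^sup>+\<theta>. ennreal_powr (\<integral>\<^sup>+x. ennreal_powr (g x \<theta>) P \<partial>M) a \<partial>lborel))"
          by (intro mult_left_mono FS) auto
        also have "(\<integral>\<^sup>+\<theta>. ennreal_powr (\<integral>\<^sup>+x. ennreal_powr (g x \<theta>) P \<partial>M) a \<partial>lborel)
            = (\<integral>\<^sup>+\<theta>\<in>{-K..K}. ennreal_powr (\<Phi> \<theta>) a \<partial>lborel)"
        proof (rule nn_integral_cong)
          fix \<theta>
          show "ennreal_powr (\<integral>\<^sup>+x. ennreal_powr (g x \<theta>) P \<partial>M) a = ennreal_powr (\<Phi> \<theta>) a * indicator {-K..K} \<theta>"
            by (cases "\<theta> \<in> {-K..K}") (simp_all add: g_def \<Phi>_def ennreal_powr_ennreal powr_powr s)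
        qed
        also have "\<dots> = (\<integral>\<^sup>+\<theta>\<in>{-K..<-K + real (2 * N) * (2 * pi)}. ennreal_powr (\<Phi> \<theta>) a \<partial>lborel)"
          unfolding nn_integral_Icc_eq_Ico by (simp add: K_def algebra_simps)
        also have "\<dots> = of_nat (2 * N) * (\<integral>\<^sup>+\<theta>\<in>{0..<2 * pi}. ennreal_powr (\<Phi> \<theta>) a \<partial>lborel)"
        proof (rule nn_integral_periods)
          fix \<theta>
          have "\<Phi> (\<theta> + 2 * pi) = \<Phi> \<theta>"
            unfolding \<Phi>_def using rcis_add_2pi[of "R x" "\<theta> + \<tau> x" for x] by (simp add: add_ac)
          then show "ennreal_powr (\<Phi> (\<theta> + 2 * pi)) a = ennreal_powr (\<Phi> \<theta>) a" by simp
        qed auto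
        also have "\<dots> = of_nat (2 * N) * (\<integral>\<^sup>+\<theta>\<in>{0..2 * pi}. ennreal_powr (\<Phi> \<theta>) a \<partial>lborel)"
          unfolding nn_integral_Icc_eq_Ico ..
        also have "ennreal (A powr (P * a)) * (ennreal C0 * \<dots>) = ennreal C * (\<integral>\<^sup>+\<theta>\<in>{0..2 * pi}. ennreal_powr (\<Phi> \<theta>) a \<partial>lborel)"
          unfolding C_def using C0 by (simp add: ennreal_mult mult.assoc ennreal_of_nat_eq_real_of_nat)
        finally show ?thesis .
      qed
      moreover have "?L \<theta> = (\<integral>\<^sup>+x. ennreal (cmod (nt_max_fun m f (rcis (R x) (\<theta> + \<tau> x))) powr p) \<partial>M)" for \<theta>
        by (intro nn_integral_cong_AE eventually_mono[OF R]) (auto simp: nt_max_fun_powr f m)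
      ultimately show "polar_integral M R \<tau> p q (nt_max_fun m f) \<le> ennreal C * polar_integral M R \<tau> p q f"
        unfolding polar_integral_def a_def \<Phi>_def by simp
    qed
  qed
qed

section \<open>Polar coordinates\<close>

lemma continuous_Complex: "continuous_on UNIV (\<lambda>x. Complex (fst x) (snd x))"
  unfolding Complex_eq by (intro continuous_intros)

lemma measurable_Complex [measurable]:
  assumes [measurable]: "f \<in> borel_measurable M" "g \<in> borel_measurable M"
  shows "(\<lambda>x. Complex (f x) (g x)) \<in> borel_measurable M"
proof -
  have "(\<lambda>x. Complex (fst x) (snd x)) \<in> borel_measurable (borel :: (real \<times> real) measure)"
    by (rule borel_measurable_continuous_onI[OF continuous_Complex])
  from measurable_compose[OF _ this, of "\<lambda>x. (f x, g x)" M] show ?thesis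
    by (simp add: borel_prod[symmetric])
qed

lemma lborel_complex: "(lborel :: complex measure) = distr (lborel \<Otimes>\<^sub>M lborel) borel (\<lambda>(x, y). Complex x y)"
proof (rule lborel_eqI)
  fix l u :: complex
  assume le: "\<And>b. b \<in> Basis \<Longrightarrow> l \<bullet> b \<le> u \<bullet> b"
  have lu: "Re l \<le> Re u" "Im l \<le> Im u"
    using le[of 1] le[of \<i>] by (auto simp: Basis_complex_def)
  have [measurable]: "(\<lambda>(x, y). Complex x y) \<in> borel_measurable (lborel \<Otimes>\<^sub>M lborel)"
    unfolding case_prod_beta by measurable
  have "(\<lambda>(x, y). Complex x y) -` box l u \<inter> space (lborel \<Otimes>\<^sub>M lborel) = {Re l<..<Re u} \<times> {Im l<..<Im u}"
    by (auto simp: in_box_complex_iff space_pair_measure)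
  then have "emeasure (distr (lborel \<Otimes>\<^sub>M lborel) borel (\<lambda>(x, y). Complex x y)) (box l u)
      = emeasure (lborel \<Otimes>\<^sub>M lborel) ({Re l<..<Re u} \<times> {Im l<..<Im u})"
    by (subst emeasure_distr) auto
  also have "\<dots> = ennreal (Re u - Re l) * ennreal (Im u - Im l)"
    using lu by (subst lborel.emeasure_pair_measure_Times) auto
  also have "\<dots> = (\<Prod>b\<in>Basis. (u - l) \<bullet> b)"
    using lu by (simp add: Basis_complex_def ennreal_mult inner_diff_left)
  finally show "emeasure (distr (lborel \<Otimes>\<^sub>M lborel) borel (\<lambda>(x, y). Complex x y)) (box l u) = (\<Prod>b\<in>Basis. (u - l) \<bullet> b)" .
qed simp

lemma nn_integral_lborel_complex:
  assumes [measurable]: "F \<in> borel_measurable (borel :: complex measure)"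
  shows "(\<integral>\<^sup>+z. F z \<partial>lborel) = (\<integral>\<^sup>+x. (\<integral>\<^sup>+y. F (Complex x y) \<partial>lborel) \<partial>lborel)"
proof -
  have [measurable]: "(\<lambda>(x, y). Complex x y) \<in> borel_measurable (lborel \<Otimes>\<^sub>M lborel)"
    unfolding case_prod_beta by measurable
  have "(\<integral>\<^sup>+z. F z \<partial>lborel) = (\<integral>\<^sup>+z. F (case z of (x, y) \<Rightarrow> Complex x y) \<partial>(lborel \<Otimes>\<^sub>M lborel))"
    unfolding lborel_complex by (rule nn_integral_distr) measurable
  also have "\<dots> = (\<integral>\<^sup>+x. (\<integral>\<^sup>+y. F (Complex x y) \<partial>lborel) \<partial>lborel)"
    by (subst lborel.nn_integral_fst[symmetric]) (simp_all add: case_prod_beta)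
  finally show ?thesis .
qed

lemma nn_integral_tan:
  fixes H :: "real \<Rightarrow> ennreal"
  assumes [measurable]: "H \<in> borel_measurable borel"
  shows "(\<integral>\<^sup>+u. H u \<partial>lborel) = (\<integral>\<^sup>+t\<in>{-pi/2<..<pi/2}. H (tan t) * ennreal (inverse ((cos t)\<^sup>2)) \<partial>lborel)"
proof -
  have [measurable]: "tan \<in> borel_measurable (borel :: real measure)"
    unfolding tan_def by measurable
  \<comment> \<open>The successor keeps the intervals nondegenerate, as the substitution rule
    requires.\<close>
  let ?a = "\<lambda>n. arctan (real (Suc n))"
  have step: "(\<integral>\<^sup>+u\<in>{-real (Suc n)..real (Suc n)}. H u \<partial>lborel)
     = (\<integral>\<^sup>+t\<in>{-?a n..?a n}. H (tan t) * ennreal (inverse ((cos t)\<^sup>2)) \<partial>lborel)" for n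
  proof -
    have *: "cos t \<noteq> 0" if "t \<in> {-?a n..?a n}" for t
    proof -
      have "-(pi/2) < t" "t < pi/2" using that arctan_bounded[of "real (Suc n)"] by auto
      then show ?thesis using cos_gt_zero_pi[of t] by simp
    qed
    have "(\<integral>\<^sup>+u. H u * indicator {tan (-?a n)..tan (?a n)} u \<partial>lborel)
       = (\<integral>\<^sup>+t. H (tan t) * ennreal (inverse ((cos t)\<^sup>2)) * indicator {-?a n..?a n} t \<partial>lborel)"
      using * by (intro nn_integral_substitution_aux)
        (auto intro!: DERIV_tan continuous_intros simp: zero_less_arctan_iff)
    then show ?thesis by (simp add: tan_arctan)
  qed
  have U1: "(\<Union>n. {-real (Suc n)..real (Suc n)}) = UNIV"
  proof (intro equalityI subsetI UNIV_I)
    fix x :: real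
    obtain n where "\<bar>x\<bar> \<le> real n" using real_arch_simple by blast
    then show "x \<in> (\<Union>n. {-real (Suc n)..real (Suc n)})" by (intro UN_I[of n]) auto
  qed
  have U2: "(\<Union>n. {-?a n..?a n}) = {-pi/2<..<pi/2}"
  proof (intro equalityI subsetI)
    fix t assume "t \<in> (\<Union>n. {-?a n..?a n})"
    then obtain n where "-?a n \<le> t" "t \<le> ?a n" by auto
    then show "t \<in> {-pi/2<..<pi/2}" using arctan_bounded[of "real (Suc n)"] by auto
  next
    fix t assume t: "t \<in> {-pi/2<..<pi/2}"
    then have at: "arctan (tan t) = t" by (intro arctan_tan) auto
    obtain n where n: "\<bar>tan t\<bar> \<le> real n" using real_arch_simple by blast
    have "t \<le> ?a n" using n by (subst at[symmetric]) (auto simp: arctan_le_iff)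
    moreover have "-?a n \<le> t"
    proof -
      have "arctan (- real (Suc n)) \<le> arctan (tan t)" using n by (subst arctan_le_iff) auto
      then show ?thesis by (simp only: at arctan_minus)
    qed
    ultimately show "t \<in> (\<Union>n. {-?a n..?a n})" by auto
  qed
  have "(\<integral>\<^sup>+u. H u \<partial>lborel) = (\<integral>\<^sup>+u\<in>(\<Union>n. {-real (Suc n)..real (Suc n)}). H u \<partial>lborel)"
    unfolding U1 by simp
  also have "\<dots> = (SUP n. \<integral>\<^sup>+u\<in>{-real (Suc n)..real (Suc n)}. H u \<partial>lborel)"
    by (rule nn_integral_incseq_SUP) (auto simp: incseq_def)
  also have "\<dots> = (SUP n. \<integral>\<^sup>+t\<in>{-?a n..?a n}. H (tan t) * ennreal (inverse ((cos t)\<^sup>2)) \<partial>lborel)"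
    unfolding step ..
  also have "\<dots> = (\<integral>\<^sup>+t\<in>(\<Union>n. {-?a n..?a n}). H (tan t) * ennreal (inverse ((cos t)\<^sup>2)) \<partial>lborel)"
  proof (rule nn_integral_incseq_SUP[symmetric])
    show "incseq (\<lambda>n. {-?a n..?a n})"
    proof (rule incseq_SucI)
      fix n
      have "?a n \<le> ?a (Suc n)" by (simp add: arctan_le_iff)
      then show "{-?a n..?a n} \<subseteq> {-?a (Suc n)..?a (Suc n)}" by auto
    qed
  qed auto
  finally show ?thesis unfolding U2 .
qed

text \<open>Three substitutions in one variable: \<open>y = x * u\<close>, then
  \<open>u = tan t\<close>, then \<open>x = r * cos t\<close>. Their factors
  \<open>r * cos t\<close>, \<open>1 / (cos t)\<^sup>2\<close> and \<open>cos t\<close> multiply to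
  \<open>r\<close>.\<close>

lemma nn_integral_polar_half_plane:
  assumes [measurable]: "F \<in> borel_measurable (borel :: complex measure)"
  shows "(\<integral>\<^sup>+x\<in>{0<..}. (\<integral>\<^sup>+y. F (Complex x y) \<partial>lborel) \<partial>lborel)
    = (\<integral>\<^sup>+t\<in>{-pi/2<..<pi/2}. (\<integral>\<^sup>+r\<in>{0<..}. F (rcis r t) * ennreal r \<partial>lborel) \<partial>lborel)"
proof -
  define H where "H u = (\<integral>\<^sup>+x. F (Complex x (x * u)) * ennreal x * indicator {0<..} x \<partial>lborel)" for u
  have [measurable]: "H \<in> borel_measurable borel" unfolding H_def by measurable
  have "(\<integral>\<^sup>+x\<in>{0<..}. (\<integral>\<^sup>+y. F (Complex x y) \<partial>lborel) \<partial>lborel)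
      = (\<integral>\<^sup>+x. (\<integral>\<^sup>+u. F (Complex x (x * u)) * ennreal x * indicator {0<..} x \<partial>lborel) \<partial>lborel)"
  proof (rule nn_integral_cong)
    fix x :: real
    show "(\<integral>\<^sup>+y. F (Complex x y) \<partial>lborel) * indicator {0<..} x
      = (\<integral>\<^sup>+u. F (Complex x (x * u)) * ennreal x * indicator {0<..} x \<partial>lborel)"
    proof (cases "0 < x")
      case True
      have "(\<integral>\<^sup>+y. F (Complex x y) \<partial>lborel) = ennreal \<bar>x\<bar> * (\<integral>\<^sup>+u. F (Complex x (0 + x * u)) \<partial>lborel)"
        using True by (intro nn_integral_real_affine) auto
      also have "\<dots> = (\<integral>\<^sup>+u. ennreal x * F (Complex x (x * u)) \<partial>lborel)"
        using True by (subst nn_integral_cmult) simp_all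
      finally show ?thesis using True by (simp add: mult.commute)
    qed simp
  qed
  also have "\<dots> = (\<integral>\<^sup>+u. H u \<partial>lborel)"
    unfolding H_def by (rule lborel_pair.Fubini'[symmetric]) measurable
  also have "\<dots> = (\<integral>\<^sup>+t\<in>{-pi/2<..<pi/2}. H (tan t) * ennreal (inverse ((cos t)\<^sup>2)) \<partial>lborel)"
    by (rule nn_integral_tan) measurable
  also have "\<dots> = (\<integral>\<^sup>+t\<in>{-pi/2<..<pi/2}. (\<integral>\<^sup>+r\<in>{0<..}. F (rcis r t) * ennreal r \<partial>lborel) \<partial>lborel)"
  proof (rule nn_integral_cong)
    fix t :: real
    show "H (tan t) * ennreal (inverse ((cos t)\<^sup>2)) * indicator {-pi/2<..<pi/2} t
      = (\<integral>\<^sup>+r\<in>{0<..}. F (rcis r t) * ennreal r \<partial>lborel) * indicator {-pi/2<..<pi/2} t"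
    proof (cases "t \<in> {-pi/2<..<pi/2}")
      case True
      then have c: "0 < cos t" by (intro cos_gt_zero_pi) auto
      have "H (tan t) = ennreal \<bar>cos t\<bar> * (\<integral>\<^sup>+r. F (Complex (0 + cos t * r) ((0 + cos t * r) * tan t)) * ennreal (0 + cos t * r) * indicator {0<..} (0 + cos t * r) \<partial>lborel)"
        unfolding H_def using c by (intro nn_integral_real_affine) auto
      also have "\<dots> = ennreal (cos t) * (\<integral>\<^sup>+r. ennreal (cos t) * (F (rcis r t) * ennreal r * indicator {0<..} r) \<partial>lborel)"
      proof -
        have "Complex (cos t * r) (cos t * r * tan t) = rcis r t" for r
          using c by (simp add: complex_eq_iff tan_def)
        moreover have "indicator {0<..} (cos t * r) = (indicator {0<..} r :: ennreal)" for r
          using c by (auto simp: zero_less_mult_iff split: split_indicator)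
        moreover have "ennreal (cos t * r) = ennreal (cos t) * ennreal r" for r
          using c by (intro ennreal_mult') simp
        ultimately show ?thesis using c by (simp add: mult_ac)
      qed
      also have "\<dots> = ennreal (cos t) * (ennreal (cos t) * (\<integral>\<^sup>+r\<in>{0<..}. F (rcis r t) * ennreal r \<partial>lborel))"
        by (subst nn_integral_cmult) (auto simp: rcis_def)
      finally have "H (tan t) * ennreal (inverse ((cos t)\<^sup>2))
        = (ennreal (cos t) * ennreal (cos t) * ennreal (inverse ((cos t)\<^sup>2))) * (\<integral>\<^sup>+r\<in>{0<..}. F (rcis r t) * ennreal r \<partial>lborel)"
        by (simp add: mult_ac)
      also have "ennreal (cos t) * ennreal (cos t) * ennreal (inverse ((cos t)\<^sup>2)) = 1"
      proof -
        have "cos t * cos t * inverse ((cos t)\<^sup>2) = 1"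
          using c by (simp add: power2_eq_square field_simps)
        then show ?thesis using c by (simp only: ennreal_mult[symmetric] less_imp_le ennreal_1
            mult_nonneg_nonneg inverse_nonnegative_iff_nonnegative zero_le_power)
      qed
      finally show ?thesis by simp
    qed simp
  qed
  finally show ?thesis .
qed

text \<open>The left half-plane is the right one under \<open>z \<mapsto> - z\<close>, that is, a
  shift of the angle by \<open>pi\<close>. The starting angle is free so that the period can later
  be centred at the axis of a cone.\<close>

lemma nn_integral_polar:
  assumes [measurable]: "F \<in> borel_measurable (borel :: complex measure)"
  shows "(\<integral>\<^sup>+z. F z \<partial>lborel) = (\<integral>\<^sup>+t\<in>{a..<a + 2 * pi}. (\<integral>\<^sup>+r\<in>{0<..}. F (rcis r t) * ennreal r \<partial>lborel) \<partial>lborel)"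
proof -
  define \<Phi> where "\<Phi> t = (\<integral>\<^sup>+r\<in>{0<..}. F (rcis r t) * ennreal r \<partial>lborel)" for t
  have [measurable]: "\<Phi> \<in> borel_measurable borel" unfolding \<Phi>_def by measurable
  have per: "\<Phi> (t + 2 * pi) = \<Phi> t" for t unfolding \<Phi>_def by (simp add: rcis_add_2pi)
  define X where "X x = (\<integral>\<^sup>+y. F (Complex x y) \<partial>lborel)" for x
  have [measurable]: "X \<in> borel_measurable borel" unfolding X_def by measurable
  have "(\<integral>\<^sup>+z. F z \<partial>lborel) = (\<integral>\<^sup>+x. X x \<partial>lborel)"
    unfolding X_def by (rule nn_integral_lborel_complex) measurable
  also have "\<dots> = (\<integral>\<^sup>+x. X x * indicator {0<..} x + X x * indicator {..<0} x \<partial>lborel)"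
    by (intro nn_integral_cong_AE AE_I'[of "{0}"]) (auto split: split_indicator)
  also have "\<dots> = (\<integral>\<^sup>+x\<in>{0<..}. X x \<partial>lborel) + (\<integral>\<^sup>+x\<in>{..<0}. X x \<partial>lborel)"
    by (rule nn_integral_add) measurable
  also have "(\<integral>\<^sup>+x\<in>{..<0}. X x \<partial>lborel) = (\<integral>\<^sup>+x\<in>{0<..}. (\<integral>\<^sup>+y. F (- Complex x y) \<partial>lborel) \<partial>lborel)"
  proof -
    have minus_Complex: "- Complex x y = Complex (- x) (- y)" for x y by (simp add: complex_eq_iff)
    have "X (- x) = (\<integral>\<^sup>+y. F (- Complex x y) \<partial>lborel)" for x
      unfolding X_def using nn_integral_real_affine[of "\<lambda>y. F (Complex (- x) y)" "-1" 0]
      by (simp add: minus_Complex)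
    then show ?thesis
      using nn_integral_real_affine[of "\<lambda>x. X x * indicator {..<0} x" "-1" 0]
      by (auto intro!: nn_integral_cong split: split_indicator)
  qed
  also have "\<dots> = (\<integral>\<^sup>+t\<in>{-pi/2<..<pi/2}. \<Phi> (t + pi) \<partial>lborel)"
  proof -
    have "- rcis r t = rcis r (t + pi)" for r t by (simp add: complex_eq_iff)
    then show ?thesis
      by (subst nn_integral_polar_half_plane) (simp_all add: \<Phi>_def)
  qed
  also have "\<dots> = (\<integral>\<^sup>+t. \<Phi> (t + pi) * indicator {pi/2<..<3*pi/2} (t + pi) \<partial>lborel)"
    by (intro nn_integral_cong) (auto split: split_indicator)
  also have "\<dots> = (\<integral>\<^sup>+t\<in>{pi/2<..<3*pi/2}. \<Phi> t \<partial>lborel)"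
    by (rule nn_integral_shift) measurable
  also have "(\<integral>\<^sup>+x\<in>{0<..}. X x \<partial>lborel) = (\<integral>\<^sup>+t\<in>{-pi/2<..<pi/2}. \<Phi> t \<partial>lborel)"
    unfolding X_def \<Phi>_def by (rule nn_integral_polar_half_plane) measurable
  also have "(\<integral>\<^sup>+t\<in>{-pi/2<..<pi/2}. \<Phi> t \<partial>lborel) + (\<integral>\<^sup>+t\<in>{pi/2<..<3*pi/2}. \<Phi> t \<partial>lborel)
     = (\<integral>\<^sup>+t. \<Phi> t * indicator {-pi/2<..<pi/2} t + \<Phi> t * indicator {pi/2<..<3*pi/2} t \<partial>lborel)"
    by (rule nn_integral_add[symmetric]) measurable
  also have "\<dots> = (\<integral>\<^sup>+t\<in>{-pi/2..<-pi/2 + 2 * pi}. \<Phi> t \<partial>lborel)"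
    by (intro nn_integral_cong_AE AE_I'[of "{-pi/2, pi/2}"])
      (auto intro!: finite_imp_null_set_lborel split: split_indicator)
  also have "\<dots> = (\<integral>\<^sup>+t\<in>{0..<2 * pi}. \<Phi> t \<partial>lborel)"
    by (rule nn_integral_periodic) (auto simp: per)
  also have "\<dots> = (\<integral>\<^sup>+t\<in>{a..<a + 2 * pi}. \<Phi> t \<partial>lborel)"
    by (rule nn_integral_periodic[symmetric]) (auto simp: per)
  finally show ?thesis unfolding \<Phi>_def .
qed

section \<open>The norms in polar coordinates\<close>

lemma L_norm_cong:
  assumes "\<And>z. z \<in> ball 0 1 \<Longrightarrow> f z = g z"
  shows "L_norm p q \<omega> f = L_norm p q \<omega> g"
proof -
  have "ennreal (cmod (f (rcis r \<theta>)) powr p * \<omega> (of_real r) * r) * indicator {0..<1} r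
      = ennreal (cmod (g (rcis r \<theta>)) powr p * \<omega> (of_real r) * r) * indicator {0..<1} r" for r \<theta>
    using assms[of "rcis r \<theta>"] by (auto split: split_indicator)
  then show ?thesis unfolding L_norm_def by (simp only:)
qed

lemma T_norm_cong:
  assumes "\<And>z. z \<in> ball 0 1 \<Longrightarrow> f z = g z"
  shows "T_norm p q \<omega> f = T_norm p q \<omega> g"
proof -
  have "ennreal (cmod (f z) powr p * \<omega> z / (1 - cmod z) * (1 / pi)) * indicator (nt_region 1 (cis \<theta>)) z
      = ennreal (cmod (g z) powr p * \<omega> z / (1 - cmod z) * (1 / pi)) * indicator (nt_region 1 (cis \<theta>)) z" for z \<theta>
    using assms[of z] by (auto simp: nt_region_def split: split_indicator)
  then show ?thesis unfolding T_norm_def by (simp only:)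
qed

text \<open>The density \<open>r\<close> is positive along the ray, so a vanishing polar integral
  yields genuine null sets on almost every ray.\<close>

lemma AE_polar:
  assumes "AE z in (lborel :: complex measure). P z"
  shows "AE t in lborel. t \<in> {0..<2 * pi} \<longrightarrow> (AE r in lborel. 0 < r \<longrightarrow> P (rcis r t))"
proof -
  obtain N where N: "{z. \<not> P z} \<subseteq> N" "N \<in> null_sets lborel"
    using assms unfolding eventually_ae_filter by auto
  then have [measurable]: "N \<in> sets borel" by auto
  have "0 = (\<integral>\<^sup>+z. indicator N z \<partial>lborel)" using null_setsD1[OF N(2)] by simp
  also have "\<dots> = (\<integral>\<^sup>+t\<in>{0..<0 + 2 * pi}. (\<integral>\<^sup>+r\<in>{0<..}. indicator N (rcis r t) * ennreal r \<partial>lborel) \<partial>lborel)"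
    by (rule nn_integral_polar) measurable
  finally have "AE t in lborel. (\<integral>\<^sup>+r\<in>{0<..}. indicator N (rcis r t) * ennreal r \<partial>lborel) * indicator {0..<0 + 2 * pi} t = 0"
    by (subst (asm) eq_commute, subst (asm) nn_integral_0_iff_AE) measurable
  then show ?thesis
  proof eventually_elim
    fix t assume t: "(\<integral>\<^sup>+r\<in>{0<..}. indicator N (rcis r t) * ennreal r \<partial>lborel) * indicator {0..<0 + 2 * pi} t = 0"
    show "t \<in> {0..<2 * pi} \<longrightarrow> (AE r in lborel. 0 < r \<longrightarrow> P (rcis r t))"
    proof
      assume "t \<in> {0..<2 * pi}"
      with t have "(\<integral>\<^sup>+r\<in>{0<..}. indicator N (rcis r t) * ennreal r \<partial>lborel) = 0" by simp
      then have "AE r in lborel. indicator N (rcis r t) * ennreal r * indicator {0<..} r = 0"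
        by (subst (asm) nn_integral_0_iff_AE) measurable
      then show "AE r in lborel. 0 < r \<longrightarrow> P (rcis r t)"
      proof (rule eventually_mono)
        fix r :: real assume "indicator N (rcis r t) * ennreal r * indicator {0<..} r = 0"
        then show "0 < r \<longrightarrow> P (rcis r t)"
          using N(1) by (auto simp: indicator_def split: if_splits)
      qed
    qed
  qed
qed

lemma AE_cmod:
  assumes "AE r in (lborel :: real measure). P r"
  shows "AE z in (lborel :: complex measure). P (cmod z)"
proof -
  obtain N where N: "{r. \<not> P r} \<subseteq> N" "N \<in> null_sets lborel"
    using assms unfolding eventually_ae_filter by auto
  then have [measurable]: "N \<in> sets borel" by auto
  have 0: "(\<integral>\<^sup>+r\<in>{0<..}. indicator N (cmod (rcis r t)) * ennreal r \<partial>lborel) = 0" for t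
  proof -
    have "AE r in lborel. r \<notin> N" using N(2) by (rule AE_not_in)
    then have "AE r in lborel. indicator N (cmod (rcis r t)) * ennreal r * indicator {0<..} r = 0"
      by (rule eventually_mono) (auto split: split_indicator)
    then show ?thesis by (subst nn_integral_0_iff_AE) measurable
  qed
  have "(\<integral>\<^sup>+z. indicator N (cmod z) \<partial>(lborel :: complex measure))
      = (\<integral>\<^sup>+t\<in>{0..<0 + 2 * pi}. (\<integral>\<^sup>+r\<in>{0<..}. indicator N (cmod (rcis r t)) * ennreal r \<partial>lborel) \<partial>lborel)"
    by (rule nn_integral_polar) measurable
  also have "\<dots> = 0" unfolding 0 by simp
  finally have "AE z in (lborel :: complex measure). indicator N (cmod z) = (0 :: ennreal)"
    by (subst (asm) nn_integral_0_iff_AE) measurable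
  then show ?thesis
    by (rule eventually_mono) (use N(1) in \<open>auto simp: indicator_def split: if_splits\<close>)
qed

text \<open>A radial weight is only known to be measurable as a function on the disc; almost every ray
  then provides a Borel version of its profile.\<close>

lemma radial_weight_borel:
  assumes "weight \<omega>" "radial \<omega>"
  obtains w :: "real \<Rightarrow> real" where "w \<in> borel_measurable borel" "\<And>r. 0 \<le> w r"
    "AE r in lborel. r \<in> {0<..<1} \<longrightarrow> \<omega> (of_real r) = w r"
    "AE z in lborel. z \<in> ball 0 1 \<longrightarrow> \<omega> z = w (cmod z)"
proof -
  have "(\<lambda>z. indicator (ball 0 1) z *\<^sub>R \<omega> z) \<in> borel_measurable lebesgue"
    using assms(1) by (auto simp: weight_def set_integrable_def dest: borel_measurable_integrable)
  then obtain h :: "complex \<Rightarrow> real" where h [measurable]: "h \<in> borel_measurable borel"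
      and hae: "AE z in lborel. indicator (ball 0 1) z *\<^sub>R \<omega> z = h z"
    using completion_ex_borel_measurable_real[of _ lborel] by auto
  have "\<exists>t\<in>{0..<2 * pi}. AE r in lborel. 0 < r \<longrightarrow> indicator (ball 0 1) (rcis r t) *\<^sub>R \<omega> (rcis r t) = h (rcis r t)"
  proof (rule ccontr)
    assume "\<not> ?thesis"
    then have "AE t in lborel. t \<notin> {0..<2 * pi}"
      using AE_polar[OF hae] by (auto elim!: eventually_mono)
    then have "emeasure lborel {0..<2 * pi} = 0"
      by (subst (asm) AE_iff_measurable[of "{0..<2 * pi}"]) auto
    then show False by simp
  qed
  then obtain t where t: "AE r in lborel. 0 < r \<longrightarrow> indicator (ball 0 1) (rcis r t) *\<^sub>R \<omega> (rcis r t) = h (rcis r t)"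
    by auto
  define w where "w r = max 0 (h (rcis r t))" for r
  have rad: "\<omega> z = \<omega> (of_real (cmod z))" "0 \<le> \<omega> z" if "z \<in> ball 0 1" for z
    using assms that unfolding radial_def weight_def by blast+
  have ae: "AE r in lborel. r \<in> {0<..<1} \<longrightarrow> \<omega> (of_real r) = w r"
    using t
  proof eventually_elim
    fix r assume r: "0 < r \<longrightarrow> indicator (ball 0 1) (rcis r t) *\<^sub>R \<omega> (rcis r t) = h (rcis r t)"
    show "r \<in> {0<..<1} \<longrightarrow> \<omega> (of_real r) = w r"
    proof
      assume r01: "r \<in> {0<..<1}"
      then have "rcis r t \<in> ball 0 1" by simp
      then show "\<omega> (of_real r) = w r"
        using r rad[of "rcis r t"] r01 by (simp add: w_def)
    qed
  qed
  show thesis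
  proof (rule that[of w])
    show "w \<in> borel_measurable borel" unfolding w_def by measurable
    show "0 \<le> w r" for r by (simp add: w_def)
    have "AE z in lborel. z \<noteq> (0 :: complex)" by (rule AE_lborel_singleton)
    then show "AE z in lborel. z \<in> ball 0 1 \<longrightarrow> \<omega> z = w (cmod z)"
      using AE_cmod[OF ae]
    proof eventually_elim
      fix z :: complex
      assume "z \<noteq> 0" "cmod z \<in> {0<..<1} \<longrightarrow> \<omega> (of_real (cmod z)) = w (cmod z)"
      then show "z \<in> ball 0 1 \<longrightarrow> \<omega> z = w (cmod z)" using rad(1)[of z] by auto
    qed
  qed (rule ae)
qed

text \<open>The measure \<open>w(r) r dr\<close>; radius \<open>0\<close> is left out because the
  bound on circles needs a positive radius.\<close>

definition L_measure :: "(real \<Rightarrow> real) \<Rightarrow> real measure" where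
  "L_measure w = density lborel (\<lambda>r. ennreal (w r * r) * indicator {0<..<1} r)"

text \<open>The parameter is \<open>(r, u)\<close>: the points of modulus \<open>r\<close> in the cone at \<open>cis \<theta>\<close> are
  \<open>rcis r (\<theta> + u * (1 - r))\<close> with \<open>|u| < 1\<close>.\<close>

definition T_measure :: "(real \<Rightarrow> real) \<Rightarrow> (real \<times> real) measure" where
  "T_measure w = density (lborel \<Otimes>\<^sub>M lborel)
    (\<lambda>x. ennreal (w (fst x) * fst x / pi) * indicator {0<..<1} (fst x) * indicator {-1<..<1} (snd x))"

text \<open>Two arguments of the same point differ by a multiple of \<open>2 * pi\<close>; here the
  difference is below \<open>pi + 1 < 2 * pi\<close>, so a single turn already represents the
  cone.\<close>

lemma nt_region_cis:
  assumes "t \<in> {\<theta> - pi..<\<theta> + pi}" "0 < r"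
  shows "rcis r t \<in> nt_region 1 (cis \<theta>) \<longleftrightarrow> \<bar>t - \<theta>\<bar> < 1 - r"
proof
  have eq: "nt_region 1 (cis \<theta>) = {rcis \<rho> \<psi> |\<rho> \<psi>. 0 \<le> \<rho> \<and> \<bar>\<psi> - \<theta>\<bar> < 1 * (1 - \<rho>)}"
    using nt_region_rcis[of 1 1 \<theta>] by (simp add: rcis_def)
  show "rcis r t \<in> nt_region 1 (cis \<theta>)" if "\<bar>t - \<theta>\<bar> < 1 - r"
    using that assms unfolding eq by force
  assume "rcis r t \<in> nt_region 1 (cis \<theta>)"
  then obtain \<rho> \<psi> where \<rho>: "rcis r t = rcis \<rho> \<psi>" "0 \<le> \<rho>" "\<bar>\<psi> - \<theta>\<bar> < 1 - \<rho>"
    unfolding eq by auto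
  have "cmod (rcis r t) = cmod (rcis \<rho> \<psi>)" using \<rho>(1) by simp
  then have r: "\<rho> = r" using \<rho>(2) assms(2) by simp
  with \<rho>(1) assms(2) have "cis t = cis \<psi>" by (simp add: rcis_def)
  then have "sin t = sin \<psi> \<and> cos t = cos \<psi>" by (simp add: complex_eq_iff)
  then obtain n :: int where n: "t = \<psi> + 2 * pi * n" using sin_cos_eq_iff by blast
  have "\<bar>2 * pi * n\<bar> < pi + 1"
    using assms n \<rho>(3) r by (simp add: abs_if split: if_splits)
  also have "\<dots> < 2 * pi" using pi_gt3 by simp
  finally have "2 * pi * \<bar>real_of_int n\<bar> < 2 * pi * 1" by (simp add: abs_mult)
  then have "\<bar>real_of_int n\<bar> < 1" using pi_gt_zero by (subst (asm) mult_less_cancel_left_pos) auto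
  then have "n = 0" by simp
  then show "\<bar>t - \<theta>\<bar> < 1 - r" using n \<rho>(3) r by simp
qed

text \<open>The polar description is open only for positive radii, so the origin is taken out; as a
  single point it does not affect integrals.\<close>

lemma sets_nt_region: "nt_region 1 (cis \<theta>) - {0} \<in> sets borel"
proof -
  have eq: "nt_region 1 (cis \<theta>) = {rcis \<rho> \<psi> |\<rho> \<psi>. 0 \<le> \<rho> \<and> \<bar>\<psi> - \<theta>\<bar> < 1 * (1 - \<rho>)}"
    using nt_region_rcis[of 1 1 \<theta>] by (simp add: rcis_def)
  have "nt_region 1 (cis \<theta>) - {0} = {rcis \<rho> \<psi> |\<rho> \<psi>. 0 < \<rho> \<and> (\<rho>, \<psi>) \<in> {x. \<bar>snd x - \<theta>\<bar> < 1 - fst x}}"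
    unfolding eq by (force simp: less_le)
  moreover have "open {x :: real \<times> real. \<bar>snd x - \<theta>\<bar> < 1 - fst x}"
    by (intro open_Collect_less continuous_intros)
  ultimately show ?thesis by (simp only:) (intro borel_open open_polar)
qed

section \<open>Both norms as polar integrals with one Borel profile of the weight\<close>

context
  fixes \<omega> :: "complex \<Rightarrow> real" and w :: "real \<Rightarrow> real"
  assumes w [measurable]: "w \<in> borel_measurable borel" and w0: "\<And>r. 0 \<le> w r"
    and aeL: "AE r in lborel. r \<in> {0<..<1} \<longrightarrow> \<omega> (of_real r) = w r"
    and aeT: "AE z in lborel. z \<in> ball 0 1 \<longrightarrow> \<omega> z = w (cmod z)"
begin

lemma L_norm_eq:
  assumes [measurable]: "f \<in> borel_measurable borel"
  shows "L_norm p q \<omega> f = ennreal_powr (ennreal (1 / (2 * pi)) *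
    polar_integral (L_measure w) (\<lambda>r. r) (\<lambda>_. 0) p q f) (1 / q)"
proof -
  have "(\<integral>\<^sup>+r\<in>{0..<1}. ennreal (cmod (f (rcis r \<theta>)) powr p * \<omega> (of_real r) * r) \<partial>lebesgue)
      = (\<integral>\<^sup>+x. ennreal (cmod (f (rcis x (\<theta> + 0))) powr p) \<partial>L_measure w)" for \<theta>
  proof -
    let ?A = "\<lambda>r. ennreal (cmod (f (rcis r \<theta>)) powr p * \<omega> (of_real r) * r) * indicator {0..<1} r"
    let ?B = "\<lambda>r. ennreal (w r * r) * indicator {0<..<1} r * ennreal (cmod (f (rcis r \<theta>)) powr p)"
    have "(\<integral>\<^sup>+r\<in>{0..<1}. ennreal (cmod (f (rcis r \<theta>)) powr p * \<omega> (of_real r) * r) \<partial>lebesgue)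
      = (\<integral>\<^sup>+r. ?B r \<partial>lborel)"
      unfolding nn_integral_completion
    proof (rule nn_integral_cong_AE)
      have "AE r in lborel. r \<noteq> (0 :: real)" by (rule AE_lborel_singleton)
      then show "AE r in lborel. ?A r
          = ?B r"
        using aeL
      proof eventually_elim
        fix r :: real
        assume "r \<noteq> 0" "r \<in> {0<..<1} \<longrightarrow> \<omega> (of_real r) = w r"
        then show "?A r
          = ?B r"
          using w0[of r] by (auto simp: mult_ac simp flip: ennreal_mult split: split_indicator)
      qed
    qed
    also have "\<dots> = (\<integral>\<^sup>+x. ennreal (cmod (f (rcis x \<theta>)) powr p) \<partial>L_measure w)"
      unfolding L_measure_def by (rule nn_integral_density[symmetric]) measurable
    finally show ?thesis by simp
  qed
  then show ?thesis unfolding L_norm_def polar_integral_def nn_integral_completion by simp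
qed

lemma T_norm_eq:
  assumes [measurable]: "f \<in> borel_measurable borel"
  shows "T_norm p q \<omega> f = ennreal_powr (polar_integral (T_measure w) fst (\<lambda>x. snd x * (1 - fst x)) p q f) (1 / q)"
proof -
  have "(\<integral>\<^sup>+z\<in>nt_region 1 (cis \<theta>). ennreal (cmod (f z) powr p * \<omega> z / (1 - cmod z) * (1 / pi)) \<partial>lebesgue)
      = (\<integral>\<^sup>+x. ennreal (cmod (f (rcis (fst x) (\<theta> + snd x * (1 - fst x)))) powr p) \<partial>T_measure w)" for \<theta>
  proof -
    let ?A = "\<lambda>z. ennreal (cmod (f z) powr p * \<omega> z / (1 - cmod z) * (1 / pi)) * indicator (nt_region 1 (cis \<theta>)) z"
    let ?K = "\<lambda>r u. ennreal (w r * r / pi) * indicator {0<..<1} r * indicator {-1<..<1} u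
      * ennreal (cmod (f (rcis r (\<theta> + u * (1 - r)))) powr p)"
    define G where "G z = ennreal (cmod (f z) powr p * w (cmod z) / (1 - cmod z) * (1 / pi))" for z
    have [measurable]: "G \<in> borel_measurable borel" unfolding G_def by measurable
    define S where "S = nt_region 1 (cis \<theta>) - {0}"
    have [measurable]: "S \<in> sets borel" unfolding S_def by (rule sets_nt_region)
    define D where "D t r = (if 0 < r \<and> \<bar>t - \<theta>\<bar> < 1 - r then G (rcis r t) * ennreal r else 0)" for t r
    have [measurable]: "case_prod D \<in> borel_measurable (borel \<Otimes>\<^sub>M borel)" unfolding D_def by measurable
    have "(\<integral>\<^sup>+z\<in>nt_region 1 (cis \<theta>). ennreal (cmod (f z) powr p * \<omega> z / (1 - cmod z) * (1 / pi)) \<partial>lebesgue)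
      = (\<integral>\<^sup>+z. G z * indicator S z \<partial>lborel)"
      unfolding nn_integral_completion
    proof (rule nn_integral_cong_AE)
      have "AE z in lborel. z \<noteq> (0 :: complex)" by (rule AE_lborel_singleton)
      then show "AE z in lborel. ?A z
          = G z * indicator S z"
        using aeT
      proof eventually_elim
        fix z :: complex
        assume "z \<noteq> 0" "z \<in> ball 0 1 \<longrightarrow> \<omega> z = w (cmod z)"
        then show "?A z
          = G z * indicator S z"
          by (cases "z \<in> nt_region 1 (cis \<theta>)") (auto simp: G_def S_def nt_region_def)
      qed
    qed
    also have "\<dots> = (\<integral>\<^sup>+t\<in>{\<theta> - pi..<\<theta> - pi + 2 * pi}. (\<integral>\<^sup>+r\<in>{0<..}. G (rcis r t) * indicator S (rcis r t) * ennreal r \<partial>lborel) \<partial>lborel)"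
      by (rule nn_integral_polar) measurable
    also have "\<dots> = (\<integral>\<^sup>+t. (\<integral>\<^sup>+r. D t r \<partial>lborel) \<partial>lborel)"
    proof (rule nn_integral_cong)
      fix t
      show "(\<integral>\<^sup>+r\<in>{0<..}. G (rcis r t) * indicator S (rcis r t) * ennreal r \<partial>lborel) * indicator {\<theta> - pi..<\<theta> - pi + 2 * pi} t
          = (\<integral>\<^sup>+r. D t r \<partial>lborel)"
      proof (cases "t \<in> {\<theta> - pi..<\<theta> + pi}")
        case True
        have "G (rcis r t) * indicator S (rcis r t) * ennreal r * indicator {0<..} r = D t r" for r
          using nt_region_cis[OF True, of r] by (auto simp: S_def D_def split: split_indicator)
        then show ?thesis using True by simp
      next
        \<comment> \<open>Outside the chosen period \<open>\<bar>t - \<theta>\<bar>\<close> is at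
          least \<open>pi\<close>, while the cone needs it below 1.\<close>
        case False
        then have "pi \<le> \<bar>t - \<theta>\<bar>" by auto
        then have "D t r = 0" for r using pi_gt3 by (simp add: D_def)
        moreover have "indicator {\<theta> - pi..<\<theta> - pi + 2 * pi} t = (0 :: ennreal)"
            using False by (auto split: split_indicator)
          ultimately show ?thesis by simp
      qed
    qed
    also have "\<dots> = (\<integral>\<^sup>+r. (\<integral>\<^sup>+t. D t r \<partial>lborel) \<partial>lborel)"
      by (rule lborel_pair.Fubini'[symmetric]) measurable
    also have "\<dots> = (\<integral>\<^sup>+r. (\<integral>\<^sup>+u. ?K r u \<partial>lborel) \<partial>lborel)"
    proof (rule nn_integral_cong)
      fix r :: real
      show "(\<integral>\<^sup>+t. D t r \<partial>lborel) = (\<integral>\<^sup>+u. ?K r u \<partial>lborel)"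
      proof (cases "r \<in> {0<..<1}")
        case True
        have "(\<integral>\<^sup>+t. D t r \<partial>lborel) = ennreal \<bar>1 - r\<bar> * (\<integral>\<^sup>+u. D (\<theta> + (1 - r) * u) r \<partial>lborel)"
          using True by (intro nn_integral_real_affine) auto
        also have "\<dots> = (\<integral>\<^sup>+u. ennreal (1 - r) * D (\<theta> + (1 - r) * u) r \<partial>lborel)"
          using True by (subst nn_integral_cmult) simp_all
        also have "\<dots> = (\<integral>\<^sup>+u. ?K r u \<partial>lborel)"
        proof (rule nn_integral_cong)
          fix u
          have "\<bar>\<theta> + (1 - r) * u - \<theta>\<bar> < 1 - r \<longleftrightarrow> u \<in> {-1<..<1}"
            using True by (auto simp: abs_mult abs_less_iff)
          \<comment> \<open>The Jacobian \<open>1 - r\<close> of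
            \<open>t = \<theta> + (1 - r) * u\<close> cancels the factor
            \<open>1 / (1 - cmod z)\<close> of the tent norm.\<close>
          moreover have "ennreal (1 - r) * (G (rcis r t) * ennreal r) = ennreal (w r * r / pi) * ennreal (cmod (f (rcis r t)) powr p)" for t
          proof -
            have eq: "(1 - r) * (X * w r / (1 - r) * (1 / pi) * r) = w r * r / pi * X" for X :: real
              using True by simp
            have G: "G (rcis r t) = ennreal (cmod (f (rcis r t)) powr p * w r / (1 - r) * (1 / pi))"
              using True by (simp add: G_def)
            have "ennreal (1 - r) * (G (rcis r t) * ennreal r)
                = ennreal ((1 - r) * (cmod (f (rcis r t)) powr p * w r / (1 - r) * (1 / pi) * r))"
              unfolding G using True w0[of r] by (subst ennreal_mult, simp, simp, subst ennreal_mult) simp_all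
            also have "\<dots> = ennreal (w r * r / pi) * ennreal (cmod (f (rcis r t)) powr p)"
              unfolding eq using True w0[of r] by (intro ennreal_mult) simp_all
            finally show ?thesis .
          qed
          ultimately show "ennreal (1 - r) * D (\<theta> + (1 - r) * u) r = ?K r u"
            using True by (simp add: D_def mult.commute[of u] split: split_indicator)
        qed
        finally show ?thesis .
      next
        case False
        then have "D t r = 0" for t by (auto simp: D_def)
        then show ?thesis using False by simp
      qed
    qed
    also have "\<dots> = (\<integral>\<^sup>+x. ennreal (w (fst x) * fst x / pi) * indicator {0<..<1} (fst x) * indicator {-1<..<1} (snd x)
         * ennreal (cmod (f (rcis (fst x) (\<theta> + snd x * (1 - fst x)))) powr p) \<partial>(lborel \<Otimes>\<^sub>M lborel))"
      by (subst lborel.nn_integral_fst[symmetric]) simp_all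
    also have "\<dots> = (\<integral>\<^sup>+x. ennreal (cmod (f (rcis (fst x) (\<theta> + snd x * (1 - fst x)))) powr p) \<partial>T_measure w)"
      unfolding T_measure_def by (rule nn_integral_density[symmetric]) measurable
    finally show ?thesis .
  qed
  then show ?thesis unfolding T_norm_def polar_integral_def nn_integral_completion by simp
qed

section \<open>The parameter measures: sigma-finiteness and negligible radii\<close>

lemma sigma_finite_L_measure: "sigma_finite_measure (L_measure w)"
  unfolding L_measure_def
  by (subst sigma_finite_measure.sigma_finite_iff_density_finite[OF sigma_finite_lborel]) (auto simp: ennreal_mult_eq_top_iff split: split_indicator)

lemma sigma_finite_T_measure: "sigma_finite_measure (T_measure w)"
proof -
  have S: "sigma_finite_measure (lborel \<Otimes>\<^sub>M lborel :: (real \<times> real) measure)"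
    unfolding lborel_prod by (rule sigma_finite_lborel)
  show ?thesis
    unfolding T_measure_def
    by (subst sigma_finite_measure.sigma_finite_iff_density_finite[OF S]) (auto simp: ennreal_mult_eq_top_iff split: split_indicator)
qed

lemma sets_L_measure [measurable_cong]: "sets (L_measure w) = sets borel"
  by (simp add: L_measure_def)

lemma sets_T_measure [measurable_cong]: "sets (T_measure w) = sets (borel \<Otimes>\<^sub>M borel)"
  unfolding T_measure_def sets_density by (intro sets_pair_measure_cong) auto

lemma AE_L_measure: "AE r in L_measure w. 0 < r \<and> r < 1"
  unfolding L_measure_def by (subst AE_density) (auto split: split_indicator)

lemma AE_T_measure: "AE x in T_measure w. 0 < fst x \<and> fst x < 1"
  unfolding T_measure_def by (subst AE_density) (auto split: split_indicator)

lemma AE_L_measure_countable: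
  assumes "countable B"
  shows "AE r in L_measure w. r \<notin> B"
proof -
  have "AE r in lborel. r \<notin> B"
    by (rule AE_not_in[OF countable_imp_null_set_lborel[OF assms]])
  then show ?thesis
    unfolding L_measure_def by (subst AE_density) (auto elim: eventually_mono)
qed

lemma AE_T_measure_countable:
  assumes "countable B"
  shows "AE x in T_measure w. fst x \<notin> B"
proof -
  have B: "B \<in> null_sets lborel" by (rule countable_imp_null_set_lborel[OF assms])
  then have Bs: "B \<in> sets lborel" by (rule null_setsD2)
  have "emeasure (lborel \<Otimes>\<^sub>M lborel) (B \<times> (UNIV :: real set)) = emeasure lborel B * emeasure lborel (UNIV :: real set)"
    by (rule lborel.emeasure_pair_measure_Times) (use Bs in simp_all)
  then have "B \<times> (UNIV :: real set) \<in> null_sets (lborel \<Otimes>\<^sub>M lborel)"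
    using null_setsD1[OF B] Bs by (intro null_setsI) simp_all
  then have "AE x in lborel \<Otimes>\<^sub>M (lborel :: real measure). x \<notin> B \<times> UNIV" by (rule AE_not_in)
  then show ?thesis
    unfolding T_measure_def by (subst AE_density) (auto elim!: eventually_mono)
qed

section \<open>Restoring the outer power\<close>

lemma L_norm_nt_max_fun:
  assumes pq: "0 < p" "0 < q" "0 < m"
  shows "\<exists>C>0. \<forall>f. f holomorphic_on ball 0 1 \<longrightarrow> f \<in> borel_measurable borel \<longrightarrow>
    L_norm p q \<omega> (nt_max_fun m f) \<le> ennreal C * L_norm p q \<omega> f"
proof -
  let ?I = "polar_integral (L_measure w) (\<lambda>r. r) (\<lambda>_. 0) p q"
  have "\<exists>C>0. \<forall>f. f holomorphic_on ball 0 1 \<longrightarrow> f \<in> borel_measurable borel \<longrightarrow>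
    ?I (nt_max_fun m f) \<le> ennreal C * ?I f"
  proof (rule sigma_finite_measure.polar_integral_nt_max_fun[OF sigma_finite_L_measure pq])
    show "(\<lambda>r. r) \<in> borel_measurable (L_measure w)" "(\<lambda>_. 0) \<in> borel_measurable (L_measure w)"
      by (simp_all add: measurable_ident_sets sets_L_measure)
    show "AE x in L_measure w. 0 < x \<and> x < 1" by (rule AE_L_measure)
    show "AE x in L_measure w. x \<notin> B" if "countable B" for B
      using that by (rule AE_L_measure_countable)
  qed
  then obtain C where C: "0 < C" "\<And>f. f holomorphic_on ball 0 1 \<Longrightarrow> f \<in> borel_measurable borel \<Longrightarrow>
    ?I (nt_max_fun m f) \<le> ennreal C * ?I f" by blast
  show ?thesis
  proof (intro exI[of _ "C powr (1 / q)"] conjI allI impI)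
    fix f :: "complex \<Rightarrow> complex" assume f: "f holomorphic_on ball 0 1" "f \<in> borel_measurable borel"
    have "L_norm p q \<omega> (nt_max_fun m f) \<le> ennreal_powr (ennreal (1 / (2 * pi)) * (ennreal C * ?I f)) (1 / q)"
      unfolding L_norm_eq[OF measurable_nt_max_fun[OF pq(3)]]
      using pq by (intro ennreal_powr_mono mult_left_mono C f) auto
    also have "\<dots> = ennreal (C powr (1 / q)) * L_norm p q \<omega> f"
      using C(1) unfolding L_norm_eq[OF f(2)] by (simp add: ennreal_powr_mult ennreal_powr_ennreal mult_ac)
    finally show "L_norm p q \<omega> (nt_max_fun m f) \<le> ennreal (C powr (1 / q)) * L_norm p q \<omega> f" .
  qed (use C in simp)
qed

lemma T_norm_nt_max_fun:
  assumes pq: "0 < p" "0 < q" "0 < m"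
  shows "\<exists>C>0. \<forall>f. f holomorphic_on ball 0 1 \<longrightarrow> f \<in> borel_measurable borel \<longrightarrow>
    T_norm p q \<omega> (nt_max_fun m f) \<le> ennreal C * T_norm p q \<omega> f"
proof -
  let ?I = "polar_integral (T_measure w) fst (\<lambda>x. snd x * (1 - fst x)) p q"
  have "\<exists>C>0. \<forall>f. f holomorphic_on ball 0 1 \<longrightarrow> f \<in> borel_measurable borel \<longrightarrow>
    ?I (nt_max_fun m f) \<le> ennreal C * ?I f"
  proof (rule sigma_finite_measure.polar_integral_nt_max_fun[OF sigma_finite_T_measure pq])
    show "fst \<in> borel_measurable (T_measure w)" "(\<lambda>x. snd x * (1 - fst x)) \<in> borel_measurable (T_measure w)"
      by measurable
    show "AE x in T_measure w. 0 < fst x \<and> fst x < 1" by (rule AE_T_measure)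
    show "AE x in T_measure w. fst x \<notin> B" if "countable B" for B
      using that by (rule AE_T_measure_countable)
  qed
  then obtain C where C: "0 < C" "\<And>f. f holomorphic_on ball 0 1 \<Longrightarrow> f \<in> borel_measurable borel \<Longrightarrow>
    ?I (nt_max_fun m f) \<le> ennreal C * ?I f" by blast
  show ?thesis
  proof (intro exI[of _ "C powr (1 / q)"] conjI allI impI)
    fix f :: "complex \<Rightarrow> complex" assume f: "f holomorphic_on ball 0 1" "f \<in> borel_measurable borel"
    have "T_norm p q \<omega> (nt_max_fun m f) \<le> ennreal_powr ((ennreal C * ?I f)) (1 / q)"
      unfolding T_norm_eq[OF measurable_nt_max_fun[OF pq(3)]]
      using pq by (intro ennreal_powr_mono mult_left_mono C f) auto
    also have "\<dots> = ennreal (C powr (1 / q)) * T_norm p q \<omega> f"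
      using C(1) unfolding T_norm_eq[OF f(2)] by (simp add: ennreal_powr_mult ennreal_powr_ennreal mult_ac)
    finally show "T_norm p q \<omega> (nt_max_fun m f) \<le> ennreal (C powr (1 / q)) * T_norm p q \<omega> f" .
  qed (use C in simp)
qed

end

theorem theorem1p1:
  fixes p q M :: real and \<omega> :: "complex \<Rightarrow> real"
  assumes "0 < p" and "0 < q" and "0 < M"
    and "weight \<omega>" and "radial \<omega>"
    and "\<forall>z\<in>ball 0 1. 0 < weight_hat \<omega> z"
  shows "\<exists>C>0::real.
    (\<forall>f\<in>AL_space p q \<omega>.
       (\<forall>\<xi>\<in>ball 0 1. nt_max M f \<xi> < \<infinity>) \<and>
       nt_max_fun M f \<in> L_space p q \<omega> \<and>
       L_norm p q \<omega> (nt_max_fun M f) \<le> ennreal C * L_norm p q \<omega> f) \<and>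
    (\<forall>f\<in>AT_space p q \<omega>.
       (\<forall>\<xi>\<in>ball 0 1. nt_max M f \<xi> < \<infinity>) \<and>
       nt_max_fun M f \<in> T_space p q \<omega> \<and>
       T_norm p q \<omega> (nt_max_fun M f) \<le> ennreal C * T_norm p q \<omega> f)"
proof -
  obtain w where w: "w \<in> borel_measurable borel" "\<And>r. 0 \<le> w r"
    "AE r in lborel. r \<in> {0<..<1} \<longrightarrow> \<omega> (of_real r) = w r"
    "AE z in lborel. z \<in> ball 0 1 \<longrightarrow> \<omega> z = w (cmod z)"
    using radial_weight_borel[OF assms(4,5)] by blast
  obtain C1 where C1: "0 < C1" "\<And>f. f holomorphic_on ball 0 1 \<Longrightarrow> f \<in> borel_measurable borel \<Longrightarrow>
      L_norm p q \<omega> (nt_max_fun M f) \<le> ennreal C1 * L_norm p q \<omega> f"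
    using L_norm_nt_max_fun[OF w assms(1-3)] by blast
  obtain C2 where C2: "0 < C2" "\<And>f. f holomorphic_on ball 0 1 \<Longrightarrow> f \<in> borel_measurable borel \<Longrightarrow>
      T_norm p q \<omega> (nt_max_fun M f) \<le> ennreal C2 * T_norm p q \<omega> f"
    using T_norm_nt_max_fun[OF w assms(1-3)] by blast
  have norms: "L_norm p q \<omega> (nt_max_fun M f) \<le> ennreal (max C1 C2) * L_norm p q \<omega> f"
      "T_norm p q \<omega> (nt_max_fun M f) \<le> ennreal (max C1 C2) * T_norm p q \<omega> f"
    if f: "f holomorphic_on ball 0 1" for f
  proof -
    \<comment> \<open>The polar estimates need a function that is Borel on the whole plane. Cutting
      \<open>f\<close> off outside the disc provides one and changes neither the norms nor the
      maximal function.\<close>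
    define g where "g z = (if z \<in> ball 0 1 then f z else 0)" for z
    have fg: "f z = g z" if "z \<in> ball 0 1" for z using that by (simp add: g_def)
    have g: "g holomorphic_on ball 0 1" using f by (rule holomorphic_transform) (rule fg)
    have gm: "g \<in> borel_measurable borel"
      unfolding g_def using holomorphic_on_imp_continuous_on[OF f]
      by (intro borel_measurable_continuous_on_if) (auto intro: continuous_intros)
    have "nt_max_fun M f = nt_max_fun M g"
      unfolding nt_max_fun_def using nt_max_cong[OF fg] by simp
    then have "L_norm p q \<omega> (nt_max_fun M f) \<le> ennreal C1 * L_norm p q \<omega> f"
        "T_norm p q \<omega> (nt_max_fun M f) \<le> ennreal C2 * T_norm p q \<omega> f"
      using C1(2)[OF g gm] C2(2)[OF g gm] L_norm_cong[OF fg] T_norm_cong[OF fg] by simp_all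
    then show "L_norm p q \<omega> (nt_max_fun M f) \<le> ennreal (max C1 C2) * L_norm p q \<omega> f"
        "T_norm p q \<omega> (nt_max_fun M f) \<le> ennreal (max C1 C2) * T_norm p q \<omega> f"
      by (auto elim!: order_trans intro!: mult_right_mono ennreal_leI)
  qed
  have meas: "nt_max_fun M f \<in> borel_measurable (lebesgue_on (ball 0 1))" for f
    by (intro measurable_restrict_space1 measurable_completion) (simp add: measurable_nt_max_fun assms(3))
  have fin: "ennreal (max C1 C2) * x < \<infinity>" if "x < \<infinity>" for x
    using that by (simp add: ennreal_mult_less_top)
  show ?thesis
  proof (intro exI[of _ "max C1 C2"] conjI ballI)
    show "0 < max C1 C2" using C1(1) by simp
  next
    fix f assume "f \<in> AL_space p q \<omega>"
    then have f: "f holomorphic_on ball 0 1" "L_norm p q \<omega> f < \<infinity>"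
      by (auto simp: AL_space_def L_space_def)
    show "nt_max M f \<xi> < \<infinity>" if "\<xi> \<in> ball 0 1" for \<xi> using nt_max_finite f(1) assms(3) that by blast
    show "L_norm p q \<omega> (nt_max_fun M f) \<le> ennreal (max C1 C2) * L_norm p q \<omega> f" by (rule norms(1)[OF f(1)])
    then show "nt_max_fun M f \<in> L_space p q \<omega>"
      unfolding L_space_def using meas fin[OF f(2)] by (auto intro: le_less_trans)
  next
    fix f assume "f \<in> AT_space p q \<omega>"
    then have f: "f holomorphic_on ball 0 1" "T_norm p q \<omega> f < \<infinity>"
      by (auto simp: AT_space_def T_space_def)
    show "nt_max M f \<xi> < \<infinity>" if "\<xi> \<in> ball 0 1" for \<xi> using nt_max_finite f(1) assms(3) that by blast
    show "T_norm p q \<omega> (nt_max_fun M f) \<le> ennreal (max C1 C2) * T_norm p q \<omega> f" by (rule norms(2)[OF f(1)])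
    then show "nt_max_fun M f \<in> T_space p q \<omega>"
      unfolding T_space_def using meas fin[OF f(2)] by (auto intro: le_less_trans)
  qed
qed

end
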